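(* Assume that $A_0^{-1}$ is a compact operator in $H$ and that $0\notin\sigma_{ess}(A_0^{-1}D)$, where $A_0^{-1}D$ is considered as a bounded operator acting in $H_{1/2}$. Then $\mathcal{A}$ generates an analytic semigroup on $H_{1/2}\times H$.
   Context: Setting. $H$ is an infinite-dimensional complex Hilbert space with inner product $\langle\cdot,\cdot\rangle$ and norm $\|\cdot\|$. $A_0:\mathrm{dom}(A_0)\subset H\to H$ is a self-adjoint, uniformly positive operator (so $A_0\ge \varepsilon I$ for some $\varepsilon>0$). $H_{1/2}:=\mathrm{dom}(A_0^{1/2})$ is equipped with the norm $\|z\|_{H_{1/2}}:=\|A_0^{1/2}z\|$ (and the corresponding inner product), and $H_{-1/2}=H_{1/2}^*$ is its dual with respect to the pivot space $H$, i.e. the completion of $H$ with respect to $\|z\|_{H_{-1/2}}=\|A_0^{-1/2}z\|$. The duality pairing $\langle z',z\rangle_{H_{-1/2}\times H_{1/2}}$ equals $\langle z',z\rangle$ if $z'\in H$. $A_0$ is also regarded as a bounded, boundedly invertible operator $A_0:H_{1/2}\to H_{-1/2}$. The operator $D:H_{1/2}\to H_{-1/2}$ is bounded, $A_0^{-1/2}DA_0^{-1/2}$ is a bounded self-adjoint operator in $H$, and $\langle Dz,z\rangle_{H_{-1/2}\times H_{1/2}}\ge 0$ for all $z\in H_{1/2}$. The operator $\mathcal{A}$ in the Hilbert space $H_{1/2}\times H$ is $$\mathcal{A}=\begin{bmatrix}0&I\\ -A_0&-D\end{bmatrix},\qquad \mathrm{dom}(\mathcal{A})=\left\{\begin{bmatrix}z\\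 w\end{bmatrix}\in H_{1/2}\times H_{1/2}\ \middle|\ A_0z+Dw\in H\right\}.$$ For a closed operator $T$, $\sigma_{ess}(T)=\{\lambda\in\mathbb{C}\mid T-\lambda I\text{ is not Fredholm}\}$, where an operator is Fredholm if its kernel has finite dimension and its range has finite codimension. *)

theory Defs
  imports "HOL-Analysis.Analysis"
begin

section \<open>Complex vector spaces and complex Hilbert spaces\<close>

class complex_vector = real_vector +
  fixes scaleC :: "complex \<Rightarrow> 'a \<Rightarrow> 'a"  (infixr \<open>*\<^sub>C\<close> 75)
  assumes scaleR_scaleC: "r *\<^sub>R x = complex_of_real r *\<^sub>C x"
    and scaleC_add_right: "a *\<^sub>C (x + y) = a *\<^sub>C x + a *\<^sub>C y"
    and scaleC_add_left: "(a + b) *\<^sub>C x = a *\<^sub>C x + b *\<^sub>C x"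
    and scaleC_scaleC: "a *\<^sub>C b *\<^sub>C x = (a * b) *\<^sub>C x"
    and scaleC_one: "1 *\<^sub>C x = x"

global_interpretation complex_vector:
  vector_space "scaleC :: complex \<Rightarrow> 'a \<Rightarrow> 'a::complex_vector"
  by unfold_locales
    (simp_all add: scaleC_add_right scaleC_add_left scaleC_scaleC scaleC_one)

instantiation prod :: (complex_vector, complex_vector) complex_vector
begin

definition scaleC_prod :: "complex \<Rightarrow> 'a \<times> 'b \<Rightarrow> 'a \<times> 'b"
  where "scaleC_prod a x = (a *\<^sub>C fst x, a *\<^sub>C snd x)"

instance
  by standard
    (auto simp: scaleC_prod_def scaleR_prod_def scaleR_scaleC scaleC_add_right
      scaleC_add_left scaleC_scaleC scaleC_one)

end

text \<open>The inner product is linear in its first and antilinear in its second argument.\<close>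

class chilbert_space = complex_vector + banach +
  fixes cinner :: "'a \<Rightarrow> 'a \<Rightarrow> complex"
  assumes cinner_commute: "cinner x y = cnj (cinner y x)"
    and cinner_add_left: "cinner (x + y) z = cinner x z + cinner y z"
    and cinner_scaleC_left: "cinner (a *\<^sub>C x) y = a * cinner x y"
    and norm_eq_sqrt_cinner: "norm x = sqrt (Re (cinner x x))"

section \<open>Operators on subspaces\<close>

text \<open>
  An operator is given by its domain (a set) and a function of which only the values on that
  domain matter. A normed space that is not a type of its own, such as the domain of a square
  root with the norm transported by it, is given by a carrier set \<open>X\<close> and its norm \<open>N\<close>.
\<close>

definition clinear_on :: "'a::complex_vector set \<Rightarrow> ('a \<Rightarrow> 'b::complex_vector) \<Rightarrow> bool" where
  "clinear_on S f \<longleftrightarrow> complex_vector.subspace S \<and>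
     (\<forall>x\<in>S. \<forall>y\<in>S. f (x + y) = f x + f y) \<and> (\<forall>c. \<forall>x\<in>S. f (c *\<^sub>C x) = c *\<^sub>C f x)"

definition bounded_op :: "'a::complex_vector set \<Rightarrow> ('a \<Rightarrow> real) \<Rightarrow> ('a \<Rightarrow> 'a) \<Rightarrow> bool" where
  "bounded_op X N T \<longleftrightarrow> clinear_on X T \<and> T ` X \<subseteq> X \<and> (\<exists>C. \<forall>x\<in>X. N (T x) \<le> C * N x)"

definition fin_dim :: "'a::complex_vector set \<Rightarrow> bool" where
  "fin_dim S \<longleftrightarrow> (\<exists>B. finite B \<and> S \<subseteq> complex_vector.span B)"

definition fin_codim :: "'a::complex_vector set \<Rightarrow> 'a set \<Rightarrow> bool" where
  "fin_codim X S \<longleftrightarrow> (\<exists>B. finite B \<and> B \<subseteq> X \<and> X \<subseteq> complex_vector.span (S \<union> B))"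

definition fredholm :: "'a::complex_vector set \<Rightarrow> 'a set \<Rightarrow> ('a \<Rightarrow> 'a) \<Rightarrow> bool" where
  "fredholm X S T \<longleftrightarrow> fin_dim {x\<in>S. T x = 0} \<and> fin_codim X (T ` S)"

definition ess_spectrum :: "'a::complex_vector set \<Rightarrow> 'a set \<Rightarrow> ('a \<Rightarrow> 'a) \<Rightarrow> complex set" where
  "ess_spectrum X S T = {\<mu>. \<not> fredholm X S (\<lambda>x. T x - \<mu> *\<^sub>C x)}"

definition compact_op :: "('a::chilbert_space \<Rightarrow> 'a) \<Rightarrow> bool" where
  "compact_op T \<longleftrightarrow> clinear_on UNIV T \<and> (\<forall>S. bounded S \<longrightarrow> compact (closure (T ` S)))"

text \<open>The last conjunct says that the graph of the operator is the graph of its adjoint.\<close>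

definition self_adjoint :: "'a::chilbert_space set \<Rightarrow> ('a \<Rightarrow> 'a) \<Rightarrow> bool" where
  "self_adjoint S A \<longleftrightarrow> clinear_on S A \<and> closure S = UNIV \<and>
     (\<forall>y z. (y \<in> S \<and> z = A y) \<longleftrightarrow> (\<forall>x\<in>S. cinner (A x) y = cinner x z))"

definition uniformly_positive :: "'a::chilbert_space set \<Rightarrow> ('a \<Rightarrow> 'a) \<Rightarrow> bool" where
  "uniformly_positive S A \<longleftrightarrow> (\<exists>\<epsilon>>0. \<forall>x\<in>S. Re (cinner (A x) x) \<ge> \<epsilon> * (norm x)\<^sup>2)"

text \<open>
  \<open>(V, R)\<close> is the square root of \<open>(S, A)\<close>: the (unique) nonnegative self-adjoint operator
  whose square, on its natural domain, is \<open>(S, A)\<close>.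
\<close>

definition is_sqrt_op ::
  "'a::chilbert_space set \<Rightarrow> ('a \<Rightarrow> 'a) \<Rightarrow> 'a set \<Rightarrow> ('a \<Rightarrow> 'a) \<Rightarrow> bool" where
  "is_sqrt_op V R S A \<longleftrightarrow> self_adjoint V R \<and> (\<forall>x\<in>V. Re (cinner (R x) x) \<ge> 0) \<and>
     S = {x\<in>V. R x \<in> V} \<and> (\<forall>x\<in>S. A x = R (R x))"

section \<open>The scale \<open>H\<^bsub>1/2\<^esub> \<subseteq> H \<subseteq> H\<^bsub>-1/2\<^esub>\<close>\<close>

text \<open>
  Throughout, \<open>(V, R)\<close> stands for the square root of \<open>A\<^sub>0\<close>. The space \<open>H\<^bsub>1/2\<^esub>\<close> is \<open>V\<close> with the
  norm \<open>half_norm R\<close>. An element \<open>f\<close> of \<open>H\<^bsub>-1/2\<^esub>\<close> is a bounded antilinear functional on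
  \<open>H\<^bsub>1/2\<^esub>\<close>, extended by 0 outside \<open>V\<close>, so that the duality pairing of \<open>f\<close> with \<open>v \<in> V\<close> is
  \<open>f v\<close> and \<open>h \<in> H\<close> is identified with \<open>\<lambda>v. cinner h v\<close>.
\<close>

definition half_norm :: "('h::chilbert_space \<Rightarrow> 'h) \<Rightarrow> 'h \<Rightarrow> real" where
  "half_norm R z = norm (R z)"

definition dual_space :: "'h::chilbert_space set \<Rightarrow> ('h \<Rightarrow> 'h) \<Rightarrow> ('h \<Rightarrow> complex) set" where
  "dual_space V R = {f. (\<forall>x\<in>V. \<forall>y\<in>V. f (x + y) = f x + f y) \<and>
     (\<forall>c. \<forall>x\<in>V. f (c *\<^sub>C x) = cnj c * f x) \<and>
     (\<exists>C. \<forall>x\<in>V. cmod (f x) \<le> C * half_norm R x) \<and> (\<forall>x. x \<notin> V \<longrightarrow> f x = 0)}"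

definition dual_norm ::
  "'h::chilbert_space set \<Rightarrow> ('h \<Rightarrow> 'h) \<Rightarrow> ('h \<Rightarrow> complex) \<Rightarrow> real" where
  "dual_norm V R f = (SUP x\<in>{x\<in>V. half_norm R x \<le> 1}. cmod (f x))"

definition embed :: "'h::chilbert_space set \<Rightarrow> 'h \<Rightarrow> 'h \<Rightarrow> complex" where
  "embed V h = (\<lambda>v. if v \<in> V then cinner h v else 0)"

text \<open>The extension of \<open>A\<^sub>0\<^bsup>1/2\<^esup>\<close> to an operator from \<open>H\<close> to \<open>H\<^bsub>-1/2\<^esub>\<close>.\<close>

definition sqrt_ext :: "'h::chilbert_space set \<Rightarrow> ('h \<Rightarrow> 'h) \<Rightarrow> 'h \<Rightarrow> 'h \<Rightarrow> complex" where
  "sqrt_ext V R h = (\<lambda>v. if v \<in> V then cinner h (R v) else 0)"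

text \<open>
  The extension of \<open>A\<^sub>0\<close> to an operator from \<open>H\<^bsub>1/2\<^esub>\<close> to \<open>H\<^bsub>-1/2\<^esub>\<close>. It agrees with \<open>A\<^sub>0\<close> on
  \<open>dom A\<^sub>0\<close>, since \<open>cinner (A\<^sub>0 z) v = cinner (R z) (R v)\<close> there.
\<close>

definition A0_ext :: "'h::chilbert_space set \<Rightarrow> ('h \<Rightarrow> 'h) \<Rightarrow> 'h \<Rightarrow> 'h \<Rightarrow> complex" where
  "A0_ext V R z = sqrt_ext V R (R z)"

definition bounded_half_to_dual ::
  "'h::chilbert_space set \<Rightarrow> ('h \<Rightarrow> 'h) \<Rightarrow> ('h \<Rightarrow> 'h \<Rightarrow> complex) \<Rightarrow> bool" where
  "bounded_half_to_dual V R D \<longleftrightarrow> D ` V \<subseteq> dual_space V R \<and>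
     (\<forall>x\<in>V. \<forall>y\<in>V. D (x + y) = (\<lambda>v. D x v + D y v)) \<and>
     (\<forall>c. \<forall>x\<in>V. D (c *\<^sub>C x) = (\<lambda>v. c * D x v)) \<and>
     (\<exists>C. \<forall>x\<in>V. dual_norm V R (D x) \<le> C * half_norm R x)"

text \<open>\<open>A\<^sub>0\<^bsup>-1/2\<^esup> D A\<^sub>0\<^bsup>-1/2\<^esup>\<close> as an operator in \<open>H\<close>.\<close>

definition sandwich ::
  "'h::chilbert_space set \<Rightarrow> ('h \<Rightarrow> 'h) \<Rightarrow> ('h \<Rightarrow> 'h \<Rightarrow> complex) \<Rightarrow> 'h \<Rightarrow> 'h" where
  "sandwich V R D x = inv (sqrt_ext V R) (D (inv_into V R x))"

text \<open>\<open>A\<^sub>0\<^sup>-\<^sup>1 D\<close> as an operator in \<open>H\<^bsub>1/2\<^esub>\<close>.\<close>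

definition A0_inv_D ::
  "'h::chilbert_space set \<Rightarrow> ('h \<Rightarrow> 'h) \<Rightarrow> ('h \<Rightarrow> 'h \<Rightarrow> complex) \<Rightarrow> 'h \<Rightarrow> 'h" where
  "A0_inv_D V R D z = inv_into V (A0_ext V R) (D z)"

section \<open>The block operator on \<open>H\<^bsub>1/2\<^esub> \<times> H\<close>\<close>

definition state_space :: "'h::chilbert_space set \<Rightarrow> ('h \<times> 'h) set" where
  "state_space V = V \<times> UNIV"

definition state_norm :: "('h::chilbert_space \<Rightarrow> 'h) \<Rightarrow> 'h \<times> 'h \<Rightarrow> real" where
  "state_norm R p = sqrt ((half_norm R (fst p))\<^sup>2 + (norm (snd p))\<^sup>2)"

definition block_dom ::
  "'h::chilbert_space set \<Rightarrow> ('h \<Rightarrow> 'h) \<Rightarrow> ('h \<Rightarrow> 'h \<Rightarrow> complex) \<Rightarrow> ('h \<times> 'h) set" where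
  "block_dom V R D =
     {(z, w). z \<in> V \<and> w \<in> V \<and> (\<lambda>v. A0_ext V R z v + D w v) \<in> range (embed V)}"

definition block_op ::
  "'h::chilbert_space set \<Rightarrow> ('h \<Rightarrow> 'h) \<Rightarrow> ('h \<Rightarrow> 'h \<Rightarrow> complex) \<Rightarrow> 'h \<times> 'h \<Rightarrow> 'h \<times> 'h" where
  "block_op V R D = (\<lambda>(z, w). (w, inv (embed V) (\<lambda>v. - A0_ext V R z v - D w v)))"

section \<open>Analytic semigroups\<close>

definition sector :: "real \<Rightarrow> complex set" where
  "sector \<theta> = {z. z \<noteq> 0 \<and> \<bar>Arg z\<bar> < \<theta>}"

text \<open>
  The third conjunct is the semigroup law, the fourth is complex differentiability of
  \<open>z \<mapsto> T z\<close> in the operator norm, with derivative \<open>L\<close>, and the last is strong continuity at 0.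
\<close>

definition analytic_semigroup ::
  "'a::complex_vector set \<Rightarrow> ('a \<Rightarrow> real) \<Rightarrow> real \<Rightarrow> (complex \<Rightarrow> 'a \<Rightarrow> 'a) \<Rightarrow> bool" where
  "analytic_semigroup X N \<theta> T \<longleftrightarrow>
     (\<forall>z\<in>insert 0 (sector \<theta>). bounded_op X N (T z)) \<and>
     (\<forall>x\<in>X. T 0 x = x) \<and>
     (\<forall>z\<in>sector \<theta>. \<forall>w\<in>sector \<theta>. \<forall>x\<in>X. T (z + w) x = T z (T w x)) \<and>
     (\<forall>z\<in>sector \<theta>. \<exists>L. bounded_op X N L \<and>
        (\<forall>\<epsilon>>0. \<forall>\<^sub>F w in at z. \<forall>x\<in>X.
           N (inverse (w - z) *\<^sub>C (T w x - T z x) - L x) \<le> \<epsilon> * N x)) \<and>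
     (\<forall>x\<in>X. ((\<lambda>z. N (T z x - x)) \<longlongrightarrow> 0) (at 0 within sector \<theta>))"

definition is_generator ::
  "'a::complex_vector set \<Rightarrow> ('a \<Rightarrow> real) \<Rightarrow> (complex \<Rightarrow> 'a \<Rightarrow> 'a) \<Rightarrow> 'a set \<Rightarrow> ('a \<Rightarrow> 'a) \<Rightarrow> bool"
  where
  "is_generator X N T S A \<longleftrightarrow>
     (\<forall>x y. (x \<in> S \<and> y = A x) \<longleftrightarrow> (x \<in> X \<and> y \<in> X \<and>
        ((\<lambda>t::real. N ((1 / t) *\<^sub>R (T (complex_of_real t) x - x) - y)) \<longlongrightarrow> 0) (at_right 0)))"

definition generates_analytic_semigroup ::
  "'a::complex_vector set \<Rightarrow> ('a \<Rightarrow> real) \<Rightarrow> 'a set \<Rightarrow> ('a \<Rightarrow> 'a) \<Rightarrow> bool" where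
  "generates_analytic_semigroup X N S A \<longleftrightarrow>
     (\<exists>\<theta> T. 0 < \<theta> \<and> \<theta> \<le> pi / 2 \<and> analytic_semigroup X N \<theta> T \<and> is_generator X N T S A)"

end

theory Submission
  imports Defs "HOL-Complex_Analysis.Cauchy_Integral_Formula"
begin

text \<open>
  In the coordinates \<open>(A\<^sub>0\<^sup>1\<^sup>/\<^sup>2 z, w)\<close> and with \<open>M = A\<^sub>0\<^sup>-\<^sup>1\<^sup>/\<^sup>2 D A\<^sub>0\<^sup>-\<^sup>1\<^sup>/\<^sup>2\<close>, the numerical range of \<open>\<A>\<close> at
  \<open>(x, w)\<close> is \<open>2\<i> Im \<langle>p, x\<rangle> - \<langle>M p, p\<rangle>\<close>, where \<open>p = A\<^sub>0\<^sup>1\<^sup>/\<^sup>2 w\<close>. That \<open>M\<close> is Fredholm gives, by uniform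
  boundedness, \<open>|p|\<^sup>2 \<le> C (\<langle>M p, p\<rangle> + \<Sum> |\<langle>p, b\<rangle>|\<^sup>2)\<close> with finitely many vectors \<open>b\<close>; approximating these
  by elements of \<open>dom A\<^sub>0\<^sup>1\<^sup>/\<^sup>2\<close> replaces the sum by a multiple of \<open>|w|\<^sup>2\<close>. Hence a translate of \<open>\<A>\<close> has its
  numerical range in a sector of the left half plane, and it is maximal since the resolvent
  equation reduces to a coercive one. For such an operator the implicit Euler approximations
  \<open>(1 - z/N \<A>)\<^sup>-\<^sup>N\<close> are contractions on a sector and converge there, uniformly on bounded sets, to
  the semigroup; analyticity passes to the limit.
\<close>

section \<open>Complex Hilbert spaces\<close>

text \<open>The obstacle is the imaginary part of the numerical range: since \<open>R\<close> is
  unbounded, \<open>cinner (R w) x\<close> is not controlled by the norm of \<open>(x, w)\<close>,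
  and only the damping form can dominate it. \<open>R\<close> maps \<open>V\<close> with
  \<open>half_norm R\<close> isometrically onto H and conjugates A0^(-1) D into \<open>M\<close>;
  this is how the hypothesis on the essential spectrum reaches \<open>M\<close>. Symmetry of
  \<open>M\<close> exchanges finite codimension of its range for a lower bound, and positivity
  replaces \<open>norm (M p)\<close> by the square root of the form.

  Euler approximations are chosen since they need nothing but the resolvents on the sector: these
  are commuting contractions, so the error after N steps is at most N times the error of one step,
  which is quadratic in the step on the domain of the square of the operator. Complex step sizes
  treat all rays at once. Holomorphy is obtained for scalar functions; Cauchy estimates whose
  constants depend only on the norms of the two vectors then lift it to the operator norm. All this
  is done on whole types, and the carrier-set formulation of the statement is reached by an isometry
  at the end.\<close>

lemma scaleC_zero_left [simp]: "0 *\<^sub>C (x::'a::complex_vector) = 0"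
  by (rule complex_vector.scale_zero_left)

lemma scaleC_zero_right [simp]: "a *\<^sub>C (0::'a::complex_vector) = 0"
  by (rule complex_vector.scale_zero_right)

lemma scaleC_minus_left: "(- a) *\<^sub>C (x::'a::complex_vector) = - (a *\<^sub>C x)"
  by (rule complex_vector.scale_minus_left)

lemma scaleC_minus_right: "a *\<^sub>C (- x::'a::complex_vector) = - (a *\<^sub>C x)"
  by (rule complex_vector.scale_minus_right)

lemma scaleC_diff_right: "a *\<^sub>C (x - y::'a::complex_vector) = a *\<^sub>C x - a *\<^sub>C y"
  by (rule complex_vector.scale_right_diff_distrib)

lemma scaleC_diff_left: "(a - b) *\<^sub>C (x::'a::complex_vector) = a *\<^sub>C x - b *\<^sub>C x"
  by (rule complex_vector.scale_left_diff_distrib)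

context
  fixes x y z :: "'a::chilbert_space"
begin

lemma cinner_add_right: "cinner x (y + z) = cinner x y + cinner x z"
  by (metis cinner_commute cinner_add_left complex_cnj_add)

lemma cinner_scaleC_right: "cinner x (a *\<^sub>C y) = cnj a * cinner x y"
  by (metis cinner_commute cinner_scaleC_left complex_cnj_mult)

lemma cinner_zero_left [simp]: "cinner 0 y = 0"
  using cinner_scaleC_left[of 0 x y] by simp

lemma cinner_zero_right [simp]: "cinner x 0 = 0"
  using cinner_scaleC_right[of 0] by simp

lemma cinner_minus_left: "cinner (- x) y = - cinner x y"
  using cinner_scaleC_left[of "-1" x y] by (simp add: scaleC_minus_left scaleC_one)

lemma cinner_minus_right: "cinner x (- y) = - cinner x y"
  using cinner_scaleC_right[of "-1"] by (simp add: scaleC_minus_left scaleC_one)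

end

lemma cinner_diff_left: "cinner (x - y) z = cinner x z - cinner y (z::'a::chilbert_space)"
  using cinner_add_left[of x "- y" z] by (simp add: cinner_minus_left)

lemma cinner_diff_right: "cinner x (y - z) = cinner x y - cinner x (z::'a::chilbert_space)"
  using cinner_add_right[of x y "- z"] by (simp add: cinner_minus_right)

lemmas cinner_simps = cinner_add_left cinner_add_right cinner_diff_left cinner_diff_right
  cinner_scaleC_left cinner_scaleC_right cinner_minus_left cinner_minus_right

lemma cinner_self: "cinner x x = complex_of_real ((norm (x::'a::chilbert_space))\<^sup>2)"
proof -
  have "Im (cinner x x) = 0"
    using arg_cong[OF cinner_commute[of x x], of Im] by simp
  moreover have "Re (cinner x x) \<ge> 0"
    by (metis norm_eq_sqrt_cinner norm_ge_zero real_sqrt_ge_0_iff)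
  then have "Re (cinner x x) = (norm x)\<^sup>2"
    by (simp add: norm_eq_sqrt_cinner)
  ultimately show ?thesis
    by (simp add: complex_eq_iff)
qed

lemma norm_scaleC: "norm (a *\<^sub>C x) = cmod a * norm (x::'a::chilbert_space)"
proof -
  have "complex_of_real ((norm (a *\<^sub>C x))\<^sup>2) = complex_of_real ((cmod a * norm x)\<^sup>2)"
    unfolding cinner_self[symmetric] cinner_scaleC_left cinner_scaleC_right
    using complex_norm_square[of a] by (simp add: cinner_self power_mult_distrib ac_simps)
  then have "(norm (a *\<^sub>C x))\<^sup>2 = (cmod a * norm x)\<^sup>2"
    using of_real_eq_iff by blast
  then show ?thesis
    by (simp add: power2_eq_iff_nonneg)
qed

lemma Re_cinner_commute: "Re (cinner x y) = Re (cinner y (x::'a::chilbert_space))"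
  by (subst cinner_commute) simp

lemma norm_add_square: "(norm (x + y))\<^sup>2 = (norm x)\<^sup>2 + 2 * Re (cinner x y) + (norm (y::'a::chilbert_space))\<^sup>2"
proof -
  have "(norm (x + y))\<^sup>2 = Re (cinner (x + y) (x + y))"
    by (simp add: cinner_self del: of_real_power)
  also have "\<dots> = (norm x)\<^sup>2 + Re (cinner x y) + Re (cinner y x) + (norm y)\<^sup>2"
    unfolding cinner_add_left cinner_add_right by (simp add: cinner_self del: of_real_power)
  finally show ?thesis
    using Re_cinner_commute[of x y] by linarith
qed

lemma norm_diff_square: "(norm (x - y))\<^sup>2 = (norm x)\<^sup>2 - 2 * Re (cinner x y) + (norm (y::'a::chilbert_space))\<^sup>2"
  using norm_add_square[of x "- y"] by (simp add: cinner_minus_right)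

text \<open>Cauchy-Schwarz: the squared distance from \<open>x\<close> to its projection
  \<open>a *\<^sub>C y\<close> on the line of \<open>y\<close> is nonnegative.\<close>

lemma cmod_cinner_le: "cmod (cinner x y) \<le> norm x * norm (y::'a::chilbert_space)"
proof (cases "y = 0")
  case False
  define a where "a = cinner x y / of_real ((norm y)\<^sup>2)"
  have n: "(norm y)\<^sup>2 \<noteq> 0" using False by simp
  have "cinner x (a *\<^sub>C y) = of_real ((cmod (cinner x y))\<^sup>2 / (norm y)\<^sup>2)"
    using complex_norm_square[of "cinner x y"] by (simp add: cinner_simps a_def mult.commute)
  then have "Re (cinner x (a *\<^sub>C y)) = (cmod (cinner x y))\<^sup>2 / (norm y)\<^sup>2"
    by (simp only: Re_complex_of_real)
  moreover have "(norm (a *\<^sub>C y))\<^sup>2 = (cmod (cinner x y))\<^sup>2 / (norm y)\<^sup>2"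
    using False by (simp add: norm_scaleC a_def norm_divide power_mult_distrib power_divide power2_eq_square norm_mult)
  ultimately have "0 \<le> (norm x)\<^sup>2 - (cmod (cinner x y))\<^sup>2 / (norm y)\<^sup>2"
    using norm_diff_square[of x "a *\<^sub>C y"] by (metis (no_types, opaque_lifting) diff_add_eq diff_diff_eq2 mult_2 zero_le_power2 add_diff_cancel_right' diff_diff_add)
  then have "(cmod (cinner x y))\<^sup>2 \<le> (norm x * norm y)\<^sup>2"
    using False by (simp add: field_simps)
  then show ?thesis
    by (rule power2_le_imp_le) simp
qed simp

lemma Re_cinner_le: "Re (cinner x y) \<le> norm x * norm (y::'a::chilbert_space)"
  using complex_Re_le_cmod cmod_cinner_le order_trans by blast

lemma cinner_eqI:
  assumes "\<And>y. cinner x y = cinner x' (y::'a::chilbert_space)"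
  shows "x = x'"
proof -
  have "cinner (x - x') (x - x') = 0"
    using assms[of "x - x'"] by (simp add: cinner_diff_left)
  then show ?thesis by (simp add: cinner_self)
qed

lemma bounded_bilinear_cinner: "bounded_bilinear (cinner :: 'a::chilbert_space \<Rightarrow> 'a \<Rightarrow> complex)"
proof
  show "\<exists>K. \<forall>a b::'a. cmod (cinner a b) \<le> norm a * norm b * K"
    by (rule exI[of _ 1]) (simp add: cmod_cinner_le)
qed (simp_all add: cinner_simps scaleR_scaleC scaleR_conv_of_real)

lemma bounded_bilinear_scaleC: "bounded_bilinear (scaleC :: complex \<Rightarrow> 'a::chilbert_space \<Rightarrow> 'a)"
proof
  show "\<exists>K. \<forall>a. \<forall>b::'a. norm (a *\<^sub>C b) \<le> norm a * norm b * K"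
    by (rule exI[of _ 1]) (simp add: norm_scaleC)
qed (simp_all add: scaleC_add_left scaleC_add_right scaleR_scaleC scaleC_scaleC scaleR_conv_of_real ac_simps)

lemmas tendsto_cinner = bounded_bilinear.tendsto[OF bounded_bilinear_cinner]
lemmas tendsto_scaleC = bounded_bilinear.tendsto[OF bounded_bilinear_scaleC]

lemma dense_cinner_zero:
  assumes "closure S = UNIV" and "\<And>v. v \<in> S \<Longrightarrow> cinner h v = 0"
  shows "h = (0::'a::chilbert_space)"
proof -
  obtain s where s: "\<And>n. s n \<in> S" "s \<longlonglongrightarrow> h"
    using assms(1) closure_sequential by (metis UNIV_I)
  have "(\<lambda>n. cinner h (s n)) \<longlonglongrightarrow> cinner h h"
    by (intro tendsto_cinner s tendsto_const)
  then have "cinner h h = 0"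
    using s(1) assms(2) by (simp add: LIMSEQ_const_iff)
  then show ?thesis by (simp add: cinner_self)
qed

text \<open>In energy coordinates the state space is the full product of H with itself, so the
  product has to be a Hilbert space in its own right for the abstract generation result to
  apply.\<close>

instantiation prod :: (chilbert_space, chilbert_space) chilbert_space
begin

definition cinner_prod :: "'a \<times> 'b \<Rightarrow> 'a \<times> 'b \<Rightarrow> complex"
  where "cinner_prod x y = cinner (fst x) (fst y) + cinner (snd x) (snd y)"

instance
proof
  fix x y z :: "'a \<times> 'b" and a :: complex
  show "cinner x y = cnj (cinner y x)"
    by (simp add: cinner_prod_def cinner_commute[of "fst x"] cinner_commute[of "snd x"])
  show "cinner (x + y) z = cinner x z + cinner y z"
    by (simp add: cinner_prod_def cinner_add_left)
  show "cinner (a *\<^sub>C x) y = a * cinner x y"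
    by (simp add: cinner_prod_def scaleC_prod_def cinner_scaleC_left distrib_left)
  show "norm x = sqrt (Re (cinner x x))"
    by (simp add: cinner_prod_def norm_prod_def cinner_self del: of_real_power)
qed

end

section \<open>Functional analysis in complex Hilbert spaces\<close>

text \<open>Variational proof: the representing vector minimises \<open>J\<close>, the parallelogram
  law makes minimising sequences Cauchy, and the first variation vanishes at the minimum. Since
  \<open>g\<close> is antilinear, the vector appears in the first slot of the inner product.\<close>

lemma riesz_representation:
  fixes g :: "'a::chilbert_space \<Rightarrow> complex"
  assumes add: "\<And>x y. g (x + y) = g x + g y"
    and scale: "\<And>c x. g (c *\<^sub>C x) = cnj c * g x"
    and bound: "\<And>x. cmod (g x) \<le> C * norm x"
  obtains h where "\<And>y. g y = cinner h y"
proof -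
  define J where "J y = (norm y)\<^sup>2 - 2 * Re (g y)" for y
  have scaleR: "g (r *\<^sub>R x) = of_real r * g x" for r x
    by (simp add: scaleR_scaleC scale)
  have lower: "J y \<ge> - C\<^sup>2" for y
  proof -
    have "Re (g y) \<le> C * norm y"
      using bound[of y] complex_Re_le_cmod order_trans by blast
    moreover have "(norm y - C)\<^sup>2 \<ge> 0" by simp
    ultimately show ?thesis unfolding J_def power2_diff by (simp add: mult.commute)
  qed
  define m where "m = Inf (range J)"
  have bdd: "bdd_below (range J)"
    using lower by (intro bdd_belowI2[of _ "- C\<^sup>2"]) auto
  have m_le: "m \<le> J y" for y
    unfolding m_def by (rule cINF_lower[OF bdd]) simp
  have "\<exists>y. J y < m + 1 / real (Suc n)" for n
    using cINF_less_iff[of UNIV J "m + 1 / real (Suc n)"] bdd unfolding m_def by auto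
  then obtain s where s: "\<And>n. J (s n) < m + 1 / real (Suc n)" by metis
  \<comment> \<open>Parallelogram law, with \<open>m\<close> bounding \<open>J\<close> from below at
    the midpoint.\<close>
  have mid: "(norm (y - y'))\<^sup>2 \<le> 2 * J y + 2 * J y' - 4 * m" for y y'
  proof -
    have g: "Re (g ((1/2) *\<^sub>R (y + y'))) = (Re (g y) + Re (g y')) / 2"
      by (simp add: scaleR add del: scaleR_add_right)
    have n: "(norm ((1/2) *\<^sub>R (y + y')))\<^sup>2 = (norm (y + y'))\<^sup>2 / 4"
      by (simp add: power_mult_distrib power_divide del: scaleR_add_right)
    show ?thesis
      using m_le[of "(1/2) *\<^sub>R (y + y')"] norm_add_square[of y y'] norm_diff_square[of y y']
      unfolding J_def g n by argo
  qed
  have "Cauchy s"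
  proof (rule metric_CauchyI)
    fix e :: real assume e: "e > 0"
    obtain N where N: "1 / real (Suc N) < e\<^sup>2 / 4"
      using e by (metis nat_approx_posE divide_pos_pos zero_less_numeral zero_less_power)
    have "dist (s i) (s j) < e" if ij: "i \<ge> N" "j \<ge> N" for i j
    proof -
      have near: "J (s k) < m + e\<^sup>2 / 4" if "k \<ge> N" for k
      proof -
        have "1 / real (Suc k) \<le> 1 / real (Suc N)" using that by (simp add: frac_le)
        then show ?thesis using s[of k] N by simp
      qed
      have "(norm (s i - s j))\<^sup>2 < e\<^sup>2"
        using mid[of "s i" "s j"] near[OF ij(1)] near[OF ij(2)] by linarith
      then show ?thesis using e by (simp add: dist_norm power2_less_imp_less)
    qed
    then show "\<exists>M. \<forall>i\<ge>M. \<forall>j\<ge>M. dist (s i) (s j) < e" by blast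
  qed
  then obtain h where h: "s \<longlonglongrightarrow> h"
    using Cauchy_convergent convergent_def by blast
  have lin: "bounded_linear g"
    by (rule bounded_linear_intro[where K = C])
      (simp_all add: add scaleR scaleR_conv_of_real bound mult.commute)
  have "(\<lambda>n. J (s n)) \<longlonglongrightarrow> J h"
    unfolding J_def by (intro tendsto_intros h bounded_linear.tendsto[OF lin])
  moreover have "(\<lambda>n. m + 1 / real (Suc n)) \<longlonglongrightarrow> m + 0"
    by (rule tendsto_add[OF tendsto_const LIMSEQ_Suc[OF lim_1_over_n]])
  ultimately have "J h \<le> m"
    using s by (metis (mono_tags, lifting) LIMSEQ_le add.right_neutral less_imp_le)
  then have min: "J h \<le> J y" for y
    using m_le order_trans by blast
  have Re_eq: "Re (cinner h v) = Re (g v)" for v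
  proof (rule ccontr)
    assume ne: "Re (cinner h v) \<noteq> Re (g v)"
    define d where "d = Re (cinner h v) - Re (g v)"
    \<comment> \<open>A step against the slope \<open>d\<close>; the summand 1 keeps the denominator
      positive without a case split on \<open>v = 0\<close>.\<close>
    define t where "t = - d / ((norm v)\<^sup>2 + 1)"
    have "J (h + t *\<^sub>R v) = J h + (t\<^sup>2 * (norm v)\<^sup>2 + 2 * t * d)"
      unfolding J_def d_def norm_add_square add scaleR
      by (simp add: scaleR_scaleC cinner_simps norm_scaleC power_mult_distrib algebra_simps)
    moreover have "t\<^sup>2 * (norm v)\<^sup>2 + 2 * t * d < 0"
    proof -
      have p: "(norm v)\<^sup>2 + 1 > 0" by (smt (verit) zero_le_power2)
      have d: "d = - t * ((norm v)\<^sup>2 + 1)" using p by (simp add: t_def)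
      have "t \<noteq> 0" using ne p by (simp add: t_def d_def)
      then have "t\<^sup>2 > 0" by simp
      moreover have "t\<^sup>2 * (norm v)\<^sup>2 \<ge> 0" by simp
      ultimately show ?thesis unfolding d by (simp add: power2_eq_square algebra_simps)
    qed
    ultimately show False using min[of "h + t *\<^sub>R v"] by simp
  qed
  have "g y = cinner h y" for y
  proof (rule complex_eqI)
    \<comment> \<open>The imaginary part at \<open>y\<close> is the real part at
      \<open>\<i> *\<^sub>C y\<close>.\<close>
    show "Im (g y) = Im (cinner h y)"
      using Re_eq[of "\<i> *\<^sub>C y"] by (simp add: scale cinner_simps)
  qed (simp add: Re_eq)
  then show thesis using that by blast
qed

text \<open>Uniform boundedness principle for the functionals given by \<open>P\<close>: by Baire,
  one of the closed sets \<open>F n\<close> contains a ball, and testing with a vector of length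
  \<open>r\<close> in direction \<open>p\<close> reads off the norm.\<close>

lemma cinner_bounded_imp_norm_bounded:
  fixes P :: "'a::chilbert_space set"
  assumes "\<And>y. \<exists>K. \<forall>p\<in>P. cmod (cinner p y) \<le> K"
  obtains K where "\<And>p. p \<in> P \<Longrightarrow> norm p \<le> K"
proof -
  define F where "F n = {y::'a. \<forall>p\<in>P. cmod (cinner p y) \<le> real n}" for n
  have closed: "closed (F n)" for n
  proof -
    have "continuous_on UNIV (\<lambda>y::'a. cmod (cinner p y))" for p
      by (intro continuous_intros bounded_bilinear.continuous_on[OF bounded_bilinear_cinner])
    then have "closed {y::'a. cmod (cinner p y) \<le> real n}" for p
      by (intro closed_Collect_le continuous_on_const)
    then have "closed (\<Inter>p\<in>P. {y::'a. cmod (cinner p y) \<le> real n})" by blast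
    moreover have "F n = (\<Inter>p\<in>P. {y::'a. cmod (cinner p y) \<le> real n})"
      by (auto simp: F_def)
    ultimately show ?thesis by simp
  qed
  have "\<exists>n. interior (F n) \<noteq> {}"
  proof (rule ccontr)
    assume no: "\<not> ?thesis"
    have "interior (\<Union> (range F)) = {}"
      using Met_TC.metric_Baire_category_alt[of "range F"] no closed
      by (force simp: complete_UNIV)
    moreover have "\<Union> (range F) = UNIV"
    proof -
      have "\<exists>n. y \<in> F n" for y
      proof -
        obtain K where K: "\<forall>p\<in>P. cmod (cinner p y) \<le> K" using assms by blast
        obtain n where "K \<le> real n" using real_arch_simple by blast
        then have "y \<in> F n" using K unfolding F_def by fastforce
        then show ?thesis by blast
      qed
      then show ?thesis by blast
    qed
    ultimately show False by simp
  qed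
  then obtain n c where "c \<in> interior (F n)" by blast
  then obtain r where r: "r > 0" "cball c r \<subseteq> F n"
    by (meson mem_interior_cball)
  have "norm p \<le> 2 * real n / r" if p: "p \<in> P" for p
  proof (cases "p = 0")
    case False
    define v where "v = (r / norm p) *\<^sub>R p"
    have "c + v \<in> cball c r" "c \<in> cball c r" using r False by (auto simp: v_def dist_norm)
    then have "cmod (cinner p (c + v)) \<le> real n" "cmod (cinner p c) \<le> real n"
      using r p unfolding F_def by blast+
    then have "cmod (cinner p v) \<le> 2 * real n"
      using norm_triangle_ineq4[of "cinner p (c + v)" "cinner p c"] by (simp add: cinner_add_right)
    moreover have "cinner p v = of_real (r * norm p)"
      using False by (simp add: v_def scaleR_scaleC cinner_simps cinner_self power2_eq_square)
    ultimately have "r * norm p \<le> 2 * real n"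
      using r by (simp add: norm_mult)
    then show ?thesis using r by (simp add: field_simps)
  qed (use r in simp)
  then show thesis using that by blast
qed

text \<open>Lax-Milgram by Banach's fixed point theorem: a small step against the residual
  \<open>Q p - h\<close> is a contraction.\<close>

lemma coercive_surj:
  fixes Q :: "'a::chilbert_space \<Rightarrow> 'a"
  assumes diff: "\<And>x y. Q (x - y) = Q x - Q y"
    and bound: "\<And>x. norm (Q x) \<le> C * norm x"
    and coercive: "\<And>x. Re (cinner (Q x) x) \<ge> \<delta> * (norm x)\<^sup>2" and "\<delta> > 0"
  obtains p where "Q p = h"
proof -
  define C' where "C' = max C (\<delta> + 1)"
  have C': "norm (Q x) \<le> C' * norm x" for x
    using bound[of x] by (smt (verit) C'_def max.cobounded1 mult_right_mono norm_ge_zero)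
  have C'pos: "C' > \<delta>" "C' > 0" using \<open>\<delta> > 0\<close> by (auto simp: C'_def)
  \<comment> \<open>This \<open>t\<close> minimises
    \<open>1 - 2 * t * \<delta> + t\<^sup>2 * C'\<^sup>2\<close>, the bound for the squared
    contraction factor, and \<open>q\<close> is the minimum; \<open>C' > \<delta>\<close> keeps
    \<open>q\<close> nonnegative.\<close>
  define t where "t = \<delta> / C'\<^sup>2"
  define q where "q = 1 - \<delta>\<^sup>2 / C'\<^sup>2"
  have t: "t > 0" using \<open>\<delta> > 0\<close> C'pos by (simp add: t_def)
  have q: "0 \<le> q" "q < 1"
    using \<open>\<delta> > 0\<close> C'pos by (auto simp: q_def power_mono)
  have contr: "norm (x - t *\<^sub>R Q x) \<le> sqrt q * norm x" for x
  proof -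
    have "(norm (x - t *\<^sub>R Q x))\<^sup>2 = (norm x)\<^sup>2 - 2 * t * Re (cinner (Q x) x) + t\<^sup>2 * (norm (Q x))\<^sup>2"
      using Re_cinner_commute[of x "Q x"]
      by (simp add: norm_diff_square scaleR_scaleC cinner_simps norm_scaleC power_mult_distrib)
    also have "\<dots> \<le> (norm x)\<^sup>2 - 2 * t * (\<delta> * (norm x)\<^sup>2) + t\<^sup>2 * (C' * norm x)\<^sup>2"
      using coercive[of x] C'[of x] t
      by (intro add_mono diff_mono mult_left_mono power_mono) auto
    also have "\<dots> = q * (norm x)\<^sup>2"
      using C'pos by (simp add: t_def q_def field_simps power2_eq_square)
    finally show ?thesis
      using q by (metis real_le_rsqrt real_sqrt_mult real_sqrt_unique norm_ge_zero)
  qed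
  have "\<exists>!p. p - t *\<^sub>R (Q p - h) = p"
  proof (rule banach_fix_type)
    show "0 \<le> sqrt q" "sqrt q < 1" using q by auto
    show "\<forall>x y. dist (x - t *\<^sub>R (Q x - h)) (y - t *\<^sub>R (Q y - h)) \<le> sqrt q * dist x y"
    proof (intro allI)
      fix x y
      have "x - t *\<^sub>R (Q x - h) - (y - t *\<^sub>R (Q y - h)) = (x - y) - t *\<^sub>R Q (x - y)"
        unfolding diff by (simp add: algebra_simps)
      then show "dist (x - t *\<^sub>R (Q x - h)) (y - t *\<^sub>R (Q y - h)) \<le> sqrt q * dist x y"
        using contr[of "x - y"] by (simp only: dist_norm)
    qed
  qed
  then show thesis using that t by auto
qed

section \<open>Analytic semigroups generated by sectorial operators\<close>

text \<open>For positive \<kappa> this is the open sector of half-angle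
  \<open>arctan \<kappa>\<close>, described without arguments: in this form it is plainly open and
  closed under addition and positive scaling, and dissipativity can be checked on real and imaginary
  parts.\<close>

definition slope_sector :: "real \<Rightarrow> complex set" where
  "slope_sector \<kappa> = {z. \<bar>Im z\<bar> < \<kappa> * Re z}"

lemma sector_arctan:
  assumes "\<kappa> > 0"
  shows "sector (arctan \<kappa>) = slope_sector \<kappa>"
proof -
  have "(z \<noteq> 0 \<and> \<bar>Arg z\<bar> < arctan \<kappa>) \<longleftrightarrow> \<bar>Im z\<bar> < \<kappa> * Re z" for z
  proof (cases "Re z > 0")
    case True
    have z: "z \<noteq> 0" using True by auto
    have re: "Re z = cmod z * cos (Arg z)" and im: "Im z = cmod z * sin (Arg z)"
      using arg_cong[OF rcis_cmod_Arg[of z], of Re] arg_cong[OF rcis_cmod_Arg[of z], of Im]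
      by (simp_all only: Re_rcis Im_rcis)
    have "\<bar>Arg z\<bar> < pi / 2"
      using True Arg_Re_pos[of z] by blast
    then have "Arg z = arctan (tan (Arg z))"
      by (simp add: arctan_tan abs_less_iff)
    also have "tan (Arg z) = Im z / Re z"
      using z unfolding tan_def re im by simp
    finally have "\<bar>Arg z\<bar> = arctan \<bar>Im z / Re z\<bar>"
      by (simp add: abs_if flip: arctan_minus)
    then have "\<bar>Arg z\<bar> < arctan \<kappa> \<longleftrightarrow> \<bar>Im z\<bar> / Re z < \<kappa>"
      using True by (simp add: arctan_less_iff)
    then show ?thesis using True z by (simp add: divide_less_eq)
  next
    case False
    have "\<not> \<bar>Im z\<bar> < \<kappa> * Re z"
      using False assms by (smt (verit) mult_nonneg_nonpos)
    moreover have "\<not> \<bar>Arg z\<bar> < arctan \<kappa>" if "z \<noteq> 0"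
      using False that Arg_Re_pos[of z] arctan_ubound[of \<kappa>] by force
    ultimately show ?thesis by blast
  qed
  then show ?thesis by (auto simp: sector_def slope_sector_def)
qed

lemma open_slope_sector: "open (slope_sector \<kappa>)"
  unfolding slope_sector_def by (intro open_Collect_less continuous_intros)

lemma slope_sector_add: "z \<in> slope_sector \<kappa> \<Longrightarrow> w \<in> slope_sector \<kappa> \<Longrightarrow> z + w \<in> slope_sector \<kappa>"
  by (auto simp: slope_sector_def distrib_left)

lemma slope_sector_divide_nat: "z \<in> slope_sector \<kappa> \<Longrightarrow> N > 0 \<Longrightarrow> z / of_nat N \<in> slope_sector \<kappa>"
  by (auto simp: slope_sector_def divide_strict_right_mono)

lemma slope_sector_Re_pos: "z \<in> slope_sector \<kappa> \<Longrightarrow> \<kappa> > 0 \<Longrightarrow> Re z > 0"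
  by (auto simp: slope_sector_def) (smt (verit) mult_pos_pos zero_less_mult_pos)

lemma slope_sector_of_real: "\<kappa> > 0 \<Longrightarrow> r > 0 \<Longrightarrow> of_real r \<in> slope_sector \<kappa>"
  by (simp add: slope_sector_def)

text \<open>The constants depend on \<open>f\<close> only through the bound \<open>K\<close>.
  Applied to matrix elements of an operator family, with \<open>K\<close> the product of two norms,
  the estimates become uniform in both vectors, which is what operator-norm differentiability
  needs.\<close>

lemma Cauchy_difference_quotient:
  assumes hol: "f holomorphic_on U" and "open U" and sub: "cball z r \<subseteq> U" and "r > 0"
    and K: "\<And>u. u \<in> cball z r \<Longrightarrow> cmod (f u) \<le> K"
  shows "cmod (deriv f z) \<le> K / r"
    and "w \<noteq> z \<Longrightarrow> dist w z < r / 2 \<Longrightarrow> cmod ((f w - f z) / (w - z) - deriv f z) \<le> 8 * K / r\<^sup>2 * dist w z"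
proof -
  have bound: "cmod ((deriv ^^ n) f u) \<le> fact n * K / s ^ n" if "cball u s \<subseteq> cball z r" "s > 0" for u s n
  proof (rule Cauchy_inequality)
    show "f holomorphic_on ball u s" "continuous_on (cball u s) f"
      using that sub hol holomorphic_on_imp_continuous_on holomorphic_on_subset continuous_on_subset
      by (meson ball_subset_cball order_trans)+
    show "cmod (f x) \<le> K" if "cmod (u - x) = s" for x
      using that \<open>cball u s \<subseteq> cball z r\<close> by (intro K) (auto simp: dist_norm)
  qed fact
  show "cmod (deriv f z) \<le> K / r"
    using bound[of z r 1] \<open>r > 0\<close> by simp
  assume w: "w \<noteq> z" "dist w z < r / 2"
  have "cmod ((deriv ^^ 0) f w - (\<Sum>i\<le>1. (deriv ^^ i) f z * (w - z) ^ i / fact i)) \<le> 8 * K / r\<^sup>2 * cmod (w - z) ^ Suc 1 / fact 1"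
  proof (rule complex_Taylor[where S = "ball z (r / 2)" and f = "\<lambda>i. (deriv ^^ i) f"])
    fix i x assume x: "x \<in> ball z (r / 2)"
    \<comment> \<open>Discs of radius \<open>r / 2\<close> about points of the half-size disc stay
      inside; there Cauchy's inequality bounds the second derivative by
      \<open>2 * K / (r / 2)\<^sup>2\<close>, the source of the 8.\<close>
    have sub2: "cball x (r / 2) \<subseteq> cball z r"
    proof
      fix y assume "y \<in> cball x (r / 2)"
      then show "y \<in> cball z r"
        using x dist_triangle[of z y x] by simp
    qed
    have "x \<in> cball x (r / 2)" using \<open>r > 0\<close> by simp
    then have "x \<in> U" using sub2 sub by blast
    then have "((deriv ^^ i) f has_field_derivative deriv ((deriv ^^ i) f) x) (at x)"
      using holomorphic_derivI[OF holomorphic_higher_deriv[OF hol \<open>open U\<close>] \<open>open U\<close>] by blast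
    then show "((deriv ^^ i) f has_field_derivative (deriv ^^ Suc i) f x) (at x within ball z (r / 2))"
      by (simp add: has_field_derivative_at_within)
    have "cmod ((deriv ^^ 2) f x) \<le> fact 2 * K / (r / 2) ^ 2"
      by (rule bound[OF sub2]) (use \<open>r > 0\<close> in simp)
    then show "cmod ((deriv ^^ Suc 1) f x) \<le> 8 * K / r\<^sup>2"
      by (simp add: numeral_2_eq_2 power_divide)
  qed (use w \<open>r > 0\<close> in \<open>auto simp: dist_commute\<close>)
  then have "cmod (f w - f z - deriv f z * (w - z)) \<le> 8 * K / r\<^sup>2 * cmod (w - z) * cmod (w - z)"
    by (simp add: algebra_simps power2_eq_square)
  moreover have "(f w - f z) / (w - z) - deriv f z = (f w - f z - deriv f z * (w - z)) / (w - z)"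
    using w by (simp add: field_simps)
  ultimately show "cmod ((f w - f z) / (w - z) - deriv f z) \<le> 8 * K / r\<^sup>2 * dist w z"
    using w by (simp add: norm_divide divide_le_eq dist_norm)
qed

definition contraction_op :: "('a::real_normed_vector \<Rightarrow> 'a) \<Rightarrow> bool" where
  "contraction_op P \<longleftrightarrow> (\<forall>x y. P (x - y) = P x - P y) \<and> (\<forall>x. norm (P x) \<le> norm x)"

lemma contraction_op_diff: "contraction_op P \<Longrightarrow> P (x - y) = P x - P y"
  and contraction_op_norm: "contraction_op P \<Longrightarrow> norm (P x) \<le> norm x"
  by (auto simp: contraction_op_def)

lemma contraction_op_comp:
  assumes "contraction_op P" "contraction_op Q"
  shows "contraction_op (P \<circ> Q)"
  using assms order_trans unfolding contraction_op_def by fastforce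

lemma contraction_op_funpow: "contraction_op P \<Longrightarrow> contraction_op (P ^^ n)"
proof (induction n)
  case 0
  then show ?case by (simp add: contraction_op_def)
next
  case (Suc n)
  then show ?case using contraction_op_comp[of P "P ^^ n"] by (simp add: o_def)
qed

lemma funpow_commute: "P \<circ> Q = Q \<circ> P \<Longrightarrow> (P ^^ n) (Q x) = Q ((P ^^ n) x)"
  by (induction n) (auto simp: fun_eq_iff)

lemma funpow_comp_commute: "P \<circ> Q = Q \<circ> P \<Longrightarrow> ((P \<circ> Q) ^^ n) x = (P ^^ n) ((Q ^^ n) x)"
proof (induction n)
  case (Suc n)
  have "(P ^^ n) (Q y) = Q ((P ^^ n) y)" for y
    using Suc.prems by (rule funpow_commute)
  with Suc show ?case by (simp add: fun_eq_iff)
qed simp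

text \<open>Stability plus commutation: errors of single steps add up without amplification. This
  turns the local error estimates below into global ones.\<close>

lemma contraction_funpow_diff:
  assumes P: "contraction_op P" and Q: "contraction_op Q" and comm: "P \<circ> Q = Q \<circ> P"
  shows "norm ((P ^^ n) x - (Q ^^ n) x) \<le> real n * norm (P x - Q x)"
proof (induction n)
  case (Suc n)
  have c: "P ((Q ^^ n) x) = (Q ^^ n) (P x)"
    by (rule funpow_commute[symmetric]) (simp add: comm)
  have "(P ^^ Suc n) x - (Q ^^ Suc n) x = P ((P ^^ n) x) - P ((Q ^^ n) x) + ((Q ^^ n) (P x) - (Q ^^ n) (Q x))"
    by (simp add: c funpow_swap1)
  also have "\<dots> = P ((P ^^ n) x - (Q ^^ n) x) + (Q ^^ n) (P x - Q x)"
    by (simp add: contraction_op_diff P contraction_op_funpow Q)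
  also have "norm \<dots> \<le> norm ((P ^^ n) x - (Q ^^ n) x) + norm (P x - Q x)"
    by (intro norm_triangle_mono contraction_op_norm contraction_op_funpow P Q)
  finally show ?case using Suc.IH by (simp add: algebra_simps)
qed simp

lemma norm_add_diff_le:
  fixes a b c d :: "'a::real_normed_vector"
  shows "norm (a + b - c) \<le> norm a + norm b + norm c"
    and norm_add_diff_diff_le: "norm (a + b - c - d) \<le> norm a + norm b + norm c + norm d"
    and norm_diff_diff_diff_le: "norm (a - b - c - d) \<le> norm a + norm b + norm c + norm d"
  by norm+

text \<open>
  Dissipativity is demanded for all rotations of the operator within the sector, that is, the
  numerical range lies in the dual sector of the left half plane.
\<close>

locale sectorial_operator =
  fixes S :: "'a::chilbert_space set" and A :: "'a \<Rightarrow> 'a" and \<kappa> :: real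
  assumes \<kappa>_pos: "\<kappa> > 0"
    and linear: "clinear_on S A"
    and dense: "closure S = UNIV"
    and dissipative: "z \<in> slope_sector \<kappa> \<Longrightarrow> x \<in> S \<Longrightarrow> Re (z * cinner (A x) x) \<le> 0"
    and onto: "z \<in> slope_sector \<kappa> \<Longrightarrow> \<exists>x\<in>S. x - z *\<^sub>C A x = y"
begin

section \<open>Resolvents of the operator on the sector\<close>

abbreviation "\<Sigma> \<equiv> slope_sector \<kappa>"

lemma S_subspace: "complex_vector.subspace S"
  using linear by (simp add: clinear_on_def)

lemma S_add: "x \<in> S \<Longrightarrow> y \<in> S \<Longrightarrow> x + y \<in> S"
  and S_scale: "x \<in> S \<Longrightarrow> c *\<^sub>C x \<in> S"
  and S_diff: "x \<in> S \<Longrightarrow> y \<in> S \<Longrightarrow> x - y \<in> S"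
  using S_subspace complex_vector.subspace_add complex_vector.subspace_scale
    complex_vector.subspace_diff by blast+

lemma A_add: "x \<in> S \<Longrightarrow> y \<in> S \<Longrightarrow> A (x + y) = A x + A y"
  and A_scale: "x \<in> S \<Longrightarrow> A (c *\<^sub>C x) = c *\<^sub>C A x"
  using linear by (auto simp: clinear_on_def)

lemma A_diff: "x \<in> S \<Longrightarrow> y \<in> S \<Longrightarrow> A (x - y) = A x - A y"
  using A_add[of "x - y" y] by (simp add: S_diff)

lemma sector_nonzero: "z \<in> \<Sigma> \<Longrightarrow> z \<noteq> 0"
  by (auto simp: slope_sector_def)

text \<open>In the expansion of the square the cross term has a favourable sign by dissipativity at
  the same \<open>z\<close>, rotation included.\<close>

lemma norm_le_resolvent:
  assumes "z \<in> \<Sigma>" "x \<in> S"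
  shows "norm x \<le> norm (x - z *\<^sub>C A x)"
proof -
  have "(norm (x - z *\<^sub>C A x))\<^sup>2 \<ge> (norm x)\<^sup>2"
    using dissipative[OF assms] Re_cinner_commute[of x "z *\<^sub>C A x"]
    unfolding norm_diff_square cinner_scaleC_left by (smt (verit) zero_le_power2)
  then show ?thesis by (rule power2_le_imp_le) simp
qed

text \<open>The inverse of \<open>1 - z A\<close>, that is one implicit Euler step of complex length
  \<open>z\<close>. On the sector the choice is determined: a solution exists by \<open>onto\<close>
  and is unique by \<open>norm_le_resolvent\<close>.\<close>

definition J :: "complex \<Rightarrow> 'a \<Rightarrow> 'a" where
  "J z y = (SOME x. x \<in> S \<and> x - z *\<^sub>C A x = y)"

lemma J:
  assumes "z \<in> \<Sigma>"
  shows J_in: "J z y \<in> S" and J_eq: "J z y - z *\<^sub>C A (J z y) = y"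
  using someI_ex[of "\<lambda>x. x \<in> S \<and> x - z *\<^sub>C A x = y"] onto[OF assms, of y]
  unfolding J_def by auto

lemma J_unique:
  assumes "z \<in> \<Sigma>" "x \<in> S"
  shows "J z (x - z *\<^sub>C A x) = x"
proof -
  let ?u = "J z (x - z *\<^sub>C A x)"
  have "?u - z *\<^sub>C A ?u = x - z *\<^sub>C A x"
    using assms(1) by (rule J_eq)
  then have "(?u - x) - z *\<^sub>C A (?u - x) = 0"
    by (simp add: A_diff J_in assms scaleC_diff_right algebra_simps)
  then have "norm (?u - x) \<le> 0"
    using norm_le_resolvent[of z "?u - x"] by (simp add: S_diff J_in assms)
  then show ?thesis by simp
qed

lemma J_add:
  assumes "z \<in> \<Sigma>"
  shows "J z (x + y) = J z x + J z y"
proof -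
  have "x + y = (J z x - z *\<^sub>C A (J z x)) + (J z y - z *\<^sub>C A (J z y))"
    by (simp only: J_eq[OF assms])
  also have "\<dots> = (J z x + J z y) - z *\<^sub>C A (J z x + J z y)"
    by (simp add: A_add J_in assms scaleC_add_right)
  finally have "x + y = (J z x + J z y) - z *\<^sub>C A (J z x + J z y)" .
  then show ?thesis using J_unique[OF assms, of "J z x + J z y"] by (simp add: J_in S_add assms)
qed

lemma J_scale:
  assumes "z \<in> \<Sigma>"
  shows "J z (c *\<^sub>C x) = c *\<^sub>C J z x"
proof -
  have "c *\<^sub>C x = c *\<^sub>C (J z x - z *\<^sub>C A (J z x))"
    by (simp add: J_eq assms)
  also have "\<dots> = c *\<^sub>C J z x - z *\<^sub>C A (c *\<^sub>C J z x)"
    by (simp add: A_scale J_in assms scaleC_diff_right scaleC_scaleC mult.commute)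
  finally show ?thesis using J_unique[OF assms, of "c *\<^sub>C J z x"] by (simp add: J_in S_scale assms)
qed

lemma J_contraction:
  assumes "z \<in> \<Sigma>"
  shows "contraction_op (J z)"
  unfolding contraction_op_def
proof (intro conjI allI)
  fix x y
  show "J z (x - y) = J z x - J z y"
    using J_add[OF assms, of "x - y" y] by simp
  show "norm (J z x) \<le> norm x"
    using norm_le_resolvent[OF assms J_in[OF assms], of x] by (simp add: J_eq assms)
qed

text \<open>The equation for \<open>J z x\<close> expresses \<open>A (J z x)\<close> through
  elements of \<open>S\<close>, so \<open>A\<close> may be applied once more.\<close>

lemma J_A_commute:
  assumes "z \<in> \<Sigma>" "x \<in> S"
  shows "A (J z x) \<in> S" and "A (J z x) = J z (A x)"
proof -
  let ?u = "J z x"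
  have "z *\<^sub>C A ?u = ?u - x"
    using J_eq[OF assms(1), of x] by (simp add: algebra_simps)
  then have "A ?u = inverse z *\<^sub>C (?u - x)"
    by (metis assms(1) sector_nonzero scaleC_scaleC scaleC_one left_inverse)
  then show in_S: "A ?u \<in> S"
    by (simp add: S_scale S_diff J_in assms)
  have "A x = A (?u - z *\<^sub>C A ?u)"
    by (simp add: J_eq assms)
  also have "\<dots> = A ?u - z *\<^sub>C A (A ?u)"
    by (simp add: A_diff A_scale S_scale J_in in_S assms)
  finally show "A ?u = J z (A x)"
    using J_unique[OF assms(1) in_S] by simp
qed

lemma J_J_commute:
  assumes "z \<in> \<Sigma>" "w \<in> \<Sigma>"
  shows "J z \<circ> J w = J w \<circ> J z"
proof
  fix y
  let ?a = "J w y"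
  have "J z y = J z (?a - w *\<^sub>C A ?a)"
    by (simp add: J_eq assms)
  also have "\<dots> = J z ?a - w *\<^sub>C A (J z ?a)"
    by (simp add: contraction_op_diff J_contraction J_scale J_A_commute J_in assms)
  finally show "(J z \<circ> J w) y = (J w \<circ> J z) y"
    by (simp add: J_unique J_in assms)
qed

section \<open>Accuracy of a single implicit Euler step\<close>

lemma J_minus_id:
  assumes "z \<in> \<Sigma>" "x \<in> S"
  shows "J z x - x = z *\<^sub>C J z (A x)"
proof -
  have "x = J z x - z *\<^sub>C J z (A x)"
    using J_unique[OF assms] by (simp add: contraction_op_diff J_contraction J_scale assms)
  then show ?thesis by (simp add: algebra_simps)
qed

lemma norm_J_minus_id:
  assumes "z \<in> \<Sigma>" "x \<in> S"
  shows "norm (J z x - x) \<le> cmod z * norm (A x)"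
  by (simp add: J_minus_id assms norm_scaleC mult_left_mono contraction_op_norm J_contraction)

text \<open>The domain of the square of \<open>A\<close>, where the local error of an Euler step is
  quadratic in the step.\<close>

definition S2 :: "'a set" where
  "S2 = {x\<in>S. A x \<in> S}"

lemma S2_S: "x \<in> S2 \<Longrightarrow> x \<in> S" and S2_A: "x \<in> S2 \<Longrightarrow> A x \<in> S"
  by (auto simp: S2_def)

lemma J_S2: "z \<in> \<Sigma> \<Longrightarrow> x \<in> S \<Longrightarrow> J z x \<in> S2"
  by (simp add: S2_def J_in J_A_commute)

lemma norm_J_second_order:
  assumes "z \<in> \<Sigma>" "x \<in> S2"
  shows "norm (J z x - x - z *\<^sub>C A x) \<le> (cmod z)\<^sup>2 * norm (A (A x))"
proof -
  have "J z x - x - z *\<^sub>C A x = z *\<^sub>C (J z (A x) - A x)"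
    by (simp add: J_minus_id assms S2_S scaleC_diff_right)
  then show ?thesis
    using norm_J_minus_id[OF assms(1) S2_A[OF assms(2)]]
    by (simp add: norm_scaleC power2_eq_square mult.assoc mult_left_mono)
qed

lemma J_tendsto_id:
  assumes "x \<in> S"
  shows "(\<lambda>n. J (of_real (1 / real (Suc n))) x) \<longlonglongrightarrow> x"
proof -
  have "norm (J (of_real (1 / real (Suc n))) x - x) \<le> 1 / real (Suc n) * norm (A x)" for n
  proof -
    have "norm (J (of_real (1 / real (Suc n))) x - x) \<le> cmod (of_real (1 / real (Suc n))) * norm (A x)"
      by (intro norm_J_minus_id slope_sector_of_real \<kappa>_pos assms) simp
    also have "cmod (of_real (1 / real (Suc n))) = 1 / real (Suc n)"
      by (simp only: norm_of_real) simp
    finally show ?thesis .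
  qed
  moreover have "(\<lambda>n. 1 / real (Suc n) * norm (A x)) \<longlonglongrightarrow> 0"
    by (rule tendsto_mult_left_zero[OF LIMSEQ_Suc[OF lim_1_over_n]])
  ultimately have "(\<lambda>n. J (of_real (1 / real (Suc n))) x - x) \<longlonglongrightarrow> 0"
    by (rule Lim_null_comparison[OF always_eventually[OF allI]])
  then show ?thesis by (rule LIM_zero_cancel)
qed

text \<open>The resolvents regularise: \<open>J h\<close> maps \<open>S\<close> into
  \<open>S2\<close>, commutes with \<open>A\<close> and tends strongly to the identity, so
  \<open>x\<close> and \<open>A x\<close> are approximated through the same vector. Density in the
  graph norm, rather than in the norm, is what the generator requires.\<close>

lemma S2_graph_dense:
  assumes "x \<in> S" "e > 0"
  obtains x' where "x' \<in> S2" "norm (x - x') < e" "norm (A x - A x') < e"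
proof -
  let ?h = "\<lambda>n. complex_of_real (1 / real (Suc n))"
  have h: "?h n \<in> \<Sigma>" for n
    by (rule slope_sector_of_real[OF \<kappa>_pos]) simp
  \<comment> \<open>Contractivity extends the convergence from \<open>S\<close> to its
    closure.\<close>
  have cont: "(\<lambda>n. J (?h n) y) \<longlonglongrightarrow> y" for y
  proof (rule LIMSEQ_I)
    fix r :: real assume r: "r > 0"
    obtain s where s: "s \<in> S" "norm (y - s) < r / 3"
      using dense r by (metis UNIV_I closure_approachable dist_norm dist_commute divide_pos_pos zero_less_numeral)
    obtain N where N: "\<And>n. n \<ge> N \<Longrightarrow> norm (J (?h n) s - s) < r / 3"
      using LIMSEQ_D[OF J_tendsto_id[OF s(1)], of "r / 3"] r by auto
    have "norm (J (?h n) y - y) < r" if "n \<ge> N" for n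
    proof -
      have "J (?h n) y - y = J (?h n) (y - s) + (J (?h n) s - s) - (y - s)"
        using J_contraction[OF h] by (simp add: contraction_op_diff)
      also have "norm \<dots> \<le> norm (J (?h n) (y - s)) + norm (J (?h n) s - s) + norm (y - s)"
        by (rule norm_add_diff_le)
      also have "\<dots> < r / 3 + r / 3 + r / 3"
        using contraction_op_norm[OF J_contraction[OF h], of n "y - s"] N[OF that] s(2) by linarith
      finally show ?thesis by simp
    qed
    then show "\<exists>N. \<forall>n\<ge>N. norm (J (?h n) y - y) < r" by blast
  qed
  obtain N1 where N1: "\<And>n. n \<ge> N1 \<Longrightarrow> norm (J (?h n) x - x) < e"
    using LIMSEQ_D[OF cont assms(2)] by blast
  obtain N2 where N2: "\<And>n. n \<ge> N2 \<Longrightarrow> norm (J (?h n) (A x) - A x) < e"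
    using LIMSEQ_D[OF cont assms(2)] by blast
  define n where "n = max N1 N2"
  show thesis
  proof (rule that[of "J (?h n) x"])
    show "J (?h n) x \<in> S2" using h assms(1) by (rule J_S2)
    show "norm (x - J (?h n) x) < e"
      using N1[of n] by (simp add: n_def norm_minus_commute)
    show "norm (A x - A (J (?h n) x)) < e"
      unfolding J_A_commute(2)[OF h assms(1)] using N2[of n] by (simp only: n_def norm_minus_commute)
  qed
qed

lemma S2_dense:
  assumes "e > 0"
  obtains x' where "x' \<in> S2" "norm (x - x') < e"
proof -
  obtain s where s: "s \<in> S" "norm (x - s) < e / 2"
    using dense assms by (metis UNIV_I closure_approachable dist_norm dist_commute half_gt_zero)
  obtain x' where x': "x' \<in> S2" "norm (s - x') < e / 2"
    using S2_graph_dense[OF s(1)] assms half_gt_zero by blast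
  have "norm (x - x') \<le> norm (x - s) + norm (s - x')"
    by (metis norm_triangle_ineq diff_add_cancel add_diff_eq)
  then show thesis using that[OF x'(1)] s(2) x'(2) by linarith
qed

text \<open>\<open>N\<close> implicit Euler steps of length \<open>z / N\<close>. For
  \<open>N = 0\<close> it is the identity, which is why some estimates below require
  \<open>N > 0\<close>.\<close>

definition F :: "nat \<Rightarrow> complex \<Rightarrow> 'a \<Rightarrow> 'a" where
  "F N z = J (z / of_nat N) ^^ N"

lemma F_contraction: "z \<in> \<Sigma> \<Longrightarrow> contraction_op (F N z)"
  unfolding F_def
  by (cases "N = 0")
    (simp add: contraction_op_def, simp add: contraction_op_funpow J_contraction slope_sector_divide_nat)

lemma F_scale:
  assumes "z \<in> \<Sigma>"
  shows "F N z (c *\<^sub>C x) = c *\<^sub>C F N z x"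
proof (cases "N = 0")
  case False
  have "(J (z / of_nat N) ^^ n) (c *\<^sub>C x) = c *\<^sub>C (J (z / of_nat N) ^^ n) x" for n
    by (induction n) (use False assms in \<open>simp_all add: J_scale slope_sector_divide_nat\<close>)
  then show ?thesis by (simp add: F_def)
qed (simp add: F_def)

text \<open>A further step costs its own local error and the effect of \<open>J h\<close> on the
  linear term, and \<open>N\<^sup>2 + 1 + N \<le> (N + 1)\<^sup>2\<close>. The bound depends only on
  the total length \<open>N * h\<close>, hence is uniform in \<open>N\<close> for fixed
  \<open>z\<close>.\<close>

lemma J_funpow_second_order:
  assumes h: "h \<in> \<Sigma>" and x: "x \<in> S2"
  shows "norm ((J h ^^ N) x - x - (of_nat N * h) *\<^sub>C A x) \<le> (real N * cmod h)\<^sup>2 * norm (A (A x))"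
proof (induction N)
  case (Suc N)
  let ?a = "(cmod h)\<^sup>2 * norm (A (A x))"
  note d = contraction_op_diff[OF J_contraction[OF h]]
  have "(J h ^^ Suc N) x - x - (of_nat (Suc N) * h) *\<^sub>C A x
      = J h ((J h ^^ N) x - x - (of_nat N * h) *\<^sub>C A x) + (J h x - x - h *\<^sub>C A x)
        + (of_nat N * h) *\<^sub>C (J h (A x) - A x)"
    by (simp add: d J_scale h scaleC_diff_right scaleC_add_left distrib_right)
  also have "norm \<dots> \<le> norm ((J h ^^ N) x - x - (of_nat N * h) *\<^sub>C A x) + ?a + real N * ?a"
  proof (intro norm_triangle_mono)
    show "norm ((of_nat N * h) *\<^sub>C (J h (A x) - A x)) \<le> real N * ?a"
      using norm_J_minus_id[OF h S2_A[OF x]]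
      by (simp add: norm_scaleC norm_mult power2_eq_square mult.assoc mult_left_mono)
  qed (use h x in \<open>auto intro!: contraction_op_norm J_contraction norm_J_second_order\<close>)
  also have "\<dots> \<le> (real N)\<^sup>2 * ?a + ?a + real N * ?a"
    using Suc.IH by (simp add: power_mult_distrib mult.assoc)
  also have "\<dots> \<le> (real (Suc N))\<^sup>2 * ?a"
    by (simp add: power2_eq_square algebra_simps)
  finally show ?case by (simp add: power_mult_distrib mult.assoc)
qed simp

lemma F_second_order:
  assumes "z \<in> \<Sigma>" "x \<in> S2" "N > 0"
  shows "norm (F N z x - x - z *\<^sub>C A x) \<le> (cmod z)\<^sup>2 * norm (A (A x))"
  using J_funpow_second_order[OF slope_sector_divide_nat[OF assms(1,3)] assms(2), of N] assms(3)
  by (simp add: F_def norm_divide)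

text \<open>A coarse step and \<open>M\<close> fine steps of the same total length
  \<open>h = z / N\<close> agree with the same linear expression up to order
  \<open>(cmod h)\<^sup>2\<close>; \<open>N\<close> such discrepancies sum to order
  \<open>1 / N\<close>, whatever \<open>M\<close>.\<close>

lemma F_refine:
  assumes z: "z \<in> \<Sigma>" and x: "x \<in> S2" and N: "N > 0" and M: "M > 0"
  shows "norm (F N z x - F (M * N) z x) \<le> 2 * (cmod z)\<^sup>2 * norm (A (A x)) / real N"
proof -
  let ?a = "norm (A (A x))"
  define h where "h = z / of_nat N"
  define P where "P = J h"
  define Q where "Q = F M h"
  have h: "h \<in> \<Sigma>" using z N by (simp add: h_def slope_sector_divide_nat)
  have hM: "h / of_nat M \<in> \<Sigma>" using h M by (simp add: slope_sector_divide_nat)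
  have "F (M * N) z = Q ^^ N"
    by (simp add: Q_def F_def h_def funpow_mult mult.commute)
  moreover have "F N z = P ^^ N"
    by (simp add: F_def P_def h_def)
  moreover have "norm ((P ^^ N) x - (Q ^^ N) x) \<le> real N * norm (P x - Q x)"
  proof (rule contraction_funpow_diff)
    show "P \<circ> Q = Q \<circ> P"
      unfolding P_def Q_def F_def fun_eq_iff o_apply
      using funpow_commute[OF J_J_commute[OF hM h]] by metis
  qed (simp_all add: P_def Q_def J_contraction F_contraction h)
  moreover have "norm (P x - Q x) \<le> 2 * (cmod h)\<^sup>2 * ?a"
  proof -
    have "P x - Q x = (J h x - x - h *\<^sub>C A x) - (F M h x - x - h *\<^sub>C A x)"
      by (simp add: P_def Q_def)
    then show ?thesis
      using norm_triangle_ineq4[of "J h x - x - h *\<^sub>C A x" "F M h x - x - h *\<^sub>C A x"]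
        norm_J_second_order[OF h x] F_second_order[OF h x M] by simp
  qed
  then have "real N * norm (P x - Q x) \<le> real N * (2 * (cmod h)\<^sup>2 * ?a)"
    by (intro mult_left_mono) auto
  ultimately show ?thesis
    using N by (simp add: h_def norm_divide power_divide power2_eq_square)
qed

text \<open>Two approximations are compared through their common refinement with
  \<open>N * M\<close> steps, after replacing \<open>x\<close> by a nearby element of
  \<open>S2\<close>; contractivity makes that replacement uniform in \<open>N\<close> and
  \<open>z\<close>.\<close>

lemma F_uniformly_Cauchy:
  assumes "e > 0"
  obtains N0 where "\<And>N M z. N \<ge> N0 \<Longrightarrow> M \<ge> N0 \<Longrightarrow> z \<in> \<Sigma> \<Longrightarrow> cmod z \<le> r \<Longrightarrow> norm (F N z x - F M z x) < e"
proof -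
  obtain x' where x': "x' \<in> S2" "norm (x - x') < e / 4"
    using S2_dense[of "e / 4"] assms by auto
  define c where "c = 2 * r\<^sup>2 * norm (A (A x'))"
  obtain N0 :: nat where N0: "N0 > 0" "c / real N0 < e / 4"
  proof -
    obtain n where "4 * c / e < real n" using reals_Archimedean2 by blast
    then have "c < real n * (e / 4)"
      using assms by (simp add: divide_less_eq mult.commute)
    also have "\<dots> \<le> real (Suc n) * (e / 4)"
      using assms by (intro mult_right_mono) auto
    finally show thesis using that[of "Suc n"] by (simp add: divide_less_eq mult.commute)
  qed
  show thesis
  proof (rule that[of N0])
    fix N M z assume NM: "N \<ge> N0" "M \<ge> N0" and z: "z \<in> \<Sigma>" "cmod z \<le> r"
    have step: "norm (F n z x' - F (m * n) z x') < e / 4" if "n \<ge> N0" "m \<ge> N0" for n m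
    proof -
      have "norm (F n z x' - F (m * n) z x') \<le> 2 * (cmod z)\<^sup>2 * norm (A (A x')) / real n"
        using that N0 by (intro F_refine z x') auto
      also have "\<dots> \<le> c / real N0"
        unfolding c_def using that N0 z(2)
        by (intro frac_le mult_right_mono mult_left_mono power_mono) auto
      finally show ?thesis using N0(2) by (rule le_less_trans)
    qed
    have near: "norm (F n z x - F n z x') < e / 4" for n
      using contraction_op_norm[OF F_contraction[OF z(1)], of n "x - x'"] x'(2)
      by (simp add: contraction_op_diff F_contraction z)
    have "norm (F N z x - F M z x) = norm ((F N z x - F N z x') + (F N z x' - F (M * N) z x')
        - (F M z x' - F (N * M) z x') - (F M z x - F M z x'))"
      by (simp add: mult.commute)
    also have "\<dots> \<le> norm (F N z x - F N z x') + norm (F N z x' - F (M * N) z x')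
        + norm (F M z x' - F (N * M) z x') + norm (F M z x - F M z x')"
      by (rule norm_add_diff_diff_le)
    also have "\<dots> < e / 4 + e / 4 + e / 4 + e / 4"
      using near[of N] near[of M] step[OF NM] step[OF NM(2,1)] by linarith
    finally show "norm (F N z x - F M z x) < e" by simp
  qed
qed

text \<open>The vertex 0 does not lie in the open sector, where alone the limit is controlled, so
  its value is set by hand.\<close>

definition T :: "complex \<Rightarrow> 'a \<Rightarrow> 'a" where
  "T z x = (if z = 0 then x else lim (\<lambda>N. F N z x))"

lemma F_tendsto_T:
  assumes "z \<in> \<Sigma>"
  shows "(\<lambda>N. F N z x) \<longlonglongrightarrow> T z x"
proof -
  have "Cauchy (\<lambda>N. F N z x)"
  proof (rule metric_CauchyI)
    fix e :: real assume "e > 0"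
    from F_uniformly_Cauchy[OF this, of "cmod z" x] assms
    show "\<exists>M. \<forall>m\<ge>M. \<forall>n\<ge>M. dist (F m z x) (F n z x) < e"
      by (metis dist_norm order_refl)
  qed
  then show ?thesis
    using sector_nonzero[OF assms] by (simp add: T_def Cauchy_convergent_iff convergent_LIMSEQ_iff)
qed

text \<open>Local uniformity in \<open>z\<close> is what lets holomorphy pass to the limit.\<close>

lemma F_uniform_limit:
  "uniform_limit (\<Sigma> \<inter> cball 0 r) (\<lambda>N z. F N z x) (\<lambda>z. T z x) sequentially"
proof (rule uniform_limitI)
  fix e :: real assume "e > 0"
  then obtain N0 where N0: "\<And>N M z. N \<ge> N0 \<Longrightarrow> M \<ge> N0 \<Longrightarrow> z \<in> \<Sigma> \<Longrightarrow> cmod z \<le> r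
      \<Longrightarrow> norm (F N z x - F M z x) < e / 2"
    using F_uniformly_Cauchy[of "e / 2" r x] by auto
  have "dist (F N z x) (T z x) < e" if "N \<ge> N0" "z \<in> \<Sigma>" "cmod z \<le> r" for N z
  proof -
    have "(\<lambda>M. norm (F N z x - F M z x)) \<longlonglongrightarrow> norm (F N z x - T z x)"
      by (intro tendsto_intros F_tendsto_T that)
    then have "norm (F N z x - T z x) \<le> e / 2"
      by (rule LIMSEQ_le_const2) (use N0 that in \<open>auto intro!: exI[of _ N0] less_imp_le\<close>)
    then show ?thesis using \<open>e > 0\<close> by (simp add: dist_norm)
  qed
  then show "\<forall>\<^sub>F N in sequentially. \<forall>z\<in>\<Sigma> \<inter> cball 0 r. dist (F N z x) (T z x) < e"
    unfolding eventually_sequentially by (intro exI[of _ N0]) auto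
qed

lemma T_contraction:
  assumes "z \<in> \<Sigma>"
  shows "contraction_op (T z)"
  unfolding contraction_op_def
proof (intro conjI allI)
  fix x y
  have "(\<lambda>N. F N z x - F N z y) \<longlonglongrightarrow> T z x - T z y"
    by (intro tendsto_intros F_tendsto_T assms)
  then show "T z (x - y) = T z x - T z y"
    using F_tendsto_T[OF assms, of "x - y"]
    by (simp add: contraction_op_diff F_contraction assms LIMSEQ_unique)
  show "norm (T z x) \<le> norm x"
    using contraction_op_norm[OF F_contraction[OF assms]]
    by (intro LIMSEQ_le_const2[OF tendsto_norm[OF F_tendsto_T[OF assms]]]) auto
qed

lemma T_scale:
  assumes "z \<in> \<Sigma>"
  shows "T z (c *\<^sub>C x) = c *\<^sub>C T z x"
proof -
  have "(\<lambda>N. c *\<^sub>C F N z x) \<longlonglongrightarrow> c *\<^sub>C T z x"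
    by (intro tendsto_scaleC tendsto_const F_tendsto_T assms)
  then show ?thesis
    using F_tendsto_T[OF assms, of "c *\<^sub>C x"] by (simp add: F_scale assms LIMSEQ_unique)
qed

lemma T_add:
  assumes "z \<in> \<Sigma>"
  shows "T z (x + y) = T z x + T z y"
  using contraction_op_diff[OF T_contraction[OF assms], of "x + y" y] by simp

lemma T_linear: "z \<in> \<Sigma> \<Longrightarrow> clinear_on UNIV (T z)"
  by (simp add: clinear_on_def T_scale T_add)

lemma T_second_order:
  assumes "z \<in> \<Sigma>" "x \<in> S2"
  shows "norm (T z x - x - z *\<^sub>C A x) \<le> (cmod z)\<^sup>2 * norm (A (A x))"
proof -
  have "(\<lambda>N. norm (F N z x - x - z *\<^sub>C A x)) \<longlonglongrightarrow> norm (T z x - x - z *\<^sub>C A x)"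
    by (intro tendsto_intros F_tendsto_T assms)
  then show ?thesis
    by (rule LIMSEQ_le_const2) (use F_second_order[OF assms] in \<open>auto intro!: exI[of _ 1]\<close>)
qed

text \<open>Telescoping against the identity: each of the \<open>N\<close> steps moves
  \<open>x\<close> by at most \<open>cmod z / N\<close> times \<open>norm (A x)\<close>. In contrast
  to \<open>T_second_order\<close>, this works on all of \<open>S\<close>.\<close>

lemma norm_T_minus_id:
  assumes z: "z \<in> \<Sigma>" and x: "x \<in> S"
  shows "norm (T z x - x) \<le> cmod z * norm (A x)"
proof -
  have "norm (F N z x - x) \<le> cmod z * norm (A x)" if "N > 0" for N
  proof -
    have h: "z / of_nat N \<in> \<Sigma>" using z that by (rule slope_sector_divide_nat)
    have "norm ((J (z / of_nat N) ^^ N) x - (id ^^ N) x) \<le> real N * norm (J (z / of_nat N) x - id x)"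
      by (rule contraction_funpow_diff) (auto simp: J_contraction h, simp add: contraction_op_def)
    also have "\<dots> \<le> real N * (cmod (z / of_nat N) * norm (A x))"
      using norm_J_minus_id[OF h x] by (simp add: mult_left_mono)
    finally show ?thesis using that by (simp add: F_def norm_divide)
  qed
  moreover have "(\<lambda>N. norm (F N z x - x)) \<longlonglongrightarrow> norm (T z x - x)"
    by (intro tendsto_intros F_tendsto_T assms)
  ultimately show ?thesis
    by (intro LIMSEQ_le_const2) (auto intro!: exI[of _ 1])
qed

text \<open>The approximations themselves do not satisfy the semigroup law. On \<open>S2\<close>,
  one step of length \<open>(z + w) / N\<close> differs from steps of lengths \<open>w / N\<close>
  and \<open>z / N\<close> in succession by order \<open>1 / N\<^sup>2\<close>, so the law holds in
  the limit; density and contractivity extend it.\<close>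

lemma T_semigroup:
  assumes z: "z \<in> \<Sigma>" and w: "w \<in> \<Sigma>"
  shows "T (z + w) x = T z (T w x)"
proof -
  have zw: "z + w \<in> \<Sigma>" using z w by (rule slope_sector_add)
  \<comment> \<open>\<open>F N z\<close> acts on the moving vector \<open>F N w x\<close>;
    contractivity reduces this to the fixed vector \<open>T w x\<close>.\<close>
  have comp: "(\<lambda>N. F N z (F N w x)) \<longlonglongrightarrow> T z (T w x)" for x
  proof -
    have "(\<lambda>N. F N w x - T w x) \<longlonglongrightarrow> 0"
      by (rule LIM_zero[OF F_tendsto_T[OF w]])
    then have "(\<lambda>N. F N z (F N w x - T w x)) \<longlonglongrightarrow> 0"
      by (rule Lim_transform_bound[rotated])
        (intro always_eventually allI contraction_op_norm[OF F_contraction[OF z]])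
    then have "(\<lambda>N. F N z (F N w x - T w x) + F N z (T w x)) \<longlonglongrightarrow> 0 + T z (T w x)"
      by (rule tendsto_add[OF _ F_tendsto_T[OF z]])
    then show ?thesis by (simp add: contraction_op_diff F_contraction z)
  qed
  have S2: "T (z + w) x = T z (T w x)" if x: "x \<in> S2" for x
  proof -
    let ?a = "norm (A (A x))"
    define C where "C = (cmod (z + w))\<^sup>2 * ?a + (cmod z)\<^sup>2 * ?a + cmod w * cmod z * ?a + (cmod w)\<^sup>2 * ?a"
    have "norm (F N (z + w) x - F N z (F N w x)) \<le> C / real N" if N: "N > 0" for N
    proof -
      define hz hw h where "hz = z / of_nat N" and "hw = w / of_nat N" and "h = (z + w) / of_nat N"
      have \<Sigma>: "hz \<in> \<Sigma>" "hw \<in> \<Sigma>" "h \<in> \<Sigma>"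
        using z w zw N by (simp_all add: hz_def hw_def h_def slope_sector_divide_nat)
      have sum: "h = hz + hw" by (simp add: h_def hz_def hw_def add_divide_distrib)
      let ?P = "J h" and ?Q = "J hz \<circ> J hw"
      have hA: "h *\<^sub>C A x = hz *\<^sub>C A x + hw *\<^sub>C A x"
        by (simp only: sum scaleC_add_left)
      have J: "J hz (J hw x - x - hw *\<^sub>C A x) = J hz (J hw x) - J hz x - hw *\<^sub>C J hz (A x)"
        by (simp only: contraction_op_diff[OF J_contraction[OF \<Sigma>(1)]] J_scale[OF \<Sigma>(1)])
      \<comment> \<open>The linear terms cancel because \<open>h = hz + hw\<close>; what remains are
        three local errors, one of them under \<open>J hz\<close>, and the effect of
        \<open>J hz\<close> on the linear term of the \<open>hw\<close>-step.\<close>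
      have eq: "?P x - ?Q x = (J h x - x - h *\<^sub>C A x) - (J hz x - x - hz *\<^sub>C A x)
          - hw *\<^sub>C (J hz (A x) - A x) - J hz (J hw x - x - hw *\<^sub>C A x)"
        unfolding J hA scaleC_diff_right o_apply by simp
      have "norm (?P x - ?Q x) \<le> norm (J h x - x - h *\<^sub>C A x) + norm (J hz x - x - hz *\<^sub>C A x)
          + norm (hw *\<^sub>C (J hz (A x) - A x)) + norm (J hz (J hw x - x - hw *\<^sub>C A x))"
        unfolding eq by (rule norm_diff_diff_diff_le)
      also have "\<dots> \<le> (cmod h)\<^sup>2 * ?a + (cmod hz)\<^sup>2 * ?a + cmod hw * (cmod hz * ?a) + (cmod hw)\<^sup>2 * ?a"
      proof (intro add_mono norm_J_second_order \<Sigma> x)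
        show "norm (hw *\<^sub>C (J hz (A x) - A x)) \<le> cmod hw * (cmod hz * ?a)"
          unfolding norm_scaleC by (intro mult_left_mono norm_J_minus_id \<Sigma> S2_A x) simp
        show "norm (J hz (J hw x - x - hw *\<^sub>C A x)) \<le> (cmod hw)\<^sup>2 * ?a"
          using contraction_op_norm[OF J_contraction[OF \<Sigma>(1)]] norm_J_second_order[OF \<Sigma>(2) x]
          by (rule order_trans)
      qed
      also have "\<dots> = C / (real N)\<^sup>2"
      proof -
        have n: "cmod h = cmod (z + w) / real N" "cmod hz = cmod z / real N" "cmod hw = cmod w / real N"
          by (simp_all add: h_def hz_def hw_def norm_divide)
        show ?thesis
          unfolding n C_def by (simp add: power_divide add_divide_distrib power2_eq_square)
      qed
      finally have PQ: "norm (?P x - ?Q x) \<le> C / (real N)\<^sup>2" .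
      have comm: "J hz \<circ> J hw = J hw \<circ> J hz"
        by (rule J_J_commute) (use \<Sigma> in auto)
      have "?P \<circ> ?Q = ?Q \<circ> ?P"
        using J_J_commute[OF \<Sigma>(3,1)] J_J_commute[OF \<Sigma>(3,2)] by (metis comp_assoc)
      then have "norm ((?P ^^ N) x - (?Q ^^ N) x) \<le> real N * norm (?P x - ?Q x)"
        by (rule contraction_funpow_diff[OF J_contraction[OF \<Sigma>(3)]
              contraction_op_comp[OF J_contraction[OF \<Sigma>(1)] J_contraction[OF \<Sigma>(2)]]])
      also have "\<dots> \<le> real N * (C / (real N)\<^sup>2)"
        by (intro mult_left_mono PQ) simp
      finally show ?thesis
        using N by (simp add: F_def h_def[symmetric] hz_def[symmetric] hw_def[symmetric]
            funpow_comp_commute[OF comm] power2_eq_square)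
    qed
    then have "\<forall>\<^sub>F N in sequentially. norm (F N (z + w) x - F N z (F N w x)) \<le> C / real N"
      by (intro eventually_mono[OF eventually_gt_at_top[of 0]])
    moreover have "(\<lambda>N. C / real N) \<longlonglongrightarrow> 0"
      by (rule lim_const_over_n)
    ultimately have "(\<lambda>N. F N (z + w) x - F N z (F N w x)) \<longlonglongrightarrow> 0"
      by (rule Lim_null_comparison)
    moreover have "(\<lambda>N. F N (z + w) x - F N z (F N w x)) \<longlonglongrightarrow> T (z + w) x - T z (T w x)"
      by (rule tendsto_diff[OF F_tendsto_T[OF zw] comp])
    ultimately have "T (z + w) x - T z (T w x) = 0"
      using LIMSEQ_unique by blast
    then show ?thesis by simp
  qed
  have "norm (T (z + w) x - T z (T w x)) \<le> 0"
  proof (rule field_le_epsilon)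
    fix e :: real assume "e > 0"
    then obtain x' where x': "x' \<in> S2" "norm (x - x') < e / 2"
      using S2_dense[of "e / 2" x] by auto
    have "T (z + w) x - T z (T w x) = T (z + w) (x - x') - T z (T w (x - x'))"
      using S2[OF x'(1)] by (simp add: contraction_op_diff T_contraction z w zw)
    also have "norm \<dots> \<le> norm (x - x') + norm (x - x')"
      using contraction_op_norm[OF T_contraction[OF zw], of "x - x'"]
        contraction_op_norm[OF contraction_op_comp[OF T_contraction[OF z] T_contraction[OF w]], of "x - x'"]
        norm_triangle_ineq4[of "T (z + w) (x - x')" "T z (T w (x - x'))"] by simp
    finally show "norm (T (z + w) x - T z (T w x)) \<le> 0 + e" using x'(2) by simp
  qed
  then show ?thesis by simp
qed

section \<open>Holomorphic dependence on the complex parameter\<close>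

lemma J_resolvent_identity:
  assumes "z \<in> \<Sigma>" "w \<in> \<Sigma>"
  shows "J w y - J z y = (w - z) *\<^sub>C J w (A (J z y))"
proof -
  let ?a = "J z y"
  have "y = (?a - w *\<^sub>C A ?a) + (w - z) *\<^sub>C A ?a"
    unfolding scaleC_diff_left using J_eq[OF assms(1), of y] by simp
  then have "J w y = J w (?a - w *\<^sub>C A ?a) + J w ((w - z) *\<^sub>C A ?a)"
    by (metis J_add[OF assms(2)])
  then show ?thesis
    unfolding J_unique[OF assms(2) J_in[OF assms(1)]] J_scale[OF assms(2)] by simp
qed

lemma eventually_in_sector: "z \<in> \<Sigma> \<Longrightarrow> \<forall>\<^sub>F w in at z. w \<in> \<Sigma>"
  using open_slope_sector eventually_at_in_open' by blast

lemma J_continuous: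
  assumes "z \<in> \<Sigma>"
  shows "((\<lambda>w. J w y) \<longlongrightarrow> J z y) (at z)"
proof -
  have "\<forall>\<^sub>F w in at z. norm (J w y - J z y) \<le> cmod (w - z) * norm (A (J z y))"
    using eventually_in_sector[OF assms]
  proof eventually_elim
    case (elim w)
    show ?case
      unfolding J_resolvent_identity[OF assms elim] norm_scaleC
      by (intro mult_left_mono contraction_op_norm J_contraction elim) simp
  qed
  moreover have "((\<lambda>w. cmod (w - z) * norm (A (J z y))) \<longlongrightarrow> cmod (z - z) * norm (A (J z y))) (at z)"
    by (intro tendsto_intros)
  then have "((\<lambda>w. cmod (w - z) * norm (A (J z y))) \<longlongrightarrow> 0) (at z)" by simp
  ultimately have "((\<lambda>w. J w y - J z y) \<longlongrightarrow> 0) (at z)"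
    by (rule Lim_null_comparison)
  then show ?thesis by (rule LIM_zero_cancel)
qed

text \<open>Product rule for \<open>J w (u w)\<close>. \<open>J\<close> is known to be continuous
  only strongly, so the difference quotient of \<open>u\<close> is split into its limit and a null
  part, on which contractivity acts. With \<open>u\<close> an iterate of \<open>J\<close>, induction
  yields differentiability of powers.\<close>

lemma J_complex_differentiable:
  assumes z: "z \<in> \<Sigma>"
    and u: "((\<lambda>w. inverse (w - z) *\<^sub>C (u w - u z)) \<longlongrightarrow> u') (at z)"
  shows "\<exists>d. ((\<lambda>w. inverse (w - z) *\<^sub>C (J w (u w) - J z (u z))) \<longlongrightarrow> d) (at z)"
proof
  let ?q = "\<lambda>w. inverse (w - z) *\<^sub>C (u w - u z)" and ?v = "A (J z (u z))"
  have "((\<lambda>w. ?q w - u') \<longlongrightarrow> 0) (at z)"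
    using u by (rule LIM_zero)
  then have "((\<lambda>w. J w (?q w - u')) \<longlongrightarrow> 0) (at z)"
    by (rule Lim_transform_bound[rotated])
      (use eventually_in_sector[OF z] in eventually_elim, simp add: contraction_op_norm J_contraction)
  then have "((\<lambda>w. J w (?q w - u') + J w u' + J w ?v) \<longlongrightarrow> 0 + J z u' + J z ?v) (at z)"
    by (intro tendsto_add J_continuous z)
  moreover have "\<forall>\<^sub>F w in at z. w \<noteq> z"
    by (simp add: eventually_at_filter)
  with eventually_in_sector[OF z]
  have "\<forall>\<^sub>F w in at z. J w (?q w - u') + J w u' + J w ?v = inverse (w - z) *\<^sub>C (J w (u w) - J z (u z))"
  proof eventually_elim
    case (elim w)
    note d = contraction_op_diff[OF J_contraction[OF elim(1)]]
    have "J w (u w) - J z (u z) = (J w (u w) - J w (u z)) + (J w (u z) - J z (u z))" by simp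
    also have "inverse (w - z) *\<^sub>C \<dots> = J w (?q w) + J w ?v"
      using elim by (simp add: J_resolvent_identity z d J_scale scaleC_add_right scaleC_scaleC scaleC_one)
    finally show ?case by (simp add: d)
  qed
  ultimately show "((\<lambda>w. inverse (w - z) *\<^sub>C (J w (u w) - J z (u z))) \<longlongrightarrow> 0 + J z u' + J z ?v) (at z)"
    by (rule Lim_transform_eventually)
qed

lemma F_holomorphic: "(\<lambda>z. cinner (F N z x) y) holomorphic_on \<Sigma>"
proof (cases "N = 0")
  case False
  have "\<exists>d. ((\<lambda>w. inverse (w - z) *\<^sub>C ((J w ^^ n) x - (J z ^^ n) x)) \<longlongrightarrow> d) (at z)" if "z \<in> \<Sigma>" for z n
  proof (induction n)
    case (Suc n)
    then show ?case
      using J_complex_differentiable[OF that, of "\<lambda>w. (J w ^^ n) x"] by auto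
  qed auto
  have "(\<lambda>z. cinner ((J z ^^ n) x) y) holomorphic_on \<Sigma>" for n
    unfolding holomorphic_on_open[OF open_slope_sector]
  proof
    fix z assume "z \<in> \<Sigma>"
    with \<open>\<And>z n. z \<in> \<Sigma> \<Longrightarrow> _ z n\<close> obtain d
      where d: "((\<lambda>w. inverse (w - z) *\<^sub>C ((J w ^^ n) x - (J z ^^ n) x)) \<longlongrightarrow> d) (at z)" by blast
    have "((\<lambda>w. cinner (inverse (w - z) *\<^sub>C ((J w ^^ n) x - (J z ^^ n) x)) y) \<longlongrightarrow> cinner d y) (at z)"
      by (intro tendsto_cinner d tendsto_const)
    then have "((\<lambda>z. cinner ((J z ^^ n) x) y) has_field_derivative cinner d y) (at z)"
      by (simp add: has_field_derivative_iff cinner_scaleC_left cinner_diff_left divide_inverse mult.commute)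
    then show "\<exists>f'. ((\<lambda>z. cinner ((J z ^^ n) x) y) has_field_derivative f') (at z)" by blast
  qed
  then have "(\<lambda>z. cinner ((J z ^^ N) x) y) \<circ> (\<lambda>z. z / of_nat N) holomorphic_on \<Sigma>"
    by (intro holomorphic_on_compose_gen[where t = \<Sigma>] holomorphic_intros)
      (use False in \<open>auto simp: slope_sector_divide_nat\<close>)
  then show ?thesis by (simp add: F_def o_def)
qed (simp add: F_def)

lemma T_holomorphic: "(\<lambda>z. cinner (T z x) y) holomorphic_on \<Sigma>"
proof (rule holomorphic_uniform_sequence[OF open_slope_sector F_holomorphic])
  fix z assume "z \<in> \<Sigma>"
  then obtain d where d: "d > 0" "cball z d \<subseteq> \<Sigma>"
    using open_slope_sector open_contains_cball by blast
  have "cball z d \<subseteq> cball 0 (cmod z + d)"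
    by (auto simp: dist_norm) (metis add.commute diff_add_cancel norm_minus_commute norm_triangle_le add_left_mono)
  then have "uniform_limit (cball z d) (\<lambda>N z. F N z x) (\<lambda>z. T z x) sequentially"
    using d by (intro uniform_limit_on_subset[OF F_uniform_limit]) auto
  then have "uniform_limit (cball z d) (\<lambda>N z. cinner (F N z x) y) (\<lambda>z. cinner (T z x) y) sequentially"
    by (rule bounded_linear.uniform_limit[OF bounded_bilinear.bounded_linear_left[OF bounded_bilinear_cinner]])
  with d show "\<exists>d>0. cball z d \<subseteq> \<Sigma> \<and>
      uniform_limit (cball z d) (\<lambda>N z. cinner (F N z x) y) (\<lambda>z. cinner (T z x) y) sequentially" by blast
qed

text \<open>The weak derivatives form a sesquilinear form \<open>g\<close>, bounded by Cauchy's
  estimate, and Riesz turns it into \<open>L\<close>. The error is uniform in \<open>x\<close>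
  because the matrix elements on the disc are bounded by \<open>norm x * norm y\<close>.\<close>

lemma T_complex_derivative:
  assumes z: "z \<in> \<Sigma>"
  shows "\<exists>L. bounded_op UNIV norm L \<and> (\<forall>\<epsilon>>0. \<forall>\<^sub>F w in at z. \<forall>x\<in>UNIV.
           norm (inverse (w - z) *\<^sub>C (T w x - T z x) - L x) \<le> \<epsilon> * norm x)"
proof -
  obtain r where r: "r > 0" "cball z r \<subseteq> \<Sigma>"
    using z open_slope_sector open_contains_cball by blast
  define g where "g x y = deriv (\<lambda>w. cinner (T w x) y) z" for x y
  have bound: "cmod (cinner (T w x) y) \<le> norm x * norm y" if "w \<in> cball z r" for w x y
    using that r(2) cmod_cinner_le[of "T w x" y] contraction_op_norm[OF T_contraction, of w x]
    by (meson mult_right_mono norm_ge_zero order_trans subsetD)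
  note Cauchy = Cauchy_difference_quotient[OF T_holomorphic open_slope_sector r(2,1) bound]
  have diff: "(\<lambda>w. cinner (T w x) y) field_differentiable at z" for x y
    using T_holomorphic z open_slope_sector holomorphic_on_imp_differentiable_at by blast
  \<comment> \<open>\<open>deriv\<close> depends only on values near \<open>z\<close>, so identities
    valid on the open sector suffice.\<close>
  have eq: "g x y = deriv f z" if "\<And>w. w \<in> \<Sigma> \<Longrightarrow> cinner (T w x) y = f w" for x y f
    unfolding g_def using eventually_nhds_in_open[OF open_slope_sector z] that
    by (intro deriv_cong_ev) (auto elim: eventually_mono)
  have add_r: "g x (y + y') = g x y + g x y'" for x y y'
    using diff by (subst eq[of _ _ "\<lambda>w. cinner (T w x) y + cinner (T w x) y'"])
      (auto simp: cinner_add_right g_def)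
  have scale_r: "g x (c *\<^sub>C y) = cnj c * g x y" for x y c
    using diff by (subst eq[of _ _ "\<lambda>w. cnj c * cinner (T w x) y"])
      (auto simp: cinner_scaleC_right g_def)
  have add_l: "g (x + x') y = g x y + g x' y" for x x' y
    using diff by (subst eq[of _ _ "\<lambda>w. cinner (T w x) y + cinner (T w x') y"])
      (auto simp: cinner_add_left g_def T_add)
  have scale_l: "g (c *\<^sub>C x) y = c * g x y" for x y c
    using diff by (subst eq[of _ _ "\<lambda>w. c * cinner (T w x) y"])
      (auto simp: cinner_scaleC_left g_def T_scale)
  have "\<exists>h. \<forall>y. g x y = cinner h y" for x
  proof -
    have "cmod (g x y) \<le> norm x / r * norm y" for y
      using Cauchy(1)[of x y] by (simp add: g_def)
    then obtain h where "\<And>y. g x y = cinner h y"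
      using riesz_representation[of "g x"] add_r scale_r by blast
    then show ?thesis by blast
  qed
  then obtain L where L: "\<And>x y. g x y = cinner (L x) y" by metis
  have "bounded_op UNIV norm L"
    unfolding bounded_op_def clinear_on_def
  proof (intro conjI ballI allI exI)
    show "L (x + y) = L x + L y" for x y
      by (rule cinner_eqI) (simp add: L[symmetric] cinner_add_left add_l)
    show "L (c *\<^sub>C x) = c *\<^sub>C L x" for c x
      by (rule cinner_eqI) (simp add: L[symmetric] cinner_scaleC_left scale_l)
    show "norm (L x) \<le> 1 / r * norm x" for x
    proof (cases "L x = 0")
      case False
      have "norm (L x) * norm (L x) = cmod (g x (L x))"
        by (simp add: L cinner_self norm_power power2_eq_square norm_mult)
      also have "\<dots> \<le> norm x * norm (L x) / r"
        using Cauchy(1)[of x "L x"] by (simp add: g_def)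
      also have "\<dots> = (norm x / r) * norm (L x)" by simp
      finally have "norm (L x) \<le> norm x / r"
        by (rule mult_right_le_imp_le) (use False in simp)
      then show ?thesis by simp
    qed (use r in simp)
  qed auto
  moreover have "\<forall>\<^sub>F w in at z. \<forall>x\<in>UNIV. norm (inverse (w - z) *\<^sub>C (T w x - T z x) - L x) \<le> \<epsilon> * norm x"
    if "\<epsilon> > 0" for \<epsilon>
  proof -
    \<comment> \<open>The first bound keeps \<open>w\<close> in range of the Cauchy estimate, the
      second turns its constant \<open>8 / r\<^sup>2\<close> into \<epsilon>.\<close>
    define \<delta> where "\<delta> = min (r / 2) (\<epsilon> * r\<^sup>2 / 8)"
    have \<delta>: "\<delta> > 0" using r \<open>\<epsilon> > 0\<close> by (simp add: \<delta>_def)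
    have "norm (inverse (w - z) *\<^sub>C (T w x - T z x) - L x) \<le> \<epsilon> * norm x"
      if w: "w \<noteq> z" "dist w z < \<delta>" for w x
    proof -
      \<comment> \<open>Testing the weak estimate with the error vector itself recovers its
        norm.\<close>
      define v where "v = inverse (w - z) *\<^sub>C (T w x - T z x) - L x"
      have "cinner v v = (cinner (T w x) v - cinner (T z x) v) / (w - z) - g x v"
        unfolding v_def L by (simp add: cinner_diff_left cinner_scaleC_left divide_inverse mult.commute)
      then have "cmod (cinner v v) \<le> 8 * (norm x * norm v) / r\<^sup>2 * dist w z"
        using Cauchy(2)[of w x v] w by (simp add: g_def \<delta>_def)
      then have "norm v * norm v \<le> (8 * norm x / r\<^sup>2 * dist w z) * norm v"
        by (simp add: cinner_self norm_mult power2_eq_square ac_simps)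
      then have "norm v \<le> 8 * norm x / r\<^sup>2 * dist w z"
        by (cases "v = 0") (simp, rule mult_right_le_imp_le, auto)
      also have "\<dots> \<le> 8 * norm x / r\<^sup>2 * (\<epsilon> * r\<^sup>2 / 8)"
        using w by (intro mult_left_mono) (auto simp: \<delta>_def)
      also have "\<dots> = \<epsilon> * norm x" using r by simp
      finally show ?thesis by (simp add: v_def)
    qed
    then show ?thesis
      unfolding eventually_at using \<delta> by blast
  qed
  ultimately show ?thesis by blast
qed

section \<open>Strong continuity at 0 and identification of the generator\<close>

lemma T_strongly_continuous: "((\<lambda>z. norm (T z x - x)) \<longlongrightarrow> 0) (at 0 within \<Sigma>)"
proof (rule tendstoI)
  fix e :: real assume e: "e > 0"
  obtain s where s: "s \<in> S2" "norm (x - s) < e / 4"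
    using S2_dense[of "e / 4" x] e by auto
  \<comment> \<open>The two approximation errors take less than \<open>e / 2\<close> together, which
    leaves \<open>e / 2\<close> for the middle term; the summand 1 avoids division by 0.\<close>
  define \<delta> where "\<delta> = e / (2 * (norm (A s) + 1))"
  have p: "norm (A s) + 1 > 0" by (smt (verit) norm_ge_zero)
  have \<delta>: "\<delta> > 0" using e p by (simp add: \<delta>_def)
  have half: "e / (2 * c) * c = e / 2" if "c > 0" for c :: real
    using that by simp
  have "dist (norm (T z x - x)) 0 < e" if z: "z \<in> \<Sigma>" "dist z 0 < \<delta>" for z
  proof -
    have "T z x - x = T z (x - s) + (T z s - s) - (x - s)"
      by (simp add: contraction_op_diff T_contraction z)
    also have "norm \<dots> \<le> norm (T z (x - s)) + norm (T z s - s) + norm (x - s)"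
      by (rule norm_add_diff_le)
    also have "\<dots> \<le> norm (x - s) + cmod z * norm (A s) + norm (x - s)"
      by (intro add_mono contraction_op_norm T_contraction norm_T_minus_id z S2_S s order_refl)
    also have "cmod z * norm (A s) \<le> \<delta> * (norm (A s) + 1)"
      using z \<delta> by (intro mult_mono) auto
    also have "\<delta> * (norm (A s) + 1) = e / 2"
      unfolding \<delta>_def by (rule half[OF p])
    finally show ?thesis using s(2) by simp
  qed
  then show "\<forall>\<^sub>F z in at 0 within \<Sigma>. dist (norm (T z x - x)) 0 < e"
    unfolding eventually_at using \<delta> by blast
qed

text \<open>The quadratic estimate is available at \<open>s\<close> only; the rest
  \<open>x - s\<close> contributes at most \<open>2 * norm (A x - A s)\<close> after division by
  \<open>t\<close>, hence the approximation in the graph norm.\<close>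

lemma T_right_derivative:
  assumes x: "x \<in> S"
  shows "((\<lambda>t. norm ((1 / t) *\<^sub>R (T (of_real t) x - x) - A x)) \<longlongrightarrow> 0) (at_right 0)"
proof (rule tendstoI)
  fix e :: real assume e: "e > 0"
  obtain s where s: "s \<in> S2" "norm (A x - A s) < e / 4"
    using S2_graph_dense[OF x, of "e / 4"] e by auto
  let ?a = "norm (A (A s))"
  define \<delta> where "\<delta> = e / (2 * (?a + 1))"
  have p: "?a + 1 > 0" by (smt (verit) norm_ge_zero)
  have \<delta>: "\<delta> > 0" using e p by (simp add: \<delta>_def)
  have half: "e / (2 * c) * c = e / 2" if "c > 0" for c :: real
    using that by simp
  have "dist (norm ((1 / t) *\<^sub>R (T (of_real t) x - x) - A x)) 0 < e" if t: "0 < t" "t < \<delta>" for t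
  proof -
    have \<Sigma>: "complex_of_real t \<in> \<Sigma>" using slope_sector_of_real[OF \<kappa>_pos t(1)] .
    have "(1 / t) *\<^sub>R (T (of_real t) x - x) - A x = (1 / t) *\<^sub>R (T (of_real t) x - x - t *\<^sub>R A x)"
      using t by (simp add: scaleR_diff_right)
    also have "\<dots> = (1 / t) *\<^sub>R ((T (of_real t) (x - s) - (x - s)) + (T (of_real t) s - s - of_real t *\<^sub>C A s) - t *\<^sub>R (A x - A s))"
      by (simp add: contraction_op_diff T_contraction \<Sigma> scaleR_scaleC scaleC_diff_right algebra_simps)
    also have "norm \<dots> = 1 / t * norm ((T (of_real t) (x - s) - (x - s)) + (T (of_real t) s - s - of_real t *\<^sub>C A s) - t *\<^sub>R (A x - A s))"
      using t by simp
    also have "\<dots> \<le> 1 / t * (norm (T (of_real t) (x - s) - (x - s)) + norm (T (of_real t) s - s - of_real t *\<^sub>C A s) + norm (t *\<^sub>R (A x - A s)))"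
      using t by (intro mult_left_mono norm_add_diff_le) simp
    also have "\<dots> \<le> 1 / t * (t * norm (A x - A s) + t\<^sup>2 * ?a + t * norm (A x - A s))"
      using norm_T_minus_id[OF \<Sigma> S_diff[OF x S2_S[OF s(1)]]] T_second_order[OF \<Sigma> s(1)] t
      by (intro mult_left_mono add_mono) (auto simp: A_diff x S2_S[OF s(1)])
    also have "\<dots> = 2 * norm (A x - A s) + t * ?a"
      using t by (simp add: field_simps power2_eq_square)
    also have "t * ?a \<le> \<delta> * (?a + 1)"
      using t by (intro mult_mono) auto
    also have "\<delta> * (?a + 1) = e / 2"
      unfolding \<delta>_def by (rule half[OF p])
    finally show ?thesis using s(2) by simp
  qed
  then show "\<forall>\<^sub>F t in at_right 0. dist (norm ((1 / t) *\<^sub>R (T (of_real t) x - x) - A x)) 0 < e"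
    unfolding eventually_at_right_field using \<delta> by auto
qed

text \<open>One inclusion is the right derivative. For the other, the derivative of a contraction
  semigroup is dissipative, so it cannot properly extend \<open>A\<close>, for which
  \<open>1 - A\<close> is already onto.\<close>

lemma T_generator: "is_generator UNIV norm T S A"
  unfolding is_generator_def
proof (intro allI iffI)
  fix x y assume "x \<in> S \<and> y = A x"
  then show "x \<in> UNIV \<and> y \<in> UNIV \<and>
      ((\<lambda>t. norm ((1 / t) *\<^sub>R (T (of_real t) x - x) - y)) \<longlongrightarrow> 0) (at_right 0)"
    using T_right_derivative by auto
next
  fix x y assume "x \<in> UNIV \<and> y \<in> UNIV \<and>
      ((\<lambda>t. norm ((1 / t) *\<^sub>R (T (of_real t) x - x) - y)) \<longlongrightarrow> 0) (at_right 0)"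
  then have "((\<lambda>t. norm ((1 / t) *\<^sub>R (T (of_real t) x - x) - y)) \<longlongrightarrow> 0) (at_right 0)"
    by blast
  then have xy: "((\<lambda>t. (1 / t) *\<^sub>R (T (of_real t) x - x)) \<longlongrightarrow> y) (at_right 0)"
    by (rule LIM_zero_cancel[OF tendsto_norm_zero_cancel])
  have one: "1 \<in> \<Sigma>" using slope_sector_of_real[OF \<kappa>_pos, of 1] by simp
  \<comment> \<open>By the choice of \<open>u\<close>, the difference \<open>v\<close> equals its
    own right derivative \<open>y - A u\<close>; contractivity then makes
    \<open>Re (cinner v v)\<close> nonpositive, so \<open>v\<close> vanishes.\<close>
  define u v where "u = J 1 (x - y)" and "v = x - u"
  have u: "u \<in> S" "u - A u = x - y"
    using J[OF one, of "x - y"] by (simp_all add: u_def scaleC_one)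
  have "((\<lambda>t. (1 / t) *\<^sub>R (T (of_real t) u - u)) \<longlongrightarrow> A u) (at_right 0)"
    by (rule LIM_zero_cancel[OF tendsto_norm_zero_cancel[OF T_right_derivative[OF u(1)]]])
  note ueq = this
  have v: "v = y - A u" using u(2) by (simp add: v_def algebra_simps)
  have "((\<lambda>t. (1 / t) *\<^sub>R (T (of_real t) x - x) - (1 / t) *\<^sub>R (T (of_real t) u - u)) \<longlongrightarrow> v) (at_right 0)"
    unfolding v by (rule tendsto_diff[OF xy ueq])
  moreover have "\<forall>\<^sub>F t in at_right 0. (1 / t) *\<^sub>R (T (of_real t) x - x) - (1 / t) *\<^sub>R (T (of_real t) u - u)
      = (1 / t) *\<^sub>R (T (of_real t) v - v)"
    using eventually_at_right_less[of "0::real"]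
  proof eventually_elim
    case (elim t)
    then show ?case
      using contraction_op_diff[OF T_contraction[OF slope_sector_of_real[OF \<kappa>_pos elim]], of x u]
      by (simp add: v_def scaleR_diff_right[symmetric] del: scaleR_diff_right)
  qed
  ultimately have "((\<lambda>t. (1 / t) *\<^sub>R (T (of_real t) v - v)) \<longlongrightarrow> v) (at_right 0)"
    by (rule Lim_transform_eventually)
  then have "((\<lambda>t. Re (cinner ((1 / t) *\<^sub>R (T (of_real t) v - v)) v)) \<longlongrightarrow> Re (cinner v v)) (at_right 0)"
    by (intro tendsto_Re tendsto_cinner tendsto_const)
  moreover have "\<forall>\<^sub>F t in at_right 0. Re (cinner ((1 / t) *\<^sub>R (T (of_real t) v - v)) v) \<le> 0"
    using eventually_at_right_less[of "0::real"]
  proof eventually_elim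
    case (elim t)
    have "Re (cinner (T (of_real t) v) v) \<le> norm (T (of_real t) v) * norm v"
      by (rule Re_cinner_le)
    also have "\<dots> \<le> (norm v)\<^sup>2"
      using contraction_op_norm[OF T_contraction[OF slope_sector_of_real[OF \<kappa>_pos elim]], of v]
      by (simp add: power2_eq_square mult_right_mono)
    finally show ?case
      using elim by (simp add: scaleR_scaleC cinner_scaleC_left cinner_diff_left cinner_self divide_le_0_iff del: of_real_power)
  qed
  ultimately have "Re (cinner v v) \<le> 0"
    by (rule tendsto_upperbound) simp
  then have "v = 0" by (simp add: cinner_self del: of_real_power)
  then have "x = u" by (simp add: v_def)
  then show "x \<in> S \<and> y = A x" using u by auto
qed

lemma T_analytic: "analytic_semigroup UNIV norm (arctan \<kappa>) T"
  unfolding analytic_semigroup_def sector_arctan[OF \<kappa>_pos]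
proof (intro conjI ballI)
  fix z assume "z \<in> insert 0 \<Sigma>"
  then consider "z = 0" | "z \<in> \<Sigma>" by blast
  then show "bounded_op UNIV norm (T z)"
  proof cases
    case 1
    then show ?thesis
      by (auto simp: bounded_op_def clinear_on_def T_def intro!: exI[of _ 1])
  next
    case 2
    then show ?thesis
      using contraction_op_norm[OF T_contraction]
      by (auto simp: bounded_op_def T_linear intro!: exI[of _ 1])
  qed
next
  fix z assume "z \<in> \<Sigma>"
  then show "\<exists>L. bounded_op UNIV norm L \<and> (\<forall>\<epsilon>>0. \<forall>\<^sub>F w in at z. \<forall>x\<in>UNIV.
      norm (inverse (w - z) *\<^sub>C (T w x - T z x) - L x) \<le> \<epsilon> * norm x)"
    by (rule T_complex_derivative)
qed (simp_all add: T_def[of 0] T_semigroup T_strongly_continuous)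

theorem generates: "generates_analytic_semigroup UNIV norm S A"
  unfolding generates_analytic_semigroup_def
proof (intro exI conjI)
  show "0 < arctan \<kappa>" "arctan \<kappa> \<le> pi / 2"
    using \<kappa>_pos arctan_ubound[of \<kappa>] by auto
qed (fact T_analytic T_generator)+

end

section \<open>Rescaling and transport of semigroups\<close>

lemma bounded_opE:
  assumes "bounded_op X N T" and "\<And>x. x \<in> X \<Longrightarrow> N x \<ge> 0"
  obtains C where "C \<ge> 0" "\<And>x. x \<in> X \<Longrightarrow> N (T x) \<le> C * N x"
proof -
  obtain C where C: "\<forall>x\<in>X. N (T x) \<le> C * N x"
    using assms(1) by (auto simp: bounded_op_def)
  have "N (T x) \<le> max C 0 * N x" if "x \<in> X" for x
    using C that assms(2)[OF that] by (meson max.cobounded1 mult_right_mono order_trans)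
  then show thesis using that[of "max C 0"] by simp
qed

lemma has_field_derivative_exp_scaled:
  "((\<lambda>w. exp (c * w)) has_field_derivative c * exp (c * z)) (at z)" for c z :: complex
  by (auto intro!: derivative_eq_intros)

text \<open>Product rule for the right derivative at 0; used with \<open>c\<close> and with
  \<open>- c\<close>, to pass between the two semigroups in both directions.\<close>

lemma right_derivative_exp_scaled:
  fixes U :: "real \<Rightarrow> 'a::chilbert_space"
  assumes "((\<lambda>t. norm ((1 / t) *\<^sub>R (U t - x) - y)) \<longlongrightarrow> 0) (at_right 0)"
  shows "((\<lambda>t. norm ((1 / t) *\<^sub>R (exp (c * of_real t) *\<^sub>C U t - x) - (y + c *\<^sub>C x))) \<longlongrightarrow> 0) (at_right 0)"
proof -
  have U: "((\<lambda>t. (1 / t) *\<^sub>R (U t - x)) \<longlongrightarrow> y) (at_right 0)"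
    by (rule LIM_zero_cancel[OF tendsto_norm_zero_cancel[OF assms]])
  have of_real: "((\<lambda>t. complex_of_real t) \<longlongrightarrow> 0) (at_right 0)"
    using tendsto_of_real[OF tendsto_ident_at, of 0 "{0<..}"] by simp
  then have e: "((\<lambda>t. exp (c * of_real t)) \<longlongrightarrow> exp (c * 0)) (at_right (0::real))"
    by (intro tendsto_intros)
  have "((\<lambda>w. (exp (c * w) - exp (c * 0)) / (w - 0)) \<longlongrightarrow> c * exp (c * 0)) (at 0)"
    using has_field_derivative_exp_scaled[of c 0] unfolding has_field_derivative_iff .
  then have "((\<lambda>w. (exp (c * w) - 1) / w) \<longlongrightarrow> c) (at 0)" by simp
  moreover have "filterlim complex_of_real (at 0) (at_right 0)"
    unfolding filterlim_at using of_real by (auto simp: eventually_at_right_less eventually_at_filter)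
  ultimately have q: "((\<lambda>t. (exp (c * of_real t) - 1) / of_real t) \<longlongrightarrow> c) (at_right (0::real))"
    by (rule filterlim_compose)
  have "((\<lambda>t. exp (c * of_real t) *\<^sub>C ((1 / t) *\<^sub>R (U t - x)) + ((exp (c * of_real t) - 1) / of_real t) *\<^sub>C x)
      \<longlongrightarrow> exp (c * 0) *\<^sub>C y + c *\<^sub>C x) (at_right 0)"
    by (rule tendsto_add[OF tendsto_scaleC[OF e U] tendsto_scaleC[OF q tendsto_const]])
  moreover have "exp (c * of_real t) *\<^sub>C ((1 / t) *\<^sub>R (U t - x)) + ((exp (c * of_real t) - 1) / of_real t) *\<^sub>C x
      = (1 / t) *\<^sub>R (exp (c * of_real t) *\<^sub>C U t - x)" for t
    by (simp add: scaleR_scaleC scaleC_scaleC scaleC_diff_left scaleC_diff_right diff_divide_distrib)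
  ultimately have "((\<lambda>t. (1 / t) *\<^sub>R (exp (c * of_real t) *\<^sub>C U t - x)) \<longlongrightarrow> y + c *\<^sub>C x) (at_right 0)"
    by (simp add: scaleC_one)
  from tendsto_norm_zero[OF LIM_zero[OF this]] show ?thesis .
qed

text \<open>Product rule in the operator norm: the error splits into three terms, each allotted a
  third of \<epsilon>. \<open>K\<close> bounds the exponential near \<open>z\<close>;
  \<open>CL + 1\<close> and \<open>CT + 1\<close> avoid division by 0.\<close>

lemma operator_derivative_exp_scaled:
  fixes T :: "complex \<Rightarrow> 'a::chilbert_space \<Rightarrow> 'a"
  assumes L: "bounded_op UNIV norm L" and T: "bounded_op UNIV norm (T z)"
    and deriv: "\<And>\<epsilon>. \<epsilon> > 0 \<Longrightarrow> \<forall>\<^sub>F w in at z. \<forall>x. norm (inverse (w - z) *\<^sub>C (T w x - T z x) - L x) \<le> \<epsilon> * norm x"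
    and "\<epsilon> > 0"
  shows "\<forall>\<^sub>F w in at z. \<forall>x. norm (inverse (w - z) *\<^sub>C (exp (c * w) *\<^sub>C T w x - exp (c * z) *\<^sub>C T z x)
           - (exp (c * z) *\<^sub>C L x + (c * exp (c * z)) *\<^sub>C T z x)) \<le> \<epsilon> * norm x"
proof -
  obtain CL where CL: "CL \<ge> 0" "\<And>x. norm (L x) \<le> CL * norm x"
    using bounded_opE[OF L] by auto
  obtain CT where CT: "CT \<ge> 0" "\<And>x. norm (T z x) \<le> CT * norm x"
    using bounded_opE[OF T] by auto
  define K where "K = cmod (exp (c * z)) + 1"
  have K: "K > 0" unfolding K_def by (smt (verit) norm_ge_zero)
  have lim: "((\<lambda>w. exp (c * w)) \<longlongrightarrow> exp (c * z)) (at z)"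
    by (intro tendsto_intros)
  have "\<forall>\<^sub>F w in at z. dist (exp (c * w)) (exp (c * z)) < 1"
    using tendstoD[OF lim, of 1] by simp
  moreover have "\<forall>\<^sub>F w in at z. dist (exp (c * w)) (exp (c * z)) < \<epsilon> / (3 * (CL + 1))"
    using CL \<open>\<epsilon> > 0\<close> by (intro tendstoD[OF lim]) simp
  moreover have "((\<lambda>w. (exp (c * w) - exp (c * z)) / (w - z)) \<longlongrightarrow> c * exp (c * z)) (at z)"
    using has_field_derivative_exp_scaled[of c z] unfolding has_field_derivative_iff .
  then have "\<forall>\<^sub>F w in at z. dist ((exp (c * w) - exp (c * z)) / (w - z)) (c * exp (c * z)) < \<epsilon> / (3 * (CT + 1))"
    using CT \<open>\<epsilon> > 0\<close> by (intro tendstoD) auto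
  moreover have "\<forall>\<^sub>F w in at z. \<forall>x. norm (inverse (w - z) *\<^sub>C (T w x - T z x) - L x) \<le> \<epsilon> / (3 * K) * norm x"
    using K \<open>\<epsilon> > 0\<close> by (intro deriv) simp
  ultimately show ?thesis
  proof eventually_elim
    case (elim w)
    show ?case
    proof
      fix x
      let ?q = "inverse (w - z) *\<^sub>C (T w x - T z x) - L x"
      let ?d = "(exp (c * w) - exp (c * z)) / (w - z) - c * exp (c * z)"
      have "cmod (exp (c * w)) \<le> K"
        using elim(1) norm_triangle_ineq2[of "exp (c * w)" "exp (c * z)"] by (simp add: K_def dist_norm)
      then have 1: "cmod (exp (c * w)) * norm ?q \<le> K * (\<epsilon> / (3 * K) * norm x)"
        using elim(4) K by (intro mult_mono) auto
      have 2: "cmod (exp (c * w) - exp (c * z)) * norm (L x) \<le> \<epsilon> / (3 * (CL + 1)) * ((CL + 1) * norm x)"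
      proof (intro mult_mono)
        show "norm (L x) \<le> (CL + 1) * norm x"
          using CL(2)[of x] by (simp add: distrib_right add_increasing2)
      qed (use elim(2) CL \<open>\<epsilon> > 0\<close> in \<open>auto simp: dist_norm\<close>)
      have 3: "cmod ?d * norm (T z x) \<le> \<epsilon> / (3 * (CT + 1)) * ((CT + 1) * norm x)"
      proof (intro mult_mono)
        show "norm (T z x) \<le> (CT + 1) * norm x"
          using CT(2)[of x] by (simp add: distrib_right add_increasing2)
      qed (use elim(3) CT \<open>\<epsilon> > 0\<close> in \<open>auto simp: dist_norm\<close>)
      have cancel: "\<epsilon> / (3 * k) * (k * norm x) = \<epsilon> / 3 * norm x" if "k > 0" for k
        using that by simp
      have K3: "K * (\<epsilon> / (3 * K) * norm x) = \<epsilon> / 3 * norm x"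
        using K by simp
      have eq: "inverse (w - z) *\<^sub>C (exp (c * w) *\<^sub>C T w x - exp (c * z) *\<^sub>C T z x)
           - (exp (c * z) *\<^sub>C L x + (c * exp (c * z)) *\<^sub>C T z x)
           = exp (c * w) *\<^sub>C ?q + (exp (c * w) - exp (c * z)) *\<^sub>C L x + ?d *\<^sub>C T z x"
        by (simp add: scaleC_diff_left scaleC_diff_right scaleC_scaleC divide_inverse left_diff_distrib right_diff_distrib mult.commute)
      have "norm (exp (c * w) *\<^sub>C ?q + (exp (c * w) - exp (c * z)) *\<^sub>C L x + ?d *\<^sub>C T z x)
          \<le> norm (exp (c * w) *\<^sub>C ?q) + norm ((exp (c * w) - exp (c * z)) *\<^sub>C L x) + norm (?d *\<^sub>C T z x)"
        by (rule order_trans[OF norm_triangle_ineq add_right_mono[OF norm_triangle_ineq]])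
      also have "\<dots> \<le> \<epsilon> / 3 * norm x + \<epsilon> / 3 * norm x + \<epsilon> / 3 * norm x"
        unfolding norm_scaleC using 1 2 3 CL(1) CT(1)
        by (intro add_mono) (simp_all only: K3 cancel add_nonneg_pos zero_less_one)
      finally show "norm (inverse (w - z) *\<^sub>C (exp (c * w) *\<^sub>C T w x - exp (c * z) *\<^sub>C T z x)
           - (exp (c * z) *\<^sub>C L x + (c * exp (c * z)) *\<^sub>C T z x)) \<le> \<epsilon> * norm x"
        unfolding eq by simp
    qed
  qed
qed

text \<open>Multiplying the semigroup by \<open>exp (c * z)\<close> adds \<open>c\<close> to its
  generator. Thus it is enough that a translate of the operator is sectorial.\<close>

lemma generates_shift:
  fixes A :: "'a::chilbert_space \<Rightarrow> 'a"
  assumes "generates_analytic_semigroup UNIV norm S (\<lambda>x. A x - c *\<^sub>C x)"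
  shows "generates_analytic_semigroup UNIV norm S A"
proof -
  obtain \<theta> T where \<theta>: "0 < \<theta>" "\<theta> \<le> pi / 2"
    and an: "analytic_semigroup UNIV norm \<theta> T"
    and gen: "is_generator UNIV norm T S (\<lambda>x. A x - c *\<^sub>C x)"
    using assms by (auto simp: generates_analytic_semigroup_def)
  have bdd: "\<And>z. z \<in> insert 0 (sector \<theta>) \<Longrightarrow> bounded_op UNIV norm (T z)"
    and T0: "\<And>x. T 0 x = x"
    and semi: "\<And>z w x. z \<in> sector \<theta> \<Longrightarrow> w \<in> sector \<theta> \<Longrightarrow> T (z + w) x = T z (T w x)"
    and deriv: "\<And>z. z \<in> sector \<theta> \<Longrightarrow> \<exists>L. bounded_op UNIV norm L \<and> (\<forall>\<epsilon>>0. \<forall>\<^sub>F w in at z.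
        \<forall>x\<in>UNIV. norm (inverse (w - z) *\<^sub>C (T w x - T z x) - L x) \<le> \<epsilon> * norm x)"
    and cont: "\<And>x. ((\<lambda>z. norm (T z x - x)) \<longlongrightarrow> 0) (at 0 within sector \<theta>)"
    using an by (auto simp: analytic_semigroup_def)
  define U where "U z x = exp (c * z) *\<^sub>C T z x" for z x
  have bdd_scale: "bounded_op UNIV norm (\<lambda>x. a *\<^sub>C P x)"
    if P: "bounded_op UNIV norm P" for a and P :: "'a \<Rightarrow> 'a"
  proof -
    obtain C where C: "\<And>x. norm (P x) \<le> C * norm x"
      using bounded_opE[OF P] by auto
    then have "norm (a *\<^sub>C P x) \<le> (cmod a * C) * norm x" for x
      by (simp add: norm_scaleC mult_left_mono mult.assoc)
    moreover have "clinear_on UNIV (\<lambda>x. a *\<^sub>C P x)"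
      using P by (simp add: bounded_op_def clinear_on_def scaleC_add_right scaleC_scaleC mult.commute)
    ultimately show ?thesis
      unfolding bounded_op_def by blast
  qed
  have bdd_add: "bounded_op UNIV norm (\<lambda>x. P x + Q x)"
    if P: "bounded_op UNIV norm P" and Q: "bounded_op UNIV norm Q" for P Q :: "'a \<Rightarrow> 'a"
  proof -
    obtain C where C: "\<And>x. norm (P x) \<le> C * norm x"
      using bounded_opE[OF P] by auto
    obtain C' where C': "\<And>x. norm (Q x) \<le> C' * norm x"
      using bounded_opE[OF Q] by auto
    have "norm (P x + Q x) \<le> (C + C') * norm x" for x
      using norm_triangle_ineq[of "P x" "Q x"] C[of x] C'[of x] by (simp add: distrib_right)
    then show ?thesis
      using P Q by (auto simp: bounded_op_def clinear_on_def scaleC_add_right)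
  qed
  have "analytic_semigroup UNIV norm \<theta> U"
    unfolding analytic_semigroup_def
  proof (intro conjI ballI)
    show "bounded_op UNIV norm (U z)" if "z \<in> insert 0 (sector \<theta>)" for z
      unfolding U_def by (rule bdd_scale[OF bdd[OF that]])
    show "U 0 x = x" for x
      by (simp add: U_def T0 scaleC_one)
    show "U (z + w) x = U z (U w x)" if z: "z \<in> sector \<theta>" and w: "w \<in> sector \<theta>" for z w x
    proof -
      have "T z (a *\<^sub>C y) = a *\<^sub>C T z y" for a y
        using bdd[of z] z by (simp add: bounded_op_def clinear_on_def)
      then show ?thesis
        by (simp add: U_def semi z w scaleC_scaleC exp_add distrib_left)
    qed
    show "\<exists>L. bounded_op UNIV norm L \<and> (\<forall>\<epsilon>>0. \<forall>\<^sub>F w in at z.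
        \<forall>x\<in>UNIV. norm (inverse (w - z) *\<^sub>C (U w x - U z x) - L x) \<le> \<epsilon> * norm x)"
      if z: "z \<in> sector \<theta>" for z
    proof -
      obtain L where L: "bounded_op UNIV norm L" "\<And>\<epsilon>. \<epsilon> > 0 \<Longrightarrow> \<forall>\<^sub>F w in at z.
          \<forall>x. norm (inverse (w - z) *\<^sub>C (T w x - T z x) - L x) \<le> \<epsilon> * norm x"
        using deriv[OF z] by auto
      have Tz: "bounded_op UNIV norm (T z)" using z by (intro bdd) simp
      show ?thesis
        unfolding U_def
        by (intro exI[of _ "\<lambda>x. exp (c * z) *\<^sub>C L x + (c * exp (c * z)) *\<^sub>C T z x"] conjI
            bdd_add bdd_scale L(1) Tz allI impI)
          (use operator_derivative_exp_scaled[where T = T, OF L(1) Tz L(2)] in simp)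
    qed
    show "((\<lambda>z. norm (U z x - x)) \<longlongrightarrow> 0) (at 0 within sector \<theta>)" for x
    proof -
      have T: "((\<lambda>z. T z x) \<longlongrightarrow> x) (at 0 within sector \<theta>)"
        by (rule LIM_zero_cancel[OF tendsto_norm_zero_cancel[OF cont]])
      have e: "((\<lambda>z. exp (c * z)) \<longlongrightarrow> exp (c * 0)) (at 0 within sector \<theta>)"
        by (intro tendsto_intros)
      have "((\<lambda>z. U z x) \<longlongrightarrow> exp (c * 0) *\<^sub>C x) (at 0 within sector \<theta>)"
        unfolding U_def by (rule tendsto_scaleC[OF e T])
      then have "((\<lambda>z. U z x) \<longlongrightarrow> x) (at 0 within sector \<theta>)"
        by (simp add: scaleC_one)
      then show ?thesis by (rule tendsto_norm_zero[OF LIM_zero])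
    qed
  qed
  moreover have "is_generator UNIV norm U S A"
    unfolding is_generator_def
  proof (intro allI)
    fix x y
    have "((\<lambda>t. norm ((1 / t) *\<^sub>R (U (of_real t) x - x) - y)) \<longlongrightarrow> 0) (at_right 0)
      \<longleftrightarrow> ((\<lambda>t. norm ((1 / t) *\<^sub>R (T (of_real t) x - x) - (y - c *\<^sub>C x))) \<longlongrightarrow> 0) (at_right 0)" (is "?l \<longleftrightarrow> ?r")
    proof
      assume ?l
      from right_derivative_exp_scaled[OF this, of "- c"] show ?r
        by (simp add: U_def scaleC_scaleC scaleC_one scaleC_minus_left flip: exp_add)
    next
      assume ?r
      from right_derivative_exp_scaled[OF this, of c] show ?l
        by (simp add: U_def)
    qed
    moreover have "(x \<in> S \<and> y - c *\<^sub>C x = A x - c *\<^sub>C x)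
        \<longleftrightarrow> ((\<lambda>t. norm ((1 / t) *\<^sub>R (T (of_real t) x - x) - (y - c *\<^sub>C x))) \<longlongrightarrow> 0) (at_right 0)"
      using gen[unfolded is_generator_def, rule_format, of x "y - c *\<^sub>C x"] by blast
    ultimately show "(x \<in> S \<and> y = A x) \<longleftrightarrow> (x \<in> UNIV \<and> y \<in> UNIV \<and>
        ((\<lambda>t. norm ((1 / t) *\<^sub>R (U (of_real t) x - x) - y)) \<longlongrightarrow> 0) (at_right 0))"
      by simp
  qed
  ultimately show ?thesis
    using \<theta> unfolding generates_analytic_semigroup_def by blast
qed

text \<open>The final statement speaks of a carrier set with its own norm, the generation theory of
  a whole Hilbert space type; an isometric linear bijection identifies the two.\<close>

lemma generates_transport:
  fixes \<Phi> :: "'b::complex_vector \<Rightarrow> 'a::chilbert_space"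
  assumes gen: "generates_analytic_semigroup UNIV norm S' B"
    and lin: "clinear_on X \<Phi>" and bij: "bij_betw \<Phi> X UNIV"
    and N: "\<And>x. x \<in> X \<Longrightarrow> N x = norm (\<Phi> x)"
    and S: "S = {x\<in>X. \<Phi> x \<in> S'}"
    and A: "\<And>x. x \<in> S \<Longrightarrow> A x \<in> X \<and> \<Phi> (A x) = B (\<Phi> x)"
  shows "generates_analytic_semigroup X N S A"
proof -
  obtain \<theta> T where \<theta>: "0 < \<theta>" "\<theta> \<le> pi / 2"
    and an: "analytic_semigroup UNIV norm \<theta> T"
    and gen: "is_generator UNIV norm T S' B"
    using gen by (auto simp: generates_analytic_semigroup_def)
  define \<Psi> where "\<Psi> = inv_into X \<Phi>"
  have \<Psi>_in: "\<Psi> y \<in> X" and \<Phi>\<Psi>: "\<Phi> (\<Psi> y) = y" for y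
    using bij by (auto simp: \<Psi>_def bij_betw_def inv_into_into f_inv_into_f)
  have inj: "x = x'" if "\<Phi> x = \<Phi> x'" "x \<in> X" "x' \<in> X" for x x'
    using bij that by (auto simp: bij_betw_def inj_on_def)
  have sub: "complex_vector.subspace X"
    using lin by (simp add: clinear_on_def)
  have X_add: "x + y \<in> X" and X_diff: "x - y \<in> X" if "x \<in> X" "y \<in> X" for x y
    using sub that complex_vector.subspace_add complex_vector.subspace_diff by blast+
  have X_scale: "a *\<^sub>C x \<in> X" if "x \<in> X" for x a
    using sub that complex_vector.subspace_scale by blast
  have \<Phi>_add: "\<Phi> (x + y) = \<Phi> x + \<Phi> y" if "x \<in> X" "y \<in> X" for x y
    using lin that by (auto simp: clinear_on_def)
  have \<Phi>_scale: "\<Phi> (a *\<^sub>C x) = a *\<^sub>C \<Phi> x" if "x \<in> X" for x a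
    using lin that by (auto simp: clinear_on_def)
  have \<Phi>_diff: "\<Phi> (x - y) = \<Phi> x - \<Phi> y" if "x \<in> X" "y \<in> X" for x y
    using \<Phi>_add[OF X_diff[OF that] that(2)] by simp
  define U where "U z x = \<Psi> (T z (\<Phi> x))" for z x
  have U_in: "U z x \<in> X" and \<Phi>U: "\<Phi> (U z x) = T z (\<Phi> x)" for z x
    by (simp_all add: U_def \<Psi>_in \<Phi>\<Psi>)
  have bdd: "bounded_op X N (\<lambda>x. \<Psi> (P (\<Phi> x)))" if P: "bounded_op UNIV norm P" for P
  proof -
    obtain C where C: "\<And>x. norm (P x) \<le> C * norm x"
      using bounded_opE[OF P] by auto
    have "clinear_on X (\<lambda>x. \<Psi> (P (\<Phi> x)))"
      unfolding clinear_on_def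
    proof (intro conjI ballI allI sub)
      show "\<Psi> (P (\<Phi> (x + y))) = \<Psi> (P (\<Phi> x)) + \<Psi> (P (\<Phi> y))" if "x \<in> X" "y \<in> X" for x y
        by (rule inj) (use P that in \<open>auto simp: \<Phi>\<Psi> \<Phi>_add \<Psi>_in X_add bounded_op_def clinear_on_def\<close>)
      show "\<Psi> (P (\<Phi> (c *\<^sub>C x))) = c *\<^sub>C \<Psi> (P (\<Phi> x))" if "x \<in> X" for c x
        by (rule inj) (use P that in \<open>auto simp: \<Phi>\<Psi> \<Phi>_scale \<Psi>_in X_scale bounded_op_def clinear_on_def\<close>)
    qed
    then show ?thesis
      unfolding bounded_op_def using C by (auto simp: N \<Psi>_in \<Phi>\<Psi>)
  qed
  have "analytic_semigroup X N \<theta> U"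
    unfolding analytic_semigroup_def
  proof (intro conjI ballI)
    show "bounded_op X N (U z)" if "z \<in> insert 0 (sector \<theta>)" for z
      using an that unfolding U_def analytic_semigroup_def by (intro bdd) blast
    show "U 0 x = x" if "x \<in> X" for x
      by (rule inj) (use that an in \<open>auto simp: \<Phi>U U_in analytic_semigroup_def\<close>)
    show "U (z + w) x = U z (U w x)" if "z \<in> sector \<theta>" "w \<in> sector \<theta>" "x \<in> X" for z w x
      by (rule inj) (use that an in \<open>auto simp: \<Phi>U U_in analytic_semigroup_def\<close>)
    show "\<exists>L. bounded_op X N L \<and> (\<forall>\<epsilon>>0. \<forall>\<^sub>F w in at z.
        \<forall>x\<in>X. N (inverse (w - z) *\<^sub>C (U w x - U z x) - L x) \<le> \<epsilon> * N x)"
      if z: "z \<in> sector \<theta>" for z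
    proof -
      obtain L where L: "bounded_op UNIV norm L" "\<And>\<epsilon>. \<epsilon> > 0 \<Longrightarrow> \<forall>\<^sub>F w in at z.
          \<forall>x\<in>UNIV. norm (inverse (w - z) *\<^sub>C (T w x - T z x) - L x) \<le> \<epsilon> * norm x"
        using an z unfolding analytic_semigroup_def by blast
      have eq: "N (inverse (w - z) *\<^sub>C (U w x - U z x) - \<Psi> (L (\<Phi> x)))
          = norm (inverse (w - z) *\<^sub>C (T w (\<Phi> x) - T z (\<Phi> x)) - L (\<Phi> x))" if "x \<in> X" for w x
        by (simp add: N X_diff X_scale U_in \<Psi>_in \<Phi>_diff \<Phi>_scale \<Phi>U \<Phi>\<Psi>)
      have "\<forall>\<^sub>F w in at z. \<forall>x\<in>X. N (inverse (w - z) *\<^sub>C (U w x - U z x) - \<Psi> (L (\<Phi> x))) \<le> \<epsilon> * N x"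
        if "\<epsilon> > 0" for \<epsilon>
        using L(2)[OF that] by (rule eventually_mono) (simp add: eq N)
      then show ?thesis using bdd[OF L(1)] by blast
    qed
    show "((\<lambda>z. N (U z x - x)) \<longlongrightarrow> 0) (at 0 within sector \<theta>)" if x: "x \<in> X" for x
    proof -
      have "N (U z x - x) = norm (T z (\<Phi> x) - \<Phi> x)" for z
        by (simp add: N X_diff U_in x \<Phi>_diff \<Phi>U)
      then show ?thesis using an by (simp add: analytic_semigroup_def)
    qed
  qed
  moreover have "is_generator X N U S A"
    unfolding is_generator_def
  proof (intro allI)
    fix x y
    show "(x \<in> S \<and> y = A x) \<longleftrightarrow> (x \<in> X \<and> y \<in> X \<and>
        ((\<lambda>t. N ((1 / t) *\<^sub>R (U (of_real t) x - x) - y)) \<longlongrightarrow> 0) (at_right 0))"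
    proof (cases "x \<in> X \<and> y \<in> X")
      case True
      have "N ((1 / t) *\<^sub>R (U (of_real t) x - x) - y) = norm ((1 / t) *\<^sub>R (T (of_real t) (\<Phi> x) - \<Phi> x) - \<Phi> y)" for t
        using True by (simp add: scaleR_scaleC N X_diff X_scale U_in \<Phi>_diff \<Phi>_scale \<Phi>U)
      moreover have "(\<Phi> x \<in> S' \<and> \<Phi> y = B (\<Phi> x)) \<longleftrightarrow>
          ((\<lambda>t. norm ((1 / t) *\<^sub>R (T (of_real t) (\<Phi> x) - \<Phi> x) - \<Phi> y)) \<longlongrightarrow> 0) (at_right 0)"
        using gen unfolding is_generator_def by simp
      moreover have "(x \<in> S \<and> y = A x) \<longleftrightarrow> (\<Phi> x \<in> S' \<and> \<Phi> y = B (\<Phi> x))"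
        using True A[of x] inj[of y "A x"] by (auto simp: S)
      ultimately show ?thesis using True by simp
    next
      case False
      then show ?thesis using A[of x] by (auto simp: S)
    qed
  qed
  ultimately show ?thesis
    using \<theta> unfolding generates_analytic_semigroup_def by blast
qed

section \<open>Operators bounded below up to finitely many functionals\<close>

text \<open>On the set where \<open>s p \<le> 1\<close> the functionals \<open>cinner p\<close> are
  bounded at each point of \<open>range M\<close>, as
  \<open>cinner p (M v) = cinner (M p) v\<close>, and at each point of \<open>B\<close>; hence at
  every point of the span, which is everything, and uniform boundedness applies.\<close>

lemma finite_codim_range_bound:
  fixes M :: "'a::chilbert_space \<Rightarrow> 'a"
  assumes lin: "clinear_on UNIV M"
    and sym: "\<And>x y. cinner (M x) y = cinner x (M y)"
    and B: "finite B" "UNIV \<subseteq> complex_vector.span (range M \<union> B)"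
  obtains C where "C > 0" "\<And>p. norm p \<le> C * (norm (M p) + (\<Sum>b\<in>B. cmod (cinner p b)))"
proof -
  define s where "s p = norm (M p) + (\<Sum>b\<in>B. cmod (cinner p b))" for p
  have s_nonneg: "s p \<ge> 0" for p
    by (simp add: s_def sum_nonneg)
  have s_scale: "s (of_real r *\<^sub>C p) = \<bar>r\<bar> * s p" for r p
  proof -
    have "M (of_real r *\<^sub>C p) = of_real r *\<^sub>C M p"
      using lin by (simp add: clinear_on_def)
    then show ?thesis
      unfolding s_def distrib_left sum_distrib_left cinner_scaleC_left norm_mult by (simp add: norm_scaleC)
  qed
  have "\<exists>K. \<forall>p\<in>{p. s p \<le> 1}. cmod (cinner p y) \<le> K" for y
  proof -
    have "y \<in> complex_vector.span (range M \<union> B)" using B(2) by blast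
    then show ?thesis
    proof (induction rule: complex_vector.span_induct)
      case base
      show ?case
        unfolding complex_vector.subspace_def
      proof (intro conjI ballI allI)
        show "0 \<in> {a. \<exists>K. \<forall>p\<in>{p. s p \<le> 1}. cmod (cinner p a) \<le> K}"
          by (auto intro!: exI[of _ 0])
      next
        fix a b
        assume "a \<in> {a. \<exists>K. \<forall>p\<in>{p. s p \<le> 1}. cmod (cinner p a) \<le> K}"
          "b \<in> {a. \<exists>K. \<forall>p\<in>{p. s p \<le> 1}. cmod (cinner p a) \<le> K}"
        then obtain K K' where "\<And>p. s p \<le> 1 \<Longrightarrow> cmod (cinner p a) \<le> K" "\<And>p. s p \<le> 1 \<Longrightarrow> cmod (cinner p b) \<le> K'"
          by auto
        then have "\<forall>p\<in>{p. s p \<le> 1}. cmod (cinner p (a + b)) \<le> K + K'"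
          unfolding cinner_add_right by (auto intro: norm_triangle_mono)
        then show "a + b \<in> {a. \<exists>K. \<forall>p\<in>{p. s p \<le> 1}. cmod (cinner p a) \<le> K}" by blast
      next
        fix c a
        assume "a \<in> {a. \<exists>K. \<forall>p\<in>{p. s p \<le> 1}. cmod (cinner p a) \<le> K}"
        then obtain K where "\<And>p. s p \<le> 1 \<Longrightarrow> cmod (cinner p a) \<le> K"
          by auto
        then have "\<forall>p\<in>{p. s p \<le> 1}. cmod (cinner p (c *\<^sub>C a)) \<le> cmod c * K"
          unfolding cinner_scaleC_right norm_mult by (auto intro: mult_left_mono)
        then show "c *\<^sub>C a \<in> {a. \<exists>K. \<forall>p\<in>{p. s p \<le> 1}. cmod (cinner p a) \<le> K}" by blast
      qed
    next
      case (step x)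
      then consider v where "x = M v" | "x \<in> B" by blast
      then show ?case
      proof cases
        case 1
        have "cmod (cinner p x) \<le> norm v" if "s p \<le> 1" for p
        proof -
          have "norm (M p) \<le> 1"
            using that sum_nonneg[of B "\<lambda>b. cmod (cinner p b)"] by (simp add: s_def)
          have "cmod (cinner p x) \<le> norm (M p) * norm v"
            unfolding 1 sym[symmetric] by (rule cmod_cinner_le)
          also have "\<dots> \<le> 1 * norm v"
            using \<open>norm (M p) \<le> 1\<close> by (intro mult_right_mono) auto
          finally show ?thesis by simp
        qed
        then show ?thesis by blast
      next
        case 2
        have "cmod (cinner p x) \<le> 1" if "s p \<le> 1" for p
        proof -
          have "cmod (cinner p x) \<le> (\<Sum>b\<in>B. cmod (cinner p b))"
            using member_le_sum[of x B "\<lambda>b. cmod (cinner p b)"] 2 B(1) by simp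
          then show ?thesis using that norm_ge_zero[of "M p"] unfolding s_def by linarith
        qed
        then show ?thesis by blast
      qed
    qed
  qed
  then obtain K where K: "\<And>p. s p \<le> 1 \<Longrightarrow> norm p \<le> K"
    using cinner_bounded_imp_norm_bounded[of "{p. s p \<le> 1}"] by auto
  have "norm p \<le> (\<bar>K\<bar> + 1) * s p" for p
  proof (rule field_le_epsilon)
    fix e :: real assume e: "e > 0"
    \<comment> \<open>The positive summand allows division even when \<open>s p = 0\<close>, and
      contributes just \<open>e\<close> in the end.\<close>
    define d where "d = s p + e / (\<bar>K\<bar> + 1)"
    have "\<bar>K\<bar> + 1 > 0" by simp
    then have K1: "\<bar>K\<bar> + 1 \<noteq> 0" by linarith
    have "e / (\<bar>K\<bar> + 1) > 0" using e by (simp add: add_nonneg_pos)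
    then have d: "d > 0" "s p \<le> d" using s_nonneg[of p] by (auto simp: d_def)
    then have "s (of_real (1 / d) *\<^sub>C p) \<le> 1"
      unfolding s_scale by (simp add: divide_le_eq)
    from K[OF this] have "norm p / d \<le> K"
      using d by (simp add: norm_scaleC norm_divide)
    then have "norm p \<le> K * d"
      using d by (simp add: divide_le_eq)
    also have "\<dots> \<le> (\<bar>K\<bar> + 1) * d"
      using d by (intro mult_right_mono) auto
    also have "\<dots> = (\<bar>K\<bar> + 1) * s p + e"
      unfolding d_def distrib_left using K1 by simp
    finally show "norm p \<le> (\<bar>K\<bar> + 1) * s p + e" .
  qed
  then show thesis
    using that[of "\<bar>K\<bar> + 1"] unfolding s_def by (simp add: add_nonneg_pos)
qed

text \<open>The form is nonnegative at \<open>p - (1 / m) M p\<close>; expanding it and estimating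
  the quadratic term by \<open>M_bound\<close>-type continuity leaves the claim.\<close>

lemma nonneg_symmetric_bound:
  fixes M :: "'a::chilbert_space \<Rightarrow> 'a"
  assumes lin: "clinear_on UNIV M"
    and sym: "\<And>x y. cinner (M x) y = cinner x (M y)"
    and nonneg: "\<And>x. Re (cinner (M x) x) \<ge> 0"
    and bound: "\<And>x. norm (M x) \<le> m * norm x" and "m > 0"
  shows "(norm (M p))\<^sup>2 \<le> m * Re (cinner (M p) p)"
proof -
  define t where "t = 1 / m"
  have t: "t > 0" "t * m = 1" using \<open>m > 0\<close> by (auto simp: t_def)
  have "M (p - of_real t *\<^sub>C M p) + M (of_real t *\<^sub>C M p) = M p"
    using lin unfolding clinear_on_def by (metis UNIV_I diff_add_cancel)
  moreover have "M (of_real t *\<^sub>C M p) = of_real t *\<^sub>C M (M p)"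
    using lin by (simp add: clinear_on_def)
  ultimately have "M (p - of_real t *\<^sub>C M p) = M p - of_real t *\<^sub>C M (M p)"
    by (simp add: eq_diff_eq)
  then have "0 \<le> Re (cinner (M p - of_real t *\<^sub>C M (M p)) (p - of_real t *\<^sub>C M p))"
    using nonneg[of "p - of_real t *\<^sub>C M p"] by simp
  also have "\<dots> = Re (cinner (M p) p) - t * Re (cinner (M p) (M p)) - t * Re (cinner (M (M p)) p)
      + t * t * Re (cinner (M (M p)) (M p))"
    unfolding cinner_diff_left cinner_diff_right cinner_scaleC_left cinner_scaleC_right
    by (simp add: right_diff_distrib)
  also have "cinner (M (M p)) p = cinner (M p) (M p)" by (rule sym)
  finally have pos: "0 \<le> Re (cinner (M p) p) - 2 * t * (norm (M p))\<^sup>2 + t * t * Re (cinner (M (M p)) (M p))"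
    by (simp add: cinner_self del: of_real_power)
  have "Re (cinner (M (M p)) (M p)) \<le> m * (norm (M p))\<^sup>2"
  proof -
    have "Re (cinner (M (M p)) (M p)) \<le> norm (M (M p)) * norm (M p)" by (rule Re_cinner_le)
    also have "\<dots> \<le> m * norm (M p) * norm (M p)" by (intro mult_right_mono bound) simp
    finally show ?thesis by (simp add: power2_eq_square)
  qed
  then have "t * t * Re (cinner (M (M p)) (M p)) \<le> t * t * (m * (norm (M p))\<^sup>2)"
    using t(1) by (intro mult_left_mono) auto
  moreover have "t * t * (m * (norm (M p))\<^sup>2) = t * (norm (M p))\<^sup>2"
    using t(2) by (metis mult.assoc mult_1_right)
  ultimately have "t * (norm (M p))\<^sup>2 \<le> Re (cinner (M p) p)"
    using pos by linarith
  then show ?thesis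
    using \<open>m > 0\<close> by (simp add: t_def divide_le_eq mult.commute)
qed

section \<open>The damped second order system in energy coordinates\<close>

text \<open>\<open>K\<close> is the bounded inverse of \<open>R\<close> on all of H,
  \<open>M\<close> the sandwich of the damping, and \<open>B\<close> witnesses that
  \<open>range M\<close> has finite codimension. With \<open>K\<close> and \<open>M\<close> bounded
  and everywhere defined, unboundedness is confined to \<open>R\<close>.\<close>

locale damped_system =
  fixes V :: "'h::chilbert_space set" and R K M :: "'h \<Rightarrow> 'h" and k m :: real and B :: "'h set"
  assumes R_self_adjoint: "self_adjoint V R"
    and K_in: "\<And>y. K y \<in> V" and RK: "\<And>y. R (K y) = y" and KR: "\<And>x. x \<in> V \<Longrightarrow> K (R x) = x"
    and K_bound: "\<And>y. norm (K y) \<le> k * norm y"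
    and M_linear: "clinear_on UNIV M"
    and M_sym: "\<And>x y. cinner (M x) y = cinner x (M y)"
    and M_nonneg: "\<And>x. Re (cinner (M x) x) \<ge> 0"
    and M_bound: "\<And>x. norm (M x) \<le> m * norm x" and m_pos: "m > 0"
    and B: "finite B" "UNIV \<subseteq> complex_vector.span (range M \<union> B)"
begin

lemma V_subspace: "complex_vector.subspace V"
  and V_dense: "closure V = UNIV"
  using R_self_adjoint by (auto simp: self_adjoint_def clinear_on_def)

lemma V_add: "x \<in> V \<Longrightarrow> y \<in> V \<Longrightarrow> x + y \<in> V"
  and V_scale: "x \<in> V \<Longrightarrow> c *\<^sub>C x \<in> V"
  and V_0: "0 \<in> V"
  using V_subspace complex_vector.subspace_add complex_vector.subspace_scale
    complex_vector.subspace_0 by blast+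

lemma R_add: "x \<in> V \<Longrightarrow> y \<in> V \<Longrightarrow> R (x + y) = R x + R y"
  and R_scale: "x \<in> V \<Longrightarrow> R (c *\<^sub>C x) = c *\<^sub>C R x"
  using R_self_adjoint by (auto simp: self_adjoint_def clinear_on_def)

lemma R_sym: "x \<in> V \<Longrightarrow> y \<in> V \<Longrightarrow> cinner (R x) y = cinner x (R y)"
  using R_self_adjoint unfolding self_adjoint_def by blast

lemma M_add: "M (x + y) = M x + M y"
  and M_scale: "M (c *\<^sub>C x) = c *\<^sub>C M x"
  using M_linear by (auto simp: clinear_on_def)

lemma M_diff: "M (x - y) = M x - M y"
  using M_add[of "x - y" y] by simp

lemma K_sym: "cinner (K x) y = cinner x (K y)"
  by (metis R_sym K_in RK)

lemma K_add: "K (x + y) = K x + K y"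
  by (metis KR K_in RK R_add V_add)

lemma K_diff: "K (x - y) = K x - K y"
  using K_add[of "x - y" y] by simp

lemma K_scale: "K (c *\<^sub>C x) = c *\<^sub>C K x"
  by (metis KR K_in RK R_scale V_scale)

text \<open>The energy coordinates are \<open>(x, w) = (R z, w)\<close>, where \<open>M\<close> stands for the sandwich of \<open>D\<close>.\<close>

definition dom :: "('h \<times> 'h) set" where
  "dom = {(x, w). w \<in> V \<and> x + M (R w) \<in> V}"

definition gen :: "'h \<times> 'h \<Rightarrow> 'h \<times> 'h" where
  "gen = (\<lambda>(x, w). (R w, - R (x + M (R w))))"

lemma dom_iff: "(x, w) \<in> dom \<longleftrightarrow> w \<in> V \<and> x + M (R w) \<in> V"
  by (simp add: dom_def)

lemma gen_linear: "clinear_on dom gen"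
  unfolding clinear_on_def complex_vector.subspace_def
proof (intro conjI ballI allI)
  have add: "(x + x') + M (R (w + w')) = (x + M (R w)) + (x' + M (R w'))" if "w \<in> V" "w' \<in> V" for x x' w w'
    by (simp add: that R_add M_add)
  have scale: "c *\<^sub>C x + M (R (c *\<^sub>C w)) = c *\<^sub>C (x + M (R w))" if "w \<in> V" for c x w
    by (simp add: that R_scale M_scale scaleC_add_right)
  have "R 0 = 0" "M 0 = 0"
    using R_scale[OF V_0, of 0] M_scale[of 0 0] by simp_all
  then show "0 \<in> dom"
    by (simp add: zero_prod_def dom_iff V_0)
  show "u + v \<in> dom" if "u \<in> dom" "v \<in> dom" for u v
    using that by (cases u; cases v) (simp add: dom_iff V_add add)
  show "c *\<^sub>C u \<in> dom" if "u \<in> dom" for c u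
    using that by (cases u) (simp add: dom_iff scaleC_prod_def V_scale scale)
  show "gen (u + v) = gen u + gen v" if "u \<in> dom" "v \<in> dom" for u v
  proof -
    obtain x w x' w' where uv: "u = (x, w)" "v = (x', w')" by (cases u, cases v)
    have "R (x + x' + M (R (w + w'))) = R (x + M (R w)) + R (x' + M (R w'))"
      using that by (subst add) (auto simp: uv dom_iff R_add)
    then show ?thesis
      using that by (simp add: uv dom_iff gen_def R_add)
  qed
  show "gen (c *\<^sub>C u) = c *\<^sub>C gen u" if "u \<in> dom" for c u
  proof -
    obtain x w where u: "u = (x, w)" by (cases u)
    have "R (c *\<^sub>C x + M (R (c *\<^sub>C w))) = c *\<^sub>C R (x + M (R w))"
      using that by (subst scale) (auto simp: u dom_iff R_scale)
    then show ?thesis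
      using that by (simp add: u dom_iff gen_def scaleC_prod_def R_scale scaleC_minus_right)
  qed
qed

lemma V_approx: "e > 0 \<Longrightarrow> \<exists>v\<in>V. dist v y < e"
  using V_dense closure_approachable[of y V] by simp

lemma dom_dense: "closure dom = UNIV"
proof -
  have "\<exists>u\<in>dom. dist u (x, w) < e" if e: "e > 0" for x w e
  proof -
    obtain w' where w': "w' \<in> V" "dist w' w < e / 2"
      using V_approx[of "e / 2" w] e by auto
    \<comment> \<open>The first component is corrected only after \<open>w'\<close> is fixed, since
      \<open>M (R w')\<close> need not depend continuously on \<open>w'\<close>.\<close>
    obtain v where v: "v \<in> V" "dist v (x + M (R w')) < e / 2"
      using V_approx[of "e / 2" "x + M (R w')"] e by auto
    have "(v - M (R w'), w') \<in> dom" using w' v by (simp add: dom_iff)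
    moreover have "dist (v - M (R w'), w') (x, w) < e"
    proof -
      have "dist (v - M (R w'), w') (x, w) \<le> dist (v - M (R w')) x + dist w' w"
        unfolding dist_Pair_Pair by (rule sqrt_sum_squares_le_sum) auto
      also have "dist (v - M (R w')) x = dist v (x + M (R w'))"
        by (simp only: dist_norm diff_diff_eq add.commute)
      finally show ?thesis using w' v by simp
    qed
    ultimately show ?thesis by blast
  qed
  then have "u \<in> closure dom" for u
    unfolding closure_approachable by (cases u) blast
  then show ?thesis by blast
qed

text \<open>For vectors in \<open>V\<close> symmetry moves \<open>R\<close> to the other side,
  \<open>cinner (R w) (\<beta> b) = cinner w (R (\<beta> b))\<close>, which \<open>norm w\<close>
  controls; hence the approximation of \<open>B\<close> from \<open>V\<close>.\<close>

lemma R_bound: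
  obtains C1 C2 where "C1 \<ge> 1" "C2 \<ge> 0"
    "\<And>w. w \<in> V \<Longrightarrow> (norm (R w))\<^sup>2 \<le> C1 * Re (cinner (M (R w)) (R w)) + C2 * (norm w)\<^sup>2"
proof -
  obtain C where C: "C > 0" "\<And>p. norm p \<le> C * (norm (M p) + (\<Sum>b\<in>B. cmod (cinner p b)))"
    using finite_codim_range_bound[OF M_linear M_sym B] by blast
  \<comment> \<open>Chosen so that the approximation errors of all \<open>b\<close> together cost at
    most half of \<open>norm (R w)\<close>, which is absorbed on the left; the summand 1 covers
    empty \<open>B\<close>.\<close>
  define \<eta> where "\<eta> = 1 / (2 * C * (card B + 1))"
  have \<eta>: "\<eta> > 0" using C by (simp add: \<eta>_def)
  have C\<eta>: "C * (card B * \<eta>) \<le> 1 / 2"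
    using C by (simp add: \<eta>_def divide_le_eq)
  have "\<exists>\<beta>. \<beta> \<in> V \<and> norm (b - \<beta>) \<le> \<eta>" for b
    using V_approx[OF \<eta>, of b] by (auto simp: dist_norm norm_minus_commute intro: less_imp_le)
  then obtain \<beta> where \<beta>: "\<And>b. \<beta> b \<in> V" "\<And>b. norm (b - \<beta> b) \<le> \<eta>" by metis
  define \<sigma> where "\<sigma> = (\<Sum>b\<in>B. norm (R (\<beta> b)))"
  have \<sigma>: "\<sigma> \<ge> 0" by (simp add: \<sigma>_def sum_nonneg)
  have bound: "norm (R w) \<le> 2 * C * norm (M (R w)) + 2 * C * \<sigma> * norm w" if w: "w \<in> V" for w
  proof -
    have "cmod (cinner (R w) b) \<le> \<eta> * norm (R w) + norm (R (\<beta> b)) * norm w" for b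
    proof -
      have "cinner (R w) b = cinner (R w) (b - \<beta> b) + cinner w (R (\<beta> b))"
        using R_sym[OF w \<beta>(1)] by (simp add: cinner_diff_right)
      also have "cmod \<dots> \<le> norm (R w) * norm (b - \<beta> b) + norm w * norm (R (\<beta> b))"
        by (intro norm_triangle_mono cmod_cinner_le)
      also have "\<dots> \<le> norm (R w) * \<eta> + norm w * norm (R (\<beta> b))"
        by (intro add_right_mono mult_left_mono \<beta>) simp
      finally show ?thesis by (simp add: mult.commute)
    qed
    then have "(\<Sum>b\<in>B. cmod (cinner (R w) b)) \<le> (\<Sum>b\<in>B. \<eta> * norm (R w) + norm (R (\<beta> b)) * norm w)"
      by (rule sum_mono)
    also have "\<dots> = card B * \<eta> * norm (R w) + \<sigma> * norm w"
      by (simp add: sum.distrib \<sigma>_def sum_distrib_right)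
    finally have "C * (norm (M (R w)) + (\<Sum>b\<in>B. cmod (cinner (R w) b)))
        \<le> C * (norm (M (R w)) + (card B * \<eta> * norm (R w) + \<sigma> * norm w))"
      using C(1) by (intro mult_left_mono) auto
    with C(2)[of "R w"] have "norm (R w) \<le> C * norm (M (R w)) + C * (card B * \<eta>) * norm (R w) + C * \<sigma> * norm w"
      by (simp add: distrib_left mult.assoc)
    moreover have "C * (card B * \<eta>) * norm (R w) \<le> 1 / 2 * norm (R w)"
      by (rule mult_right_mono[OF C\<eta>]) simp
    ultimately show ?thesis by simp
  qed
  show thesis
  proof (rule that)
    \<comment> \<open>The 8 is \<open>2 * 2\<^sup>2\<close>, from squaring a sum of two terms with
      coefficient \<open>2 * C\<close>; the summand 1 secures \<open>C1 \<ge> 1\<close>, used when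
      the sector is read off.\<close>
    show "8 * C\<^sup>2 * m + 1 \<ge> 1" "8 * C\<^sup>2 * \<sigma>\<^sup>2 \<ge> 0" using m_pos by simp_all
    fix w assume w: "w \<in> V"
    let ?p = "R w"
    have "(norm ?p)\<^sup>2 \<le> (2 * C * norm (M ?p) + 2 * C * \<sigma> * norm w)\<^sup>2"
      by (intro power_mono bound w) simp
    also have "\<dots> \<le> 2 * (2 * C * norm (M ?p))\<^sup>2 + 2 * (2 * C * \<sigma> * norm w)\<^sup>2"
      using zero_le_power2[of "2 * C * norm (M ?p) - 2 * C * \<sigma> * norm w"]
      unfolding power2_diff power2_sum by linarith
    also have "\<dots> = 8 * C\<^sup>2 * (norm (M ?p))\<^sup>2 + 8 * C\<^sup>2 * \<sigma>\<^sup>2 * (norm w)\<^sup>2"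
      by (simp add: power_mult_distrib)
    also have "8 * C\<^sup>2 * (norm (M ?p))\<^sup>2 \<le> 8 * C\<^sup>2 * (m * Re (cinner (M ?p) ?p))"
      by (intro mult_left_mono nonneg_symmetric_bound M_linear M_sym M_nonneg M_bound m_pos) simp
    also have "\<dots> \<le> (8 * C\<^sup>2 * m + 1) * Re (cinner (M ?p) ?p)"
      using M_nonneg[of ?p] by (simp add: distrib_right mult.assoc)
    finally show "(norm ?p)\<^sup>2 \<le> (8 * C\<^sup>2 * m + 1) * Re (cinner (M ?p) ?p) + 8 * C\<^sup>2 * \<sigma>\<^sup>2 * (norm w)\<^sup>2"
      by simp
  qed
qed

lemma Im_M: "Im (cinner (M p) p) = 0"
proof -
  have "cinner (M p) p = cnj (cinner (M p) p)"
    by (metis M_sym cinner_commute)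
  then show ?thesis by (metis complex_cnj_cancel_iff Reals_cnj_iff complex_is_Real_iff)
qed

text \<open>The coupling between \<open>x\<close> and \<open>w\<close> is skew-symmetric and
  contributes only an imaginary part; the real part is the damping.\<close>

lemma cinner_gen:
  assumes "(x, w) \<in> dom"
  shows "Re (cinner (gen (x, w)) (x, w)) = - Re (cinner (M (R w)) (R w))"
    and "Im (cinner (gen (x, w)) (x, w)) = 2 * Im (cinner (R w) x)"
proof -
  have "cinner (gen (x, w)) (x, w) = cinner (R w) x - cinner x (R w) - cinner (M (R w)) (R w)"
    using assms R_sym[of "x + M (R w)" w]
    by (simp add: gen_def dom_iff cinner_prod_def cinner_minus_left cinner_add_left)
  moreover have "cinner x (R w) = cnj (cinner (R w) x)" by (rule cinner_commute)
  ultimately show "Re (cinner (gen (x, w)) (x, w)) = - Re (cinner (M (R w)) (R w))"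
    and "Im (cinner (gen (x, w)) (x, w)) = 2 * Im (cinner (R w) x)"
    by (simp_all add: Im_M)
qed

text \<open>
  Eliminating \<open>x\<close> from the resolvent equation leaves the equation
  \<open>(\<lambda> K\<^sup>2 + 1/\<lambda> + M) p = K g - f/\<lambda>\<close> for \<open>p = R w\<close>.
\<close>

lemma gen_onto:
  assumes "Re \<mu> > 0"
  obtains u where "u \<in> dom" "\<mu> *\<^sub>C u - gen u = (f, g)"
proof -
  have \<mu>: "\<mu> \<noteq> 0" using assms by auto
  \<comment> \<open>Coercivity comes from the term \<open>inverse \<mu> *\<^sub>C p\<close>; the
    real parts of the other two terms are nonnegative.\<close>
  define \<delta> where "\<delta> = Re (inverse \<mu>)"
  have \<delta>: "\<delta> > 0" using assms by (simp add: \<delta>_def cmod_power2[symmetric] \<mu>)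
  define Q where "Q p = \<mu> *\<^sub>C K (K p) + inverse \<mu> *\<^sub>C p + M p" for p
  have "\<exists>p. Q p = K g - inverse \<mu> *\<^sub>C f"
  proof (rule coercive_surj[of Q "cmod \<mu> * (\<bar>k\<bar> * \<bar>k\<bar>) + cmod (inverse \<mu>) + m" \<delta>])
    show "Q (x - y) = Q x - Q y" for x y
      by (simp add: Q_def K_diff M_diff scaleC_diff_right)
    show "norm (Q x) \<le> (cmod \<mu> * (\<bar>k\<bar> * \<bar>k\<bar>) + cmod (inverse \<mu>) + m) * norm x" for x
    proof -
      have K': "norm (K y) \<le> \<bar>k\<bar> * norm y" for y
        using K_bound[of y] by (smt (verit) mult_right_mono norm_ge_zero)
      have "norm (K (K x)) \<le> \<bar>k\<bar> * (\<bar>k\<bar> * norm x)"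
        using K'[of "K x"] mult_left_mono[OF K'[of x], of "\<bar>k\<bar>"] by simp
      then have "cmod \<mu> * norm (K (K x)) \<le> cmod \<mu> * (\<bar>k\<bar> * (\<bar>k\<bar> * norm x))"
        by (rule mult_left_mono) simp
      moreover have "norm (Q x) \<le> cmod \<mu> * norm (K (K x)) + cmod (inverse \<mu>) * norm x + norm (M x)"
        unfolding Q_def norm_scaleC[symmetric]
        by (rule order_trans[OF norm_triangle_ineq add_right_mono[OF norm_triangle_ineq]])
      ultimately show ?thesis
        using M_bound[of x] unfolding distrib_right mult.assoc by linarith
    qed
    show "\<delta> * (norm x)\<^sup>2 \<le> Re (cinner (Q x) x)" for x
    proof -
      have "cinner (K (K x)) x = of_real ((norm (K x))\<^sup>2)"
        by (simp only: K_sym[of "K x"] cinner_self)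
      then have "Re (cinner (Q x) x) = Re \<mu> * (norm (K x))\<^sup>2 + \<delta> * (norm x)\<^sup>2 + Re (cinner (M x) x)"
        by (simp add: Q_def cinner_add_left cinner_scaleC_left cinner_self \<delta>_def del: of_real_power)
      then show ?thesis using M_nonneg[of x] assms by simp
    qed
  qed (use \<delta> in blast)+
  then obtain p where p: "Q p = K g - inverse \<mu> *\<^sub>C f" by blast
  let ?w = "K p" and ?x = "inverse \<mu> *\<^sub>C (f + p)"
  \<comment> \<open>The first row of the resolvent equation determines \<open>?x\<close>; this
    identity is the second row with \<open>K\<close> applied, and it shows at once that the sum lies
    in \<open>V\<close>.\<close>
  have x: "?x + M (R ?w) = K (g - \<mu> *\<^sub>C ?w)"
    using p by (simp add: Q_def RK K_diff K_scale scaleC_add_right algebra_simps)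
  show thesis
  proof (rule that[of "(?x, ?w)"])
    show "(?x, ?w) \<in> dom"
      by (simp only: dom_iff x K_in)
    have "gen (?x, ?w) = (p, - (g - \<mu> *\<^sub>C ?w))"
      unfolding gen_def prod.case x by (simp only: RK)
    then show "\<mu> *\<^sub>C (?x, ?w) - gen (?x, ?w) = (f, g)"
      using \<mu> by (simp add: scaleC_prod_def scaleC_scaleC scaleC_one)
  qed
qed

lemma generates: "generates_analytic_semigroup UNIV norm dom gen"
proof -
  obtain C1 C2 where C: "C1 \<ge> 1" "C2 \<ge> 0"
    "\<And>w. w \<in> V \<Longrightarrow> (norm (R w))\<^sup>2 \<le> C1 * Re (cinner (M (R w)) (R w)) + C2 * (norm w)\<^sup>2"
    using R_bound by blast
  \<comment> \<open>The shift has to absorb both \<open>C2 * (norm w)\<^sup>2\<close> and the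
    \<open>(norm x)\<^sup>2\<close> that arises from splitting the product
    \<open>norm (R w) * norm x\<close>.\<close>
  define c where "c = C2 + 1"
  interpret shifted: sectorial_operator dom "\<lambda>u. gen u - of_real c *\<^sub>C u" "1 / C1"
  proof
    show "1 / C1 > 0" using C by simp
    show "clinear_on dom (\<lambda>u. gen u - of_real c *\<^sub>C u)"
      using gen_linear by (auto simp: clinear_on_def scaleC_add_right scaleC_diff_right scaleC_scaleC mult.commute)
    show "closure dom = UNIV" by (rule dom_dense)
  next
    fix z u assume z: "z \<in> slope_sector (1 / C1)" and u: "u \<in> dom"
    obtain x w where xw: "u = (x, w)" by (cases u)
    define a where "a = cinner (gen u) u"
    \<comment> \<open>\<open>- q\<close> is the real part of the form of the translated operator.
      The bound of \<open>Im a\<close> by \<open>C1 * q\<close> puts the numerical range into a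
      sector, and the slope \<open>1 / C1\<close> is dual to it.\<close>
    define q where "q = Re (cinner (M (R w)) (R w)) + c * (norm u)\<^sup>2"
    have Re_z: "Re z > 0" and Im_z: "\<bar>Im z\<bar> * C1 \<le> Re z"
      using slope_sector_Re_pos[OF z] z C(1) by (auto simp: slope_sector_def field_simps)
    have n: "(norm u)\<^sup>2 = (norm x)\<^sup>2 + (norm w)\<^sup>2" by (simp add: xw norm_Pair)
    have w: "w \<in> V" using u by (simp add: xw dom_iff)
    have Im_a: "\<bar>Im a\<bar> \<le> C1 * q"
    proof -
      have "\<bar>Im a\<bar> \<le> 2 * (norm (R w) * norm x)"
        using cinner_gen(2)[of x w] u abs_Im_le_cmod[of "cinner (R w) x"] cmod_cinner_le[of "R w" x]
        by (simp add: a_def xw)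
      also have "\<dots> \<le> (norm (R w))\<^sup>2 + (norm x)\<^sup>2"
        using zero_le_power2[of "norm (R w) - norm x"] unfolding power2_diff by simp
      also have "\<dots> \<le> C1 * Re (cinner (M (R w)) (R w)) + C2 * (norm w)\<^sup>2 + (norm x)\<^sup>2"
        using C(3)[OF w] by simp
      finally have 1: "\<bar>Im a\<bar> \<le> C1 * Re (cinner (M (R w)) (R w)) + C2 * (norm w)\<^sup>2 + (norm x)\<^sup>2" .
      have "C2 * (norm w)\<^sup>2 + (norm x)\<^sup>2 \<le> c * (norm u)\<^sup>2"
        unfolding n c_def using C(2) by (simp add: algebra_simps)
      moreover have "1 * (c * (norm u)\<^sup>2) \<le> C1 * (c * (norm u)\<^sup>2)"
        using C by (intro mult_right_mono) (auto simp: c_def)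
      ultimately show ?thesis
        using 1 unfolding q_def distrib_left by linarith
    qed
    have q: "q \<ge> 0" using M_nonneg[of "R w"] C by (simp add: q_def c_def)
    have "Re (z * cinner (gen u - of_real c *\<^sub>C u) u) = - Re z * q - Im z * Im a"
      using cinner_gen(1)[of x w] u
      by (simp add: cinner_diff_left cinner_scaleC_left cinner_self a_def q_def xw algebra_simps del: of_real_power)
    also have "\<dots> \<le> - Re z * q + \<bar>Im z\<bar> * (C1 * q)"
    proof -
      have "- (Im z * Im a) \<le> \<bar>Im z\<bar> * \<bar>Im a\<bar>"
        by (metis abs_ge_minus_self abs_mult)
      also have "\<dots> \<le> \<bar>Im z\<bar> * (C1 * q)" by (intro mult_left_mono Im_a) simp
      finally show ?thesis by simp
    qed
    also have "\<dots> \<le> - Re z * q + Re z * q"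
      using mult_right_mono[OF Im_z q] by (simp add: mult.assoc)
    finally show "Re (z * cinner (gen u - of_real c *\<^sub>C u) u) \<le> 0" by simp
  next
    fix z and y :: "'h \<times> 'h"
    assume z: "z \<in> slope_sector (1 / C1)"
    have Re_z: "Re z > 0" using slope_sector_Re_pos[OF z] C by simp
    then have z0: "z \<noteq> 0" by auto
    \<comment> \<open>Dividing the equation for \<open>z\<close> by \<open>z\<close> gives the
      resolvent equation of \<open>gen\<close> at \<mu>.\<close>
    define \<mu> where "\<mu> = inverse z + of_real c"
    have "Re (inverse z) > 0" using Re_z z0 by (simp add: cmod_power2[symmetric])
    then have "Re \<mu> > 0" using C by (simp add: \<mu>_def c_def)
    obtain f g where "inverse z *\<^sub>C y = (f, g)" by (cases "inverse z *\<^sub>C y")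
    then obtain u where u: "u \<in> dom" "\<mu> *\<^sub>C u - gen u = inverse z *\<^sub>C y"
      using gen_onto[OF \<open>Re \<mu> > 0\<close>, of f g] by metis
    have "z *\<^sub>C (\<mu> *\<^sub>C u - gen u) = y"
      using z0 by (simp add: u scaleC_scaleC scaleC_one)
    moreover have "z *\<^sub>C (\<mu> *\<^sub>C u - gen u) = u - z *\<^sub>C (gen u - of_real c *\<^sub>C u)"
      using z0 by (simp add: \<mu>_def scaleC_diff_right scaleC_scaleC scaleC_one distrib_left scaleC_add_left scaleC_add_right)
    ultimately show "\<exists>u\<in>dom. u - z *\<^sub>C (gen u - of_real c *\<^sub>C u) = y"
      using u(1) by auto
  qed
  show ?thesis by (rule generates_shift[OF shifted.generates])
qed

end

section \<open>Generation on \<open>H\<^bsub>1/2\<^esub> \<times> H\<close>\<close>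

text \<open>
  Off the range of \<open>f\<close> the inverse \<open>inv_into S f\<close> is a constant, and a linear map of this kind
  forces \<open>S\<close> to be trivial.
\<close>

lemma linear_inv_into_imp_surj:
  assumes inv: "clinear_on UNIV (inv_into S f)" and f: "clinear_on S f" "inj_on f S" and "S \<noteq> {0}"
  shows "f ` S = UNIV"
proof (rule ccontr)
  assume "f ` S \<noteq> UNIV"
  then obtain y where y: "y \<notin> f ` S" by blast
  let ?T = "inv_into S f"
  have add: "?T (a + b) = ?T a + ?T b" for a b
    using inv by (simp add: clinear_on_def)
  have const: "?T a = ?T y" if "a \<notin> f ` S" for a
  proof -
    have "(\<lambda>x. x \<in> S \<and> f x = a) = (\<lambda>x. x \<in> S \<and> f x = y)" using that y by auto
    then show ?thesis by (simp add: inv_into_def)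
  qed
  have sub: "complex_vector.subspace S" using f by (simp add: clinear_on_def)
  \<comment> \<open>Off the range the inverse is constant, so its value at \<open>y\<close> equals
    its own double and is 0.\<close>
  have "y + y \<notin> f ` S"
  proof
    assume "y + y \<in> f ` S"
    then obtain s where s: "s \<in> S" "f s = y + y" by auto
    have "f ((1/2) *\<^sub>C s) = (1/2) *\<^sub>C (y + y)"
      using f s by (simp add: clinear_on_def)
    also have "\<dots> = y"
      by (simp add: scaleC_add_right scaleC_one flip: scaleC_add_left)
    finally show False
      using y s(1) complex_vector.subspace_scale[OF sub] by (metis image_eqI)
  qed
  then have Ty: "?T y = 0" using const[of "y + y"] add[of y y] by simp
  have "s = 0" if s: "s \<in> S" for s
  proof -
    \<comment> \<open>Adding \<open>y\<close> moves any value \<open>f s\<close> off the range, and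
      additivity then forces \<open>s = 0\<close>.\<close>
    have "y + f s \<notin> f ` S"
    proof
      assume "y + f s \<in> f ` S"
      then obtain r where r: "r \<in> S" "f r = y + f s" by auto
      have d: "r - s \<in> S" using r s sub complex_vector.subspace_diff by blast
      have "f r = f (r - s) + f s"
        using f d s unfolding clinear_on_def by (metis diff_add_cancel)
      then have "f (r - s) = y" using r by simp
      then show False using y d by blast
    qed
    then have "0 = ?T y + ?T (f s)" using const[of "y + f s"] Ty add by metis
    then show ?thesis using Ty f s by simp
  qed
  then have "S = {0}" using complex_vector.subspace_0[OF sub] by blast
  then show False using \<open>S \<noteq> {0}\<close> by blast
qed

theorem theorem4p1:
  fixes dom_A0 V :: "'h::chilbert_space set"
    and A0 R :: "'h \<Rightarrow> 'h"
    and D :: "'h \<Rightarrow> 'h \<Rightarrow> complex"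
  assumes infinite_dim: "\<not> fin_dim (UNIV :: 'h set)"
    and A0_self_adjoint: "self_adjoint dom_A0 A0"
    and A0_uniformly_positive: "uniformly_positive dom_A0 A0"
    and sqrt_A0: "is_sqrt_op V R dom_A0 A0"
    and D_bounded: "bounded_half_to_dual V R D"
    and sandwich_bounded: "bounded_op UNIV norm (sandwich V R D)"
    and sandwich_self_adjoint: "self_adjoint UNIV (sandwich V R D)"
    and D_nonneg: "\<And>z. z \<in> V \<Longrightarrow> D z z \<in> \<real>\<^sub>\<ge>\<^sub>0"
    and A0_inv_compact: "compact_op (inv_into dom_A0 A0)"
    and zero_not_ess: "0 \<notin> ess_spectrum V V (A0_inv_D V R D)"
  shows "generates_analytic_semigroup (state_space V) (state_norm R)
           (block_dom V R D) (block_op V R D)"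
proof -
  have R_sa: "self_adjoint V R" and dom_A0: "dom_A0 = {x\<in>V. R x \<in> V}"
    and A0: "\<And>x. x \<in> dom_A0 \<Longrightarrow> A0 x = R (R x)"
    using sqrt_A0 by (auto simp: is_sqrt_op_def)
  have V: "complex_vector.subspace V" and V_dense: "closure V = UNIV"
    and R_add: "\<And>x y. x \<in> V \<Longrightarrow> y \<in> V \<Longrightarrow> R (x + y) = R x + R y"
    and R_scale: "\<And>c x. x \<in> V \<Longrightarrow> R (c *\<^sub>C x) = c *\<^sub>C R x"
    and R_adj: "\<And>y z. (y \<in> V \<and> z = R y) \<longleftrightarrow> (\<forall>x\<in>V. cinner (R x) y = cinner x z)"
    using R_sa by (auto simp: self_adjoint_def clinear_on_def)
  obtain \<epsilon> where \<epsilon>: "\<epsilon> > 0" "\<And>x. x \<in> dom_A0 \<Longrightarrow> \<epsilon> * (norm x)\<^sup>2 \<le> Re (cinner (A0 x) x)"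
    using A0_uniformly_positive by (auto simp: uniformly_positive_def)
  have A0_linear: "clinear_on dom_A0 A0" and dom_A0_dense: "closure dom_A0 = UNIV"
    using A0_self_adjoint by (auto simp: self_adjoint_def)

  \<comment> \<open>Invertibility of A0 and of its square root\<close>
  have A0_bound: "norm x \<le> norm (A0 x) / \<epsilon>" if "x \<in> dom_A0" for x
  proof (cases "x = 0")
    case False
    have "\<epsilon> * norm x * norm x \<le> norm (A0 x) * norm x"
      using \<epsilon>(2)[OF that] Re_cinner_le[of "A0 x" x] by (simp add: power2_eq_square)
    then have "\<epsilon> * norm x \<le> norm (A0 x)"
      by (rule mult_right_le_imp_le) (use False in simp)
    then show ?thesis using \<epsilon>(1) by (simp add: le_divide_eq mult.commute)
  qed (use \<epsilon> in simp)
  have A0_inj: "inj_on A0 dom_A0"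
  proof (rule inj_onI)
    fix x y assume xy: "x \<in> dom_A0" "y \<in> dom_A0" "A0 x = A0 y"
    have d: "x - y \<in> dom_A0"
      using A0_linear xy complex_vector.subspace_diff unfolding clinear_on_def by blast
    have "A0 (x - y) + A0 y = A0 x"
      using A0_linear d xy(2) unfolding clinear_on_def by (metis diff_add_cancel)
    then have "A0 (x - y) = 0" using xy by simp
    then show "x = y" using A0_bound[OF d] by simp
  qed
  \<comment> \<open>If the domain were trivial, so would be its closure, the whole space, against
    infinite dimension.\<close>
  have "dom_A0 \<noteq> {0}"
  proof
    assume "dom_A0 = {0}"
    then have "(UNIV :: 'h set) \<subseteq> complex_vector.span {}"
      using dom_A0_dense by (simp add: complex_vector.span_zero)
    then show False using infinite_dim unfolding fin_dim_def by blast
  qed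
  \<comment> \<open>\<open>compact_op\<close> contains linearity of
    \<open>inv_into dom_A0 A0\<close> on all of H, which leaves no point outside the range.\<close>
  then have A0_surj: "A0 ` dom_A0 = UNIV"
    using A0_inv_compact A0_linear A0_inj by (intro linear_inv_into_imp_surj) (auto simp: compact_op_def)

  have R_surj: "\<exists>x\<in>V. R x = y" for y
  proof -
    obtain x where "x \<in> dom_A0" "A0 x = y" using A0_surj by (metis UNIV_I imageE)
    then show ?thesis using A0[of x] dom_A0 by auto
  qed
  have R_inj: "inj_on R V"
  proof (rule inj_onI)
    fix x y assume xy: "x \<in> V" "y \<in> V" "R x = R y"
    have d: "x - y \<in> V" using xy V complex_vector.subspace_diff by blast
    have "R (x - y) = 0" using R_add[OF d xy(2)] xy(3) by simp
    moreover have "0 \<in> V" using V complex_vector.subspace_0 by blast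
    moreover have "R 0 = 0" using R_scale[OF \<open>0 \<in> V\<close>, of 0] by simp
    ultimately have "x - y \<in> dom_A0" "A0 (x - y) = 0"
      using d A0[of "x - y"] by (auto simp: dom_A0)
    then show "x = y" using A0_bound[of "x - y"] by simp
  qed
  define K where "K = inv_into V R"
  have K_in: "K y \<in> V" and RK: "R (K y) = y" for y
  proof -
    have "y \<in> R ` V" using R_surj[of y] by auto
    then show "K y \<in> V" "R (K y) = y"
      unfolding K_def by (rule inv_into_into, rule f_inv_into_f)
  qed
  have KR: "K (R x) = x" if "x \<in> V" for x
    using that R_inj by (simp add: K_def)
  have R_sym: "cinner (R x) y = cinner x (R y)" if "x \<in> V" "y \<in> V" for x y
    using R_adj[of y "R y"] that by blast
  \<comment> \<open>Two applications of \<open>K\<close> invert \<open>A0\<close>, and that inverse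
    is bounded by \<open>1 / \<epsilon>\<close>; the bound for \<open>K\<close> is the square
    root.\<close>
  have K_bound: "norm (K y) \<le> sqrt (1 / \<epsilon>) * norm y" for y
  proof -
    have KK: "K (K y) \<in> dom_A0" "A0 (K (K y)) = y"
      using A0[of "K (K y)"] by (simp_all add: dom_A0 K_in RK)
    have "(norm (K y))\<^sup>2 = Re (cinner (K (K y)) y)"
      using arg_cong[OF R_sym[OF K_in K_in, of "K y" y], of Re]
      by (simp add: RK cinner_self del: of_real_power)
    also have "\<dots> \<le> norm (K (K y)) * norm y" by (rule Re_cinner_le)
    also have "\<dots> \<le> norm y / \<epsilon> * norm y"
      using A0_bound[OF KK(1)] KK(2) by (intro mult_right_mono) auto
    also have "\<dots> = (sqrt (1 / \<epsilon>) * norm y)\<^sup>2"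
      unfolding power_mult_distrib using \<epsilon>(1) by (simp add: power2_eq_square)
    finally show ?thesis
      by (rule power2_le_imp_le) (use \<epsilon>(1) in simp)
  qed

  \<comment> \<open>The damping operator transferred to H\<close>
  define M where "M = sandwich V R D"
  have sqrt_ext_inj: "h = h'" if "sqrt_ext V R h = sqrt_ext V R h'" for h h'
  proof (rule cinner_eqI)
    fix y
    show "cinner h y = cinner h' y"
      using fun_cong[OF that, of "K y"] by (simp add: sqrt_ext_def K_in RK)
  qed
  have D_dual: "D x \<in> dual_space V R" if "x \<in> V" for x
    using D_bounded that by (auto simp: bounded_half_to_dual_def)
  have K_add: "K (x + y) = K x + K y" for x y
    by (metis KR K_in RK R_add V complex_vector.subspace_add)
  have K_scale: "K (c *\<^sub>C x) = c *\<^sub>C K x" for c x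
    by (metis KR K_in RK R_scale V complex_vector.subspace_scale)
  \<comment> \<open>The inverse of \<open>sqrt_ext V R\<close> in \<open>sandwich\<close> is
    meaningful only on its range; Riesz, applied after transport by \<open>K\<close>, shows that
    each \<open>D x\<close> lies there.\<close>
  have D_sqrt_ext: "\<exists>h. D x = sqrt_ext V R h" if x: "x \<in> V" for x
  proof -
    have add: "\<And>u v. u \<in> V \<Longrightarrow> v \<in> V \<Longrightarrow> D x (u + v) = D x u + D x v"
      and scale: "\<And>c u. u \<in> V \<Longrightarrow> D x (c *\<^sub>C u) = cnj c * D x u"
      and zero: "\<And>u. u \<notin> V \<Longrightarrow> D x u = 0"
      using D_dual[OF x] by (auto simp: dual_space_def)
    obtain C where C: "\<And>u. u \<in> V \<Longrightarrow> cmod (D x u) \<le> C * half_norm R u"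
      using D_dual[OF x] unfolding dual_space_def by blast
    have "\<exists>h. \<forall>y. D x (K y) = cinner h y"
    proof (rule riesz_representation[of "\<lambda>y. D x (K y)" C])
      show "D x (K (u + v)) = D x (K u) + D x (K v)" for u v
        by (simp add: K_add add K_in)
      show "D x (K (c *\<^sub>C u)) = cnj c * D x (K u)" for c u
        by (simp add: K_scale scale K_in)
      show "cmod (D x (K u)) \<le> C * norm u" for u
        using C[OF K_in, of u] by (simp add: half_norm_def RK)
    qed blast
    then obtain h where h: "\<And>y. D x (K y) = cinner h y" by blast
    have "D x v = sqrt_ext V R h v" for v
      using h[of "R v"] by (cases "v \<in> V") (simp_all add: KR sqrt_ext_def zero)
    then show ?thesis by blast
  qed
  have DM: "D x = sqrt_ext V R (M (R x))" if x: "x \<in> V" for x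
  proof -
    obtain h where h: "D x = sqrt_ext V R h" using D_sqrt_ext[OF x] by blast
    have "inj (sqrt_ext V R)" using sqrt_ext_inj by (rule injI)
    then have "M (R x) = h"
      using h x by (simp add: M_def sandwich_def KR[unfolded K_def])
    then show ?thesis using h by simp
  qed
  have M_linear: "clinear_on UNIV M"
    using sandwich_bounded by (simp add: M_def bounded_op_def)
  obtain m where m: "\<And>x. norm (M x) \<le> m * norm x" "m \<ge> 0"
    using bounded_opE[OF sandwich_bounded] unfolding M_def by auto
  \<comment> \<open>The enlarged constant is strictly positive, as \<open>damped_system\<close>
    demands.\<close>
  have M_bound: "norm (M x) \<le> (m + 1) * norm x" for x
    using m(1)[of x] by (simp add: distrib_right add_increasing2)
  have M_sym: "cinner (M x) y = cinner x (M y)" for x y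
    using sandwich_self_adjoint unfolding M_def self_adjoint_def by blast
  have M_nonneg: "Re (cinner (M y) y) \<ge> 0" for y
  proof -
    have "D (K y) (K y) = cinner (M y) y"
      by (simp add: DM K_in RK sqrt_ext_def)
    then show ?thesis using D_nonneg[OF K_in, of y] by (auto simp: complex_nonneg_Reals_iff)
  qed

  \<comment> \<open>So \<open>R\<close> conjugates \<open>A0_inv_D V R D\<close> into
    \<open>M\<close>, and finite codimension of the range carries over.\<close>
  have A0_inv_D: "A0_inv_D V R D x = K (M (R x))" if x: "x \<in> V" for x
  proof -
    have inj: "inj_on (A0_ext V R) V"
      using R_inj sqrt_ext_inj unfolding A0_ext_def inj_on_def by blast
    have "A0_ext V R (K (M (R x))) = D x"
      by (simp add: A0_ext_def RK DM x)
    then show ?thesis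
      unfolding A0_inv_D_def using inv_into_f_f[OF inj K_in] by metis
  qed
  have "fredholm V V (\<lambda>x. A0_inv_D V R D x - 0 *\<^sub>C x)"
    using zero_not_ess by (simp add: ess_spectrum_def)
  then obtain B where B: "finite B" "B \<subseteq> V"
    "V \<subseteq> complex_vector.span ((\<lambda>x. A0_inv_D V R D x) ` V \<union> B)"
    by (auto simp: fredholm_def fin_codim_def)
  have codim: "UNIV \<subseteq> complex_vector.span (range M \<union> R ` B)"
  proof
    fix y
    have "K y \<in> complex_vector.span ((\<lambda>x. A0_inv_D V R D x) ` V \<union> B)"
      using B(3) K_in by blast
    \<comment> \<open>Membership in \<open>V\<close> is carried through the induction because
      \<open>R\<close> is known to be linear only there.\<close>
    then have "K y \<in> V \<and> R (K y) \<in> complex_vector.span (range M \<union> R ` B)"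
    proof (induction rule: complex_vector.span_induct)
      case base
      have "0 \<in> V" using V complex_vector.subspace_0 by blast
      then have "R 0 = 0" using R_scale[of 0 0] by simp
      with \<open>0 \<in> V\<close> show ?case
        unfolding complex_vector.subspace_def
        using V by (auto simp: R_add R_scale complex_vector.subspace_add complex_vector.subspace_scale
            complex_vector.span_zero complex_vector.span_add complex_vector.span_scale)
    next
      case (step x)
      then show ?case
        using B(2) by (auto simp: A0_inv_D K_in RK intro: complex_vector.span_base)
    qed
    then show "y \<in> complex_vector.span (range M \<union> R ` B)" by (simp add: RK)
  qed

  interpret damped: damped_system V R K M "sqrt (1 / \<epsilon>)" "m + 1" "R ` B"
    using R_sa K_in RK KR K_bound M_linear M_sym M_nonneg M_bound m(2) B(1) codim
    by unfold_locales auto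

  \<comment> \<open>Identification of the block operator in energy coordinates\<close>
  have embed_inj: "inj (embed V)"
  proof (rule injI)
    fix h h' assume eq: "embed V h = embed V h'"
    have "cinner (h - h') v = 0" if "v \<in> V" for v
      using fun_cong[OF eq, of v] that by (simp add: embed_def cinner_diff_left)
    then have "h - h' = 0" by (rule dense_cinner_zero[OF V_dense])
    then show "h = h'" by simp
  qed
  \<comment> \<open>Self-adjointness in graph form: the functional of \<open>q\<close> is
    represented in H exactly if \<open>q\<close> lies in the domain of the adjoint of
    \<open>R\<close>, that is in \<open>V\<close>.\<close>
  have embed_iff: "sqrt_ext V R q = embed V h \<longleftrightarrow> q \<in> V \<and> h = R q" for q h
  proof -
    have "sqrt_ext V R q = embed V h \<longleftrightarrow> (\<forall>v\<in>V. cinner q (R v) = cinner h v)"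
      by (auto simp: fun_eq_iff sqrt_ext_def embed_def)
    also have "\<dots> \<longleftrightarrow> (\<forall>v\<in>V. cinner (R v) q = cinner v h)"
      by (metis cinner_commute complex_cnj_cancel_iff)
    finally show ?thesis using R_adj[of q h] by simp
  qed
  have ext: "(\<lambda>v. A0_ext V R z v + D w v) = sqrt_ext V R (R z + M (R w))" if "z \<in> V" "w \<in> V" for z w
    by (auto simp: DM that A0_ext_def sqrt_ext_def cinner_add_left)
  have block_dom: "(z, w) \<in> block_dom V R D \<longleftrightarrow> z \<in> V \<and> w \<in> V \<and> R z + M (R w) \<in> V" for z w
    using embed_iff[of "R z + M (R w)"] by (auto simp: block_dom_def ext)
  have block_op: "block_op V R D (z, w) = (w, - R (R z + M (R w)))" if "(z, w) \<in> block_dom V R D" for z w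
  proof -
    have zw: "z \<in> V" "w \<in> V" "R z + M (R w) \<in> V" using that by (simp_all add: block_dom)
    have "(\<lambda>v. - A0_ext V R z v - D w v) = (\<lambda>v. - embed V (R (R z + M (R w))) v)"
      using fun_cong[OF ext[OF zw(1,2)]] embed_iff[of "R z + M (R w)" "R (R z + M (R w))"] zw(3)
      by (auto simp: fun_eq_iff algebra_simps)
    also have "\<dots> = embed V (- R (R z + M (R w)))"
      by (auto simp: embed_def cinner_minus_left)
    finally show ?thesis by (simp add: block_op_def embed_inj)
  qed

  show ?thesis
  proof (rule generates_transport[OF damped.generates, where \<Phi> = "\<lambda>(z, w). (R z, w)"])
    show "clinear_on (state_space V) (\<lambda>(z, w). (R z, w))"
      using V unfolding clinear_on_def complex_vector.subspace_def state_space_def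
      by (auto simp: zero_prod_def scaleC_prod_def R_add R_scale)
    show "bij_betw (\<lambda>(z, w). (R z, w)) (state_space V) UNIV"
      by (rule bij_betw_byWitness[where f' = "\<lambda>(x, w). (K x, w)"])
        (auto simp: state_space_def KR RK K_in)
    show "state_norm R p = norm (case p of (z, w) \<Rightarrow> (R z, w))" if "p \<in> state_space V" for p
      by (cases p) (simp add: state_norm_def half_norm_def norm_Pair)
    show "block_dom V R D = {p \<in> state_space V. (case p of (z, w) \<Rightarrow> (R z, w)) \<in> damped.dom}"
      by (auto simp: block_dom damped.dom_iff state_space_def)
    show "block_op V R D p \<in> state_space V \<and>
        (case block_op V R D p of (z, w) \<Rightarrow> (R z, w)) = damped.gen (case p of (z, w) \<Rightarrow> (R z, w))"
      if "p \<in> block_dom V R D" for p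
      using that by (cases p) (simp add: block_op state_space_def block_dom damped.gen_def)
  qed
qed

end
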